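(* Let $\mathfrak g$ be a simple Lie algebra and let $\mathfrak g^\vee$ be the Langlands dual Lie algebra. Then $\mathcal S_{\mathfrak g}(q)=\mathcal S_{\mathfrak g^\vee}(q)$. In particular, the simple root statistic has the same distribution for types $\mathbf B_p$ and $\mathbf C_p$, i.e. $\#\mathfrak{Ad}(\mathbf B_p)_i=\#\mathfrak{Ad}(\mathbf C_p)_i$ for all $i$.
   Context: For a simple Lie algebra $\mathfrak g$ of rank $p$ with root system $\Delta$, positive roots $\Delta^+$ and simple roots $\Pi$, an $\mathsf{ad}$-nilpotent ideal is a subset $I\subset\Delta^+$ such that $\gamma\in I$, $\nu\in\Delta^+$, $\gamma+\nu\in\Delta$ imply $\gamma+\nu\in I$. $\mathfrak{Ad}(\mathfrak g)$ is the set of all of them; $\mathfrak{Ad}(\mathfrak g)_i=\{I\in\mathfrak{Ad}(\mathfrak g)\mid\#(I\cap\Pi)=i\}$, and $\mathcal S_{\mathfrak g}(q)=\sum_{i=0}^p\#(\mathfrak{Ad}(\mathfrak g)_i)\,q^i$ (the distribution of the simple root statistic $I\mapsto\#(I\cap\Pi)$). The Langlands dual $\mathfrak g^\vee$ is the simple Lie algebra whose root system is the dual root system $\Delta^\vee=\{2\mu/(\mu,\mu)\mid\mu\in\Delta\}$. *)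

theory Defs
  imports "HOL-Analysis.Analysis" "HOL-Computational_Algebra.Polynomial"
begin

text \<open>
  A simple complex Lie algebra enters only through its root system. By the Cartan--Killing
  classification these root systems are exactly the irreducible reduced crystallographic ones, and
  they determine the Lie algebra up to isomorphism. A simple Lie algebra of rank \<open>p\<close> is
  therefore represented by such a \<open>\<Delta>\<close> spanning a Euclidean space of dimension \<open>p\<close>.
\<close>

definition coroot :: "'a::euclidean_space \<Rightarrow> 'a" where
  "coroot \<mu> = (2 / (\<mu> \<bullet> \<mu>)) *\<^sub>R \<mu>"

definition reflection :: "'a::euclidean_space \<Rightarrow> 'a \<Rightarrow> 'a" where
  "reflection \<alpha> v = v - (v \<bullet> coroot \<alpha>) *\<^sub>R \<alpha>"

definition root_system :: "'a::euclidean_space set \<Rightarrow> bool" where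
  "root_system \<Delta> \<longleftrightarrow>
     finite \<Delta> \<and> 0 \<notin> \<Delta> \<and> span \<Delta> = UNIV \<and>
     (\<forall>\<alpha>\<in>\<Delta>. \<forall>\<beta>\<in>\<Delta>. reflection \<alpha> \<beta> \<in> \<Delta>) \<and>
     (\<forall>\<alpha>\<in>\<Delta>. \<forall>\<beta>\<in>\<Delta>. \<beta> \<bullet> coroot \<alpha> \<in> \<int>) \<and>
     (\<forall>\<alpha>\<in>\<Delta>. \<forall>c. c *\<^sub>R \<alpha> \<in> \<Delta> \<longrightarrow> c = 1 \<or> c = -1)"

definition irreducible_root_system :: "'a::euclidean_space set \<Rightarrow> bool" where
  "irreducible_root_system \<Delta> \<longleftrightarrow>
     root_system \<Delta> \<and>
     \<not> (\<exists>A B. A \<noteq> {} \<and> B \<noteq> {} \<and> A \<union> B = \<Delta> \<and> A \<inter> B = {} \<and>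
              (\<forall>\<alpha>\<in>A. \<forall>\<beta>\<in>B. \<alpha> \<bullet> \<beta> = 0))"

definition dual_roots :: "'a::euclidean_space set \<Rightarrow> 'a set" where
  "dual_roots \<Delta> = coroot ` \<Delta>"

definition positive_roots :: "'a::euclidean_space set \<Rightarrow> 'a set \<Rightarrow> 'a set" where
  "positive_roots \<Delta> S = {\<beta> \<in> \<Delta>. \<exists>c :: 'a \<Rightarrow> nat. \<beta> = (\<Sum>\<alpha>\<in>S. real (c \<alpha>) *\<^sub>R \<alpha>)}"

text \<open>
  A choice of positive roots is recorded by its set of simple roots, that is, by a base.
\<close>

definition is_simple_roots :: "'a::euclidean_space set \<Rightarrow> 'a set \<Rightarrow> bool" where
  "is_simple_roots \<Delta> S \<longleftrightarrow>
     S \<subseteq> \<Delta> \<and> independent S \<and> span S = UNIV \<and>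
     (\<forall>\<beta>\<in>\<Delta>. \<beta> \<in> positive_roots \<Delta> S \<or> - \<beta> \<in> positive_roots \<Delta> S)"

definition ad_nilpotent_ideals :: "'a::euclidean_space set \<Rightarrow> 'a set \<Rightarrow> 'a set set" where
  "ad_nilpotent_ideals \<Delta> S =
     {I. I \<subseteq> positive_roots \<Delta> S \<and>
         (\<forall>\<gamma>\<in>I. \<forall>\<nu>\<in>positive_roots \<Delta> S. \<gamma> + \<nu> \<in> \<Delta> \<longrightarrow> \<gamma> + \<nu> \<in> I)}"

definition ad_nilpotent_ideals_with ::
    "'a::euclidean_space set \<Rightarrow> 'a set \<Rightarrow> nat \<Rightarrow> 'a set set" where
  "ad_nilpotent_ideals_with \<Delta> S i = {I \<in> ad_nilpotent_ideals \<Delta> S. card (I \<inter> S) = i}"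

definition simple_root_polynomial :: "'a::euclidean_space set \<Rightarrow> 'a set \<Rightarrow> nat poly" where
  "simple_root_polynomial \<Delta> S =
     (\<Sum>i = 0..dim \<Delta>. monom (card (ad_nilpotent_ideals_with \<Delta> S i)) i)"

text \<open>
  The root systems of types \<open>B\<^sub>p\<close> and \<open>C\<^sub>p\<close> in their standard coordinates, where \<open>p = CARD('n)\<close>.
\<close>

definition type_B_roots :: "(real ^ 'n) set" where
  "type_B_roots =
     {s *\<^sub>R axis i 1 | s i. s \<in> {1, -1}} \<union>
     {s *\<^sub>R axis i 1 + t *\<^sub>R axis j 1 | s t i j. s \<in> {1, -1} \<and> t \<in> {1, -1} \<and> i \<noteq> j}"

definition type_C_roots :: "(real ^ 'n) set" where
  "type_C_roots =
     {s *\<^sub>R axis i 2 | s i. s \<in> {1, -1}} \<union>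
     {s *\<^sub>R axis i 1 + t *\<^sub>R axis j 1 | s t i j. s \<in> {1, -1} \<and> t \<in> {1, -1} \<and> i \<noteq> j}"

end

theory Submission
  imports Defs
begin

text \<open>
  An ideal is the same thing as an up-set of positive roots, and the count does not depend on the
  base, since any two bases are conjugate under reflections. If some permutation of the simple roots
  preserves the angles and makes \<open>norm \<alpha> * norm (\<sigma> \<alpha>)\<close> constant, then \<open>\<alpha> \<mapsto> coroot (\<sigma> \<alpha>)\<close>
  extends to a similarity that carries the root system onto its dual. The identity does this when
  all roots have the same length, and the reversal of the diagram does it when a multiple bond is
  the middle of a path. Positive definiteness of the inner product forces every other
  irreducible diagram to be a path with a double bond at its end, that is, of type B or C;
  there the two root posets are isomorphic although the root systems are not.
\<close>

subsection \<open>Coroots and reflections\<close>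

text \<open>Types B and C of rank at least 3 are the obstacle: no similarity identifies them, so
  ideals must be carried over by a bijection of positive roots that is not additive, and the
  defining condition on sums has to be replaced by one on the order alone. Positive definiteness is
  used through an open half space: the normalised simple roots lie on one side of a hyperplane,
  hence a nonnegative combination of them that is not trivial cannot vanish, whereas each forbidden
  subdiagram supplies one of squared norm at most 0. No list of diagrams is needed. When the simple
  roots have equal length nothing about the diagram is used; otherwise two neighbours of different
  length start two arms, of lengths p and q, which grow until they fill the diagram. With N the
  product of the two Cartan integers at the bond between the arms, strict Cauchy-Schwarz gives N p q
  < (p + 1)(q + 1). Hence N is 2 or 3, and either p = q (B2, G2, F4, settled by exchanging the arms)
  or N = 2 and one arm is a single root (B and C).\<close>

lemma coroot_scaleR: "coroot (c *\<^sub>R v) = (1 / c) *\<^sub>R coroot v"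
  by (cases "c = 0") (auto simp: coroot_def)

lemma coroot_minus: "coroot (- v) = - coroot v"
  using coroot_scaleR[of "-1" v] by simp

lemma coroot_coroot [simp]: "coroot (coroot v) = v"
  by (cases "v = 0") (auto simp: coroot_def)

lemma inner_coroot: "x \<bullet> coroot \<alpha> = 2 * (x \<bullet> \<alpha>) / (\<alpha> \<bullet> \<alpha>)"
  by (simp add: coroot_def)

lemma linear_reflection: "linear (reflection \<alpha>)"
  by (rule linearI) (auto simp: reflection_def inner_add_left algebra_simps)

lemma reflection_self [simp]: "reflection \<alpha> \<alpha> = - \<alpha>"
  by (cases "\<alpha> = 0") (auto simp: reflection_def inner_coroot scaleR_2)

lemma reflection_inner: "reflection \<alpha> x \<bullet> reflection \<alpha> y = x \<bullet> y"
proof (cases "\<alpha> = 0")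
  case False
  then show ?thesis
    by (simp add: reflection_def inner_coroot inner_diff_left inner_diff_right inner_commute
        field_simps power2_eq_square)
qed (simp add: reflection_def)

lemma reflection_reflection [simp]: "reflection \<alpha> (reflection \<alpha> v) = v"
proof -
  have "reflection \<alpha> (reflection \<alpha> v) = reflection \<alpha> v - (v \<bullet> coroot \<alpha>) *\<^sub>R (reflection \<alpha> \<alpha>)"
    by (metis linear_diff linear_reflection linear_scale reflection_def)
  then show ?thesis
    by (simp add: reflection_def)
qed

lemma bij_reflection: "bij (reflection \<alpha>)"
  by (rule involuntory_imp_bij) simp

lemma reflection_scaleR_root:
  assumes "c \<noteq> 0"
  shows "reflection (c *\<^sub>R \<alpha>) v = reflection \<alpha> v"
  using assms by (simp add: reflection_def coroot_scaleR)

lemma reflection_coroot: "reflection (coroot \<alpha>) v = reflection \<alpha> v"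
  by (cases "\<alpha> = 0")
    (simp_all add: coroot_def reflection_scaleR_root)

lemma coroot_reflection: "coroot (reflection \<alpha> \<beta>) = reflection \<alpha> (coroot \<beta>)"
  by (simp add: coroot_def reflection_inner linear_scale[OF linear_reflection])

lemma similarity_reflection:
  assumes "linear \<phi>" "\<And>x y. \<phi> x \<bullet> \<phi> y = k * (x \<bullet> y)" "k \<noteq> 0"
  shows "\<phi> (reflection \<alpha> v) = reflection (\<phi> \<alpha>) (\<phi> v)"
  using assms
  by (simp add: reflection_def linear_diff linear_scale inner_coroot)

subsection \<open>Roots relative to a base\<close>

lemma sum_in_Nats: "(\<And>x. x \<in> A \<Longrightarrow> f x \<in> \<nat>) \<Longrightarrow> sum f A \<in> \<nat>"
  by (induction A rule: infinite_finite_induct) auto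

locale based_root_system =
  fixes \<Delta> S :: "'a::euclidean_space set"
  assumes root_system: "root_system \<Delta>"
    and base: "is_simple_roots \<Delta> S"
begin

abbreviation P where "P \<equiv> positive_roots \<Delta> S"
abbreviation crd where "crd v \<alpha> \<equiv> representation S v \<alpha>"

lemma S_subset: "S \<subseteq> \<Delta>" and indep: "independent S" and span: "span S = UNIV"
  and pos_or_neg: "\<beta> \<in> \<Delta> \<Longrightarrow> \<beta> \<in> P \<or> - \<beta> \<in> P"
  using base by (auto simp: is_simple_roots_def)

lemma finite_roots: "finite \<Delta>" and zero_notin: "0 \<notin> \<Delta>"
  and refl_closed: "\<alpha> \<in> \<Delta> \<Longrightarrow> \<beta> \<in> \<Delta> \<Longrightarrow> reflection \<alpha> \<beta> \<in> \<Delta>"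
  and integral: "\<alpha> \<in> \<Delta> \<Longrightarrow> \<beta> \<in> \<Delta> \<Longrightarrow> \<beta> \<bullet> coroot \<alpha> \<in> \<int>"
  and reduced: "\<alpha> \<in> \<Delta> \<Longrightarrow> c *\<^sub>R \<alpha> \<in> \<Delta> \<Longrightarrow> c = 1 \<or> c = -1"
  using root_system by (auto simp: root_system_def)

lemma finite_S: "finite S"
  using S_subset finite_roots finite_subset by blast

lemma minus_root: "\<beta> \<in> \<Delta> \<Longrightarrow> - \<beta> \<in> \<Delta>"
  using refl_closed[of \<beta> \<beta>] by simp

lemma P_subset: "P \<subseteq> \<Delta>"
  by (auto simp: positive_roots_def)

lemma crd_linear: "linear (\<lambda>v. crd v \<alpha>)"
  using indep span by (intro linearI) (simp_all add: representation_add representation_scale)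

lemma crd_simple: "\<alpha> \<in> S \<Longrightarrow> crd \<alpha> \<beta> = (if \<beta> = \<alpha> then 1 else 0)"
  using real_vector.representation_basis[OF indep] by metis

lemma crd_outside: "\<alpha> \<notin> S \<Longrightarrow> crd v \<alpha> = 0"
  using real_vector.representation_ne_zero by blast

lemma crd_sum: "(\<Sum>\<alpha>\<in>S. crd v \<alpha> *\<^sub>R \<alpha>) = v"
  using real_vector.sum_representation_eq[OF indep _ finite_S] span by blast

lemma crd_of_sum:
  assumes "\<alpha> \<in> S"
  shows "crd (\<Sum>\<beta>\<in>S. c \<beta> *\<^sub>R \<beta>) \<alpha> = c \<alpha>"
proof -
  have "crd (\<Sum>\<beta>\<in>S. c \<beta> *\<^sub>R \<beta>) \<alpha> = (\<Sum>\<beta>\<in>S. c \<beta> * crd \<beta> \<alpha>)"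
    by (simp add: linear_sum[OF crd_linear] linear_scale[OF crd_linear])
  also have "\<dots> = (\<Sum>\<beta>\<in>S. if \<beta> = \<alpha> then c \<beta> else 0)"
    by (rule sum.cong) (auto simp: crd_simple)
  finally show ?thesis
    using assms finite_S by simp
qed

lemma crd_P:
  assumes "\<beta> \<in> P"
  shows "crd \<beta> \<alpha> \<in> \<nat>"
  using assms crd_of_sum[of \<alpha>] crd_outside[of \<alpha>]
  by (cases "\<alpha> \<in> S") (auto simp: positive_roots_def)

lemma crd_P_nonneg: "\<beta> \<in> P \<Longrightarrow> 0 \<le> crd \<beta> \<alpha>"
  using crd_P Nats_induct by (metis Nats_cases of_nat_0_le_iff)

lemma eq_if_crd_eq: "(\<And>\<alpha>. \<alpha> \<in> S \<Longrightarrow> crd v \<alpha> = crd w \<alpha>) \<Longrightarrow> v = w"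
  by (metis (no_types, lifting) crd_sum sum.cong)

text \<open>The coordinates of a root never have mixed signs, so a single positive one decides
  between the root and its negative.\<close>

lemma P_I:
  assumes "\<beta> \<in> \<Delta>" "crd \<beta> \<alpha> > 0"
  shows "\<beta> \<in> P"
proof (rule ccontr)
  assume "\<beta> \<notin> P"
  then have "- \<beta> \<in> P"
    using pos_or_neg assms by blast
  then have "0 \<le> crd (- \<beta>) \<alpha>"
    by (rule crd_P_nonneg)
  then show False
    using assms(2) linear_neg[OF crd_linear] by simp
qed

lemma minus_notin_P:
  assumes "\<beta> \<in> P"
  shows "- \<beta> \<notin> P"
proof
  assume "- \<beta> \<in> P"
  moreover have "crd (- \<beta>) \<alpha> = - crd \<beta> \<alpha>" for \<alpha>
    by (rule linear_neg[OF crd_linear])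
  ultimately have "crd \<beta> \<alpha> = 0" for \<alpha>
    using crd_P_nonneg[of \<beta> \<alpha>] crd_P_nonneg[of "- \<beta>" \<alpha>] assms by simp
  then have "\<beta> = 0"
    using crd_sum[of \<beta>] by simp
  then show False
    using assms P_subset zero_notin by auto
qed

lemma simple_in_P: "\<alpha> \<in> S \<Longrightarrow> \<alpha> \<in> P"
  using P_I[of \<alpha> \<alpha>] S_subset by (auto simp: crd_simple)

lemma root_on_simple_line:
  assumes "\<beta> \<in> P" "\<alpha> \<in> S" "\<And>\<gamma>. \<gamma> \<in> S \<Longrightarrow> \<gamma> \<noteq> \<alpha> \<Longrightarrow> crd \<beta> \<gamma> = 0"
  shows "\<beta> = \<alpha>"
proof -
  have "\<beta> = crd \<beta> \<alpha> *\<^sub>R \<alpha>"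
    by (rule eq_if_crd_eq) (use assms in \<open>auto simp: linear_scale[OF crd_linear] crd_simple\<close>)
  moreover from this have "crd \<beta> \<alpha> = 1 \<or> crd \<beta> \<alpha> = -1"
    using reduced[of \<alpha> "crd \<beta> \<alpha>"] assms S_subset P_subset by auto
  ultimately show ?thesis
    using crd_P_nonneg[OF assms(1), of \<alpha>] by auto
qed

lemma crd_reflection:
  assumes "\<alpha> \<in> S"
  shows "crd (reflection \<alpha> v) \<gamma> = crd v \<gamma> - (if \<gamma> = \<alpha> then v \<bullet> coroot \<alpha> else 0)"
  using assms
  by (simp add: reflection_def linear_diff[OF crd_linear] linear_scale[OF crd_linear] crd_simple)

text \<open>Only the coordinate at \<open>\<alpha>\<close> changes. By reducedness a positive root
  other than \<open>\<alpha>\<close> has a further positive coordinate, which survives and settles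
  the sign.\<close>

lemma reflection_P:
  assumes "\<beta> \<in> P" "\<alpha> \<in> S" "\<beta> \<noteq> \<alpha>"
  shows "reflection \<alpha> \<beta> \<in> P"
proof -
  obtain \<gamma> where \<gamma>: "\<gamma> \<in> S" "\<gamma> \<noteq> \<alpha>" "crd \<beta> \<gamma> \<noteq> 0"
    using root_on_simple_line[OF assms(1,2)] assms(3) by blast
  then have "crd (reflection \<alpha> \<beta>) \<gamma> > 0"
    using crd_reflection[OF assms(2)] crd_P_nonneg[OF assms(1), of \<gamma>] by simp
  moreover have "reflection \<alpha> \<beta> \<in> \<Delta>"
    using assms S_subset P_subset refl_closed by blast
  ultimately show ?thesis
    using P_I by blast
qed

text \<open>The reflected root is positive, and its coordinate at \<open>\<beta>\<close> is minus
  the Cartan integer.\<close>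

lemma simple_inner_nonpos:
  assumes "\<alpha> \<in> S" "\<beta> \<in> S" "\<alpha> \<noteq> \<beta>"
  shows "\<alpha> \<bullet> \<beta> \<le> 0"
proof -
  have "reflection \<beta> \<alpha> \<in> P"
    using reflection_P assms simple_in_P by blast
  then have "0 \<le> crd (reflection \<beta> \<alpha>) \<beta>"
    by (rule crd_P_nonneg)
  then have "\<alpha> \<bullet> coroot \<beta> \<le> 0"
    using assms by (simp add: crd_reflection crd_simple)
  moreover have "\<beta> \<bullet> \<beta> > 0"
    using assms S_subset zero_notin by auto
  ultimately show ?thesis
    by (simp add: inner_coroot field_simps)
qed

text \<open>Expanding \<open>\<beta> \<bullet> \<beta> > 0\<close> in the base leaves a positive
  summand. Reflecting \<open>\<beta>\<close> in that simple root lowers its height.\<close>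

lemma exists_simple_inner_pos:
  assumes "\<beta> \<in> P"
  obtains \<alpha> where "\<alpha> \<in> S" "crd \<beta> \<alpha> > 0" "\<beta> \<bullet> \<alpha> > 0"
proof -
  have "\<exists>\<alpha>\<in>S. crd \<beta> \<alpha> > 0 \<and> \<beta> \<bullet> \<alpha> > 0"
  proof (rule ccontr)
    assume neg: "\<not> ?thesis"
    have "\<beta> \<bullet> \<beta> = \<beta> \<bullet> (\<Sum>\<alpha>\<in>S. crd \<beta> \<alpha> *\<^sub>R \<alpha>)"
      by (simp add: crd_sum)
    also have "\<dots> = (\<Sum>\<alpha>\<in>S. crd \<beta> \<alpha> * (\<beta> \<bullet> \<alpha>))"
      by (simp add: inner_sum_right)
    also have "\<dots> \<le> 0"
    proof (rule sum_nonpos)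
      fix \<alpha> assume "\<alpha> \<in> S"
      then show "crd \<beta> \<alpha> * (\<beta> \<bullet> \<alpha>) \<le> 0"
        using neg crd_P_nonneg[OF assms, of \<alpha>]
        by (cases "crd \<beta> \<alpha> = 0") (auto simp: mult_nonneg_nonpos)
    qed
    finally show False
      using assms P_subset zero_notin by (metis inner_gt_zero_iff not_less subsetD)
  qed
  then show thesis
    using that by blast
qed

text \<open>Induction on the height, the sum of the coordinates: a positive root that is not simple
  is the simple reflection of a lower positive root. This stands in for the Weyl group wherever all
  roots have to be placed in a given set.\<close>

lemma roots_generated:
  assumes "S \<subseteq> F" "\<And>v. v \<in> F \<Longrightarrow> - v \<in> F"
    and "\<And>\<alpha> v. \<alpha> \<in> S \<Longrightarrow> v \<in> F \<Longrightarrow> v \<in> \<Delta> \<Longrightarrow> reflection \<alpha> v \<in> F"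
  shows "\<Delta> \<subseteq> F"
proof -
  have pos: "\<beta> \<in> F" if "\<beta> \<in> P" "(\<Sum>\<alpha>\<in>S. crd \<beta> \<alpha>) = real n" for \<beta> n
    using that
  proof (induction n arbitrary: \<beta> rule: less_induct)
    case (less n)
    obtain \<alpha> where \<alpha>: "\<alpha> \<in> S" "crd \<beta> \<alpha> > 0" "\<beta> \<bullet> \<alpha> > 0"
      using exists_simple_inner_pos less.prems(1) by blast
    show ?case
    proof (cases "\<beta> = \<alpha>")
      case False
      define \<gamma> where "\<gamma> = reflection \<alpha> \<beta>"
      have \<gamma>: "\<gamma> \<in> P"
        using reflection_P less.prems(1) \<alpha>(1) False by (simp add: \<gamma>_def)
      have "\<alpha> \<bullet> \<alpha> > 0"
        using \<alpha>(3) by auto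
      then have c: "\<beta> \<bullet> coroot \<alpha> > 0"
        using \<alpha>(3) by (simp add: inner_coroot)
      have "(\<Sum>\<delta>\<in>S. crd \<gamma> \<delta>) = (\<Sum>\<delta>\<in>S. crd \<beta> \<delta>) - \<beta> \<bullet> coroot \<alpha>"
        using \<alpha>(1) finite_S by (simp add: \<gamma>_def crd_reflection sum_subtractf)
      \<comment> \<open>The height drops by \<open>\<beta> \<bullet> coroot \<alpha> > 0\<close> and
        is again a natural number, so the induction applies.\<close>
      moreover have "(\<Sum>\<delta>\<in>S. crd \<gamma> \<delta>) \<in> \<nat>"
        using crd_P[OF \<gamma>] by (simp add: sum_in_Nats)
      then obtain m where "(\<Sum>\<delta>\<in>S. crd \<gamma> \<delta>) = real m"
        by (auto elim: Nats_cases)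
      ultimately have "\<gamma> \<in> F"
        using less.IH[of m \<gamma>] \<gamma> c less.prems by simp
      then have "reflection \<alpha> \<gamma> \<in> F"
        using assms(3) \<alpha>(1) \<gamma> P_subset by blast
      then show ?thesis
        by (simp add: \<gamma>_def)
    qed (use \<alpha> assms in auto)
  qed
  have "P \<subseteq> F"
  proof
    fix \<beta> assume \<beta>: "\<beta> \<in> P"
    have "(\<Sum>\<delta>\<in>S. crd \<beta> \<delta>) \<in> \<nat>"
      using crd_P[OF \<beta>] by (simp add: sum_in_Nats)
    then show "\<beta> \<in> F"
      using pos[OF \<beta>] by (auto elim: Nats_cases)
  qed
  then show ?thesis
    using pos_or_neg assms(2) by (metis add.inverse_inverse subset_iff)
qed

end

subsection \<open>Transport of structure\<close>

lemma root_system_dual: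
  assumes "root_system \<Delta>"
  shows "root_system (dual_roots \<Delta>)"
proof -
  have nz: "\<alpha> \<noteq> 0" if "\<alpha> \<in> \<Delta>" for \<alpha>
    using that assms by (auto simp: root_system_def)
  have "span (dual_roots \<Delta>) = UNIV"
  proof -
    have "\<alpha> \<in> span (dual_roots \<Delta>)" if "\<alpha> \<in> \<Delta>" for \<alpha>
    proof -
      have "\<alpha> = (\<alpha> \<bullet> \<alpha> / 2) *\<^sub>R coroot \<alpha>"
        using nz[OF that] by (simp add: coroot_def)
      then show ?thesis
        using that by (metis dual_roots_def imageI span_base span_scale)
    qed
    then show ?thesis
      using assms by (metis root_system_def span_minimal subset_iff subspace_span top.extremum_uniqueI)
  qed
  moreover have "0 \<notin> dual_roots \<Delta>"
    using nz by (auto simp: dual_roots_def coroot_def)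
  moreover have "c = 1 \<or> c = -1" if "\<alpha> \<in> dual_roots \<Delta>" "c *\<^sub>R \<alpha> \<in> dual_roots \<Delta>" for c \<alpha>
  proof -
    obtain \<beta> \<gamma> where \<beta>: "\<beta> \<in> \<Delta>" "\<alpha> = coroot \<beta>" and \<gamma>: "\<gamma> \<in> \<Delta>" "c *\<^sub>R \<alpha> = coroot \<gamma>"
      using \<open>\<alpha> \<in> dual_roots \<Delta>\<close> \<open>c *\<^sub>R \<alpha> \<in> dual_roots \<Delta>\<close> by (auto simp: dual_roots_def)
    have "\<gamma> = (1 / c) *\<^sub>R \<beta>"
      using \<beta> \<gamma> by (metis coroot_coroot coroot_scaleR)
    then have "1 / c = 1 \<or> 1 / c = -1"
      using assms \<beta> \<gamma> by (metis root_system_def)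
    then show ?thesis
      by (auto simp: divide_eq_eq split: if_splits)
  qed
  ultimately show ?thesis
    using assms
    by (auto simp: root_system_def dual_roots_def reflection_coroot coroot_reflection[symmetric]
        inner_commute)
qed

lemma
  assumes f: "linear f" "bij f" and S: "is_simple_roots \<Delta> S"
  shows positive_roots_image: "positive_roots (f ` \<Delta>) (f ` S) = f ` positive_roots \<Delta> S"
    and is_simple_roots_image: "is_simple_roots (f ` \<Delta>) (f ` S)"
proof -
  have inj: "inj_on f A" for A
    using f(2) by (auto simp: bij_def inj_def inj_on_def)
  have eq: "(\<Sum>\<alpha>\<in>f ` S. real (c \<alpha>) *\<^sub>R \<alpha>) = f (\<Sum>\<alpha>\<in>S. real (c (f \<alpha>)) *\<^sub>R \<alpha>)" for c
    using f inj by (simp add: sum.reindex linear_sum linear_scale)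
  show *: "positive_roots (f ` \<Delta>) (f ` S) = f ` positive_roots \<Delta> S"
  proof (intro equalityI subsetI)
    fix v assume "v \<in> positive_roots (f ` \<Delta>) (f ` S)"
    then obtain \<beta> c where "\<beta> \<in> \<Delta>" "v = f \<beta>" "f \<beta> = f (\<Sum>\<alpha>\<in>S. real (c (f \<alpha>)) *\<^sub>R \<alpha>)"
      unfolding positive_roots_def eq by auto
    moreover from this have "\<beta> = (\<Sum>\<alpha>\<in>S. real (c (f \<alpha>)) *\<^sub>R \<alpha>)"
      using inj[of UNIV] by (auto dest: injD)
    ultimately show "v \<in> f ` positive_roots \<Delta> S"
      unfolding positive_roots_def by (intro image_eqI[of _ _ \<beta>] CollectI conjI exI[of _ "\<lambda>\<alpha>. c (f \<alpha>)"]) auto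
  next
    fix v assume "v \<in> f ` positive_roots \<Delta> S"
    then obtain \<beta> and c :: "'a \<Rightarrow> nat" where "\<beta> \<in> \<Delta>" "v = f \<beta>" "\<beta> = (\<Sum>\<alpha>\<in>S. real (c \<alpha>) *\<^sub>R \<alpha>)"
      unfolding positive_roots_def by auto
    moreover have "(\<Sum>\<alpha>\<in>f ` S. real (c (inv f \<alpha>)) *\<^sub>R \<alpha>) = f (\<Sum>\<alpha>\<in>S. real (c \<alpha>) *\<^sub>R \<alpha>)"
      unfolding eq using f(2) by (simp add: bij_def inv_f_f)
    ultimately show "v \<in> positive_roots (f ` \<Delta>) (f ` S)"
      unfolding positive_roots_def by (intro CollectI conjI exI[of _ "\<lambda>\<alpha>. c (inv f \<alpha>)"]) auto
  qed
  have "independent (f ` S)"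
    using S f inj by (intro linear_independent_injective_image) (auto simp: is_simple_roots_def)
  moreover have "span (f ` S) = UNIV"
    using S f by (simp add: linear_span_image is_simple_roots_def bij_def)
  moreover have "- f \<beta> = f (- \<beta>)" for \<beta>
    using f(1) by (simp add: linear_neg)
  ultimately show "is_simple_roots (f ` \<Delta>) (f ` S)"
    using S unfolding is_simple_roots_def * by auto
qed

text \<open>Linearity of \<open>h\<close> is deliberately not asked for: the comparison of types B
  and C uses a bijection that does not respect addition, only the resulting notion of ideal.\<close>

lemma card_ideals_transport:
  assumes h: "bij_betw h (positive_roots \<Delta> S) (positive_roots \<Delta>' S')"
    and simple: "S \<subseteq> positive_roots \<Delta> S" "S' = h ` S"
    and ideals: "\<And>I. I \<subseteq> positive_roots \<Delta> S \<Longrightarrow>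
      h ` I \<in> ad_nilpotent_ideals \<Delta>' S' \<longleftrightarrow> I \<in> ad_nilpotent_ideals \<Delta> S"
  shows "card (ad_nilpotent_ideals_with \<Delta>' S' i) = card (ad_nilpotent_ideals_with \<Delta> S i)"
proof -
  have inj: "inj_on h (positive_roots \<Delta> S)" and im: "h ` positive_roots \<Delta> S = positive_roots \<Delta>' S'"
    using h by (auto simp: bij_betw_def)
  have card_eq: "card (h ` I \<inter> S') = card (I \<inter> S)" if "I \<subseteq> positive_roots \<Delta> S" for I
  proof -
    have "h ` I \<inter> S' = h ` (I \<inter> S)"
      using inj_on_image_Int[OF inj that simple(1)] simple(2) by simp
    then show ?thesis
      using that inj by (metis card_image inf.coboundedI1 inj_on_subset)
  qed
  have "ad_nilpotent_ideals_with \<Delta>' S' i = (`) h ` ad_nilpotent_ideals_with \<Delta> S i"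
  proof (intro equalityI subsetI)
    fix J assume J: "J \<in> ad_nilpotent_ideals_with \<Delta>' S' i"
    then have "J \<subseteq> h ` positive_roots \<Delta> S"
      by (auto simp: ad_nilpotent_ideals_with_def ad_nilpotent_ideals_def im)
    then obtain I where I: "I \<subseteq> positive_roots \<Delta> S" "J = h ` I"
      by (auto simp: subset_image_iff)
    then show "J \<in> (`) h ` ad_nilpotent_ideals_with \<Delta> S i"
      using J ideals card_eq by (auto simp: ad_nilpotent_ideals_with_def)
  next
    fix J assume "J \<in> (`) h ` ad_nilpotent_ideals_with \<Delta> S i"
    then obtain I where I: "I \<in> ad_nilpotent_ideals_with \<Delta> S i" "J = h ` I"
      by auto
    moreover from this have "I \<subseteq> positive_roots \<Delta> S"
      by (auto simp: ad_nilpotent_ideals_with_def ad_nilpotent_ideals_def)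
    ultimately show "J \<in> ad_nilpotent_ideals_with \<Delta>' S' i"
      using ideals card_eq by (auto simp: ad_nilpotent_ideals_with_def)
  qed
  moreover have "inj_on ((`) h) (ad_nilpotent_ideals_with \<Delta> S i)"
    using inj by (intro inj_on_subset[OF inj_on_image_Pow[OF inj]])
      (auto simp: ad_nilpotent_ideals_with_def ad_nilpotent_ideals_def)
  ultimately show ?thesis
    by (simp add: card_image)
qed

lemma card_ideals_linear_image:
  assumes f: "linear f" "bij f" and S: "is_simple_roots \<Delta> S"
  shows "card (ad_nilpotent_ideals_with (f ` \<Delta>) (f ` S) i) = card (ad_nilpotent_ideals_with \<Delta> S i)"
proof (rule card_ideals_transport)
  have inj: "inj f"
    using f(2) by (simp add: bij_def)
  show "bij_betw f (positive_roots \<Delta> S) (positive_roots (f ` \<Delta>) (f ` S))"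
    unfolding positive_roots_image[OF assms] using inj by (auto simp: bij_betw_def intro: inj_on_subset)
  show "S \<subseteq> positive_roots \<Delta> S"
  proof
    fix \<alpha> assume \<alpha>: "\<alpha> \<in> S"
    have "finite S"
      using S by (simp add: is_simple_roots_def independent_imp_finite)
    then have "\<alpha> = (\<Sum>\<beta>\<in>S. real (if \<beta> = \<alpha> then 1 else 0) *\<^sub>R \<beta>)"
      using \<alpha> by (simp add: if_distrib[of real] if_distrib[of "\<lambda>c. c *\<^sub>R _"] cong: if_cong)
    then show "\<alpha> \<in> positive_roots \<Delta> S"
      using \<alpha> S unfolding positive_roots_def is_simple_roots_def
      by (intro CollectI conjI exI[of _ "\<lambda>\<beta>. if \<beta> = \<alpha> then 1 else 0"]) auto
  qed
  fix I
  have "f \<gamma> + f \<nu> \<in> f ` A \<longleftrightarrow> \<gamma> + \<nu> \<in> A" for \<gamma> \<nu> A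
    using inj by (metis f(1) inj_image_mem_iff linear_add)
  then show "f ` I \<in> ad_nilpotent_ideals (f ` \<Delta>) (f ` S) \<longleftrightarrow> I \<in> ad_nilpotent_ideals \<Delta> S"
    unfolding ad_nilpotent_ideals_def positive_roots_image[OF assms]
    using inj by (auto simp: inj_image_subset_iff)
qed simp

lemma simple_root_polynomial_eqI:
  fixes \<Delta> \<Delta>' :: "'a::euclidean_space set"
  assumes "span \<Delta> = UNIV" "span \<Delta>' = UNIV"
    and "\<And>i. card (ad_nilpotent_ideals_with \<Delta> S i) = card (ad_nilpotent_ideals_with \<Delta>' S' i)"
  shows "simple_root_polynomial \<Delta> S = simple_root_polynomial \<Delta>' S'"
proof -
  have "dim \<Delta> = dim \<Delta>'"
    using assms(1,2) by (metis dim_span)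
  then show ?thesis
    using assms(3) by (simp add: simple_root_polynomial_def)
qed

section \<open>Independence of the choice of base\<close>

context based_root_system
begin

text \<open>Simple roots are the indecomposable positive ones. Expanding \<open>\<alpha>\<close> in
  the other base, any \<open>\<delta>\<close> that occurs has no coordinates besides the one at
  \<open>\<alpha>\<close>, since nonnegative terms cannot cancel; by reducedness
  \<open>\<delta> = \<alpha>\<close>.\<close>

lemma positive_roots_eq_imp_base_subset:
  assumes "is_simple_roots \<Delta> S'" "positive_roots \<Delta> S' = P"
  shows "S \<subseteq> S'"
proof
  fix \<alpha> assume \<alpha>: "\<alpha> \<in> S"
  interpret S': based_root_system \<Delta> S'
    using assms root_system by unfold_locales
  have \<alpha>': "\<alpha> \<in> S'.P"
    using \<alpha> assms(2) simple_in_P by simp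
  then obtain \<delta> where \<delta>: "\<delta> \<in> S'" "S'.crd \<alpha> \<delta> > 0"
    using S'.exists_simple_inner_pos by blast
  have \<delta>P: "\<delta> \<in> P"
    using \<delta> assms(2) S'.simple_in_P by blast
  have "crd \<delta> \<gamma> = 0" if "\<gamma> \<in> S" "\<gamma> \<noteq> \<alpha>" for \<gamma>
  proof -
    have "0 = crd (\<Sum>\<epsilon>\<in>S'. S'.crd \<alpha> \<epsilon> *\<^sub>R \<epsilon>) \<gamma>"
      using that \<alpha> by (simp add: S'.crd_sum crd_simple)
    also have "\<dots> = (\<Sum>\<epsilon>\<in>S'. S'.crd \<alpha> \<epsilon> * crd \<epsilon> \<gamma>)"
      by (simp add: linear_sum[OF crd_linear] linear_scale[OF crd_linear])
    finally have "(\<Sum>\<epsilon>\<in>S'. S'.crd \<alpha> \<epsilon> * crd \<epsilon> \<gamma>) = 0"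
      by simp
    moreover have nonneg: "0 \<le> S'.crd \<alpha> \<epsilon> * crd \<epsilon> \<gamma>" if "\<epsilon> \<in> S'" for \<epsilon>
    proof -
      have "\<epsilon> \<in> P"
        using S'.simple_in_P[OF that] assms(2) by simp
      then show ?thesis
        using S'.crd_P_nonneg[OF \<alpha>'] crd_P_nonneg by (metis mult_nonneg_nonneg)
    qed
    ultimately have "\<forall>\<epsilon>\<in>S'. S'.crd \<alpha> \<epsilon> * crd \<epsilon> \<gamma> = 0"
      using sum_nonneg_eq_0_iff[OF S'.finite_S nonneg] by simp
    then have "S'.crd \<alpha> \<delta> * crd \<delta> \<gamma> = 0"
      using \<delta>(1) by blast
    then show ?thesis
      using \<delta> by simp
  qed
  then have "\<delta> = \<alpha>"
    using root_on_simple_line[OF \<delta>P \<alpha>] by blast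
  then show "\<alpha> \<in> S'"
    using \<delta> by simp
qed

end

text \<open>Induction on the number of positive roots for \<open>S\<close> that are not positive for
  \<open>S'\<close>. If a simple root is among them, reflecting \<open>S\<close> in it lowers this
  number; if none is, the two sets of positive roots agree, and so do the bases.\<close>

lemma card_ideals_base_independent:
  assumes "root_system \<Delta>" "is_simple_roots \<Delta> S" "is_simple_roots \<Delta> S'"
  shows "card (ad_nilpotent_ideals_with \<Delta> S i) = card (ad_nilpotent_ideals_with \<Delta> S' i)"
  using assms(2)
proof (induction "card (positive_roots \<Delta> S - positive_roots \<Delta> S')" arbitrary: S rule: less_induct)
  case less
  interpret S: based_root_system \<Delta> S
    using assms less.prems by unfold_locales
  interpret S': based_root_system \<Delta> S'
    using assms by unfold_locales
  show ?case
  proof (cases "S \<subseteq> S'.P")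
    case True
    have "S.P \<subseteq> S'.P"
    proof
      fix \<beta> assume \<beta>: "\<beta> \<in> S.P"
      then obtain \<alpha> where \<alpha>: "\<alpha> \<in> S" "S.crd \<beta> \<alpha> > 0"
        using S.exists_simple_inner_pos by blast
      have \<alpha>P: "\<alpha> \<in> S'.P"
        using True \<alpha> by blast
      then obtain \<gamma> where \<gamma>: "S'.crd \<alpha> \<gamma> > 0"
        using S'.exists_simple_inner_pos by blast
      have "S'.crd \<beta> \<gamma> = S'.crd (\<Sum>\<epsilon>\<in>S. S.crd \<beta> \<epsilon> *\<^sub>R \<epsilon>) \<gamma>"
        by (simp add: S.crd_sum)
      also have "\<dots> = (\<Sum>\<epsilon>\<in>S. S.crd \<beta> \<epsilon> * S'.crd \<epsilon> \<gamma>)"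
        by (simp add: linear_sum[OF S'.crd_linear] linear_scale[OF S'.crd_linear])
      also have "\<dots> > 0"
        using True \<alpha> \<gamma> \<beta>
        by (intro sum_pos2[OF S.finite_S \<alpha>(1)] mult_pos_pos mult_nonneg_nonneg
            S.crd_P_nonneg S'.crd_P_nonneg) auto
      finally show "\<beta> \<in> S'.P"
        using S'.P_I \<beta> S.P_subset by blast
    qed
    moreover have "S'.P \<subseteq> S.P"
      using \<open>S.P \<subseteq> S'.P\<close> S.pos_or_neg S'.minus_notin_P S'.P_subset by blast
    ultimately have "S = S'"
      using S.positive_roots_eq_imp_base_subset[OF S'.base]
        S'.positive_roots_eq_imp_base_subset[OF S.base] by blast
    then show ?thesis
      by simp
  next
    case False
    then obtain \<alpha> where \<alpha>: "\<alpha> \<in> S" "\<alpha> \<notin> S'.P"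
      by blast
    let ?r = "reflection \<alpha>"
    have \<alpha>\<Delta>: "\<alpha> \<in> \<Delta>"
      using \<alpha> S.S_subset by blast
    have im: "?r ` \<Delta> = \<Delta>"
    proof (intro equalityI subsetI)
      fix v assume "v \<in> \<Delta>"
      then show "v \<in> ?r ` \<Delta>"
        using S.refl_closed[OF \<alpha>\<Delta>] by (intro image_eqI[of _ _ "?r v"]) simp_all
    qed (use S.refl_closed[OF \<alpha>\<Delta>] in auto)
    have base: "is_simple_roots \<Delta> (?r ` S)" and pos: "positive_roots \<Delta> (?r ` S) = ?r ` S.P"
      using is_simple_roots_image[OF linear_reflection bij_reflection less.prems]
        positive_roots_image[OF linear_reflection bij_reflection less.prems] im by metis+
    \<comment> \<open>The reflection permutes the positive roots other than \<open>\<alpha>\<close>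
      and turns \<open>\<alpha>\<close> into \<open>- \<alpha>\<close>, which lies in
      \<open>S'.P\<close>: the difference loses \<open>\<alpha>\<close> and gains nothing.\<close>
    have "?r ` S.P - S'.P \<subseteq> (S.P - S'.P) - {\<alpha>}"
    proof
      fix v assume v: "v \<in> ?r ` S.P - S'.P"
      then obtain \<beta> where \<beta>: "\<beta> \<in> S.P" "v = ?r \<beta>"
        by blast
      have "- \<alpha> \<in> S'.P"
        using \<alpha> \<alpha>\<Delta> S'.pos_or_neg by blast
      then have "\<beta> \<noteq> \<alpha>"
        using v \<beta> by auto
      then have "v \<in> S.P"
        using S.reflection_P \<beta> \<alpha> by blast
      moreover have "v \<noteq> \<alpha>"
      proof
        assume "v = \<alpha>"
        then have "\<beta> = - \<alpha>"
          using \<beta> by (metis reflection_reflection reflection_self)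
        then show False
          using \<beta> S.minus_notin_P[OF S.simple_in_P[OF \<alpha>(1)]] by simp
      qed
      ultimately show "v \<in> (S.P - S'.P) - {\<alpha>}"
        using v by blast
    qed
    moreover have "\<alpha> \<in> S.P - S'.P"
      using \<alpha> S.simple_in_P by blast
    moreover have "finite (S.P - S'.P)"
      using S.finite_roots S.P_subset finite_subset by blast
    ultimately have "card (positive_roots \<Delta> (?r ` S) - S'.P) < card (S.P - S'.P)"
      unfolding pos by (intro psubset_card_mono) auto
    then have "card (ad_nilpotent_ideals_with \<Delta> (?r ` S) i) = card (ad_nilpotent_ideals_with \<Delta> S' i)"
      using less.hyps base by blast
    then show ?thesis
      using card_ideals_linear_image[OF linear_reflection bij_reflection less.prems, of \<alpha> i] im by simp
  qed
qed

section \<open>Duality by a similarity\<close>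

text \<open>A similarity intertwines reflections, so matching the simple roots with the simple
  coroots already sends every root into the dual system. It then carries one base of the dual to be
  compared with \<open>S'\<close>.\<close>

lemma card_ideals_dual_similarity:
  assumes "root_system \<Delta>" "is_simple_roots \<Delta> S" "is_simple_roots (dual_roots \<Delta>) S'"
    and \<phi>: "linear \<phi>" "\<And>x y. \<phi> x \<bullet> \<phi> y = k * (x \<bullet> y)" "k > 0" "\<phi> ` S = coroot ` S"
  shows "card (ad_nilpotent_ideals_with \<Delta> S i) = card (ad_nilpotent_ideals_with (dual_roots \<Delta>) S' i)"
proof -
  interpret based_root_system \<Delta> S
    using assms(1,2) by unfold_locales
  have dual: "root_system (dual_roots \<Delta>)"
    by (rule root_system_dual[OF root_system])
  have inj: "inj \<phi>"
  proof (rule injI)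
    fix x y assume "\<phi> x = \<phi> y"
    then have "\<phi> (x - y) \<bullet> \<phi> (x - y) = 0"
      using \<phi>(1) by (simp add: linear_diff)
    then show "x = y"
      using \<phi>(2,3) by simp
  qed
  then have bij: "bij \<phi>"
    using \<phi>(1) linear_injective_imp_surjective by (auto simp: bij_def)
  have "\<Delta> \<subseteq> {v. \<phi> v \<in> dual_roots \<Delta>}"
  proof (rule roots_generated)
    show "S \<subseteq> {v. \<phi> v \<in> dual_roots \<Delta>}"
      using \<phi>(4) S_subset by (auto simp: dual_roots_def)
    show "- v \<in> {v. \<phi> v \<in> dual_roots \<Delta>}" if "v \<in> {v. \<phi> v \<in> dual_roots \<Delta>}" for v
      using that minus_root linear_neg[OF \<phi>(1)]
      by (auto simp: dual_roots_def coroot_minus[symmetric])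
    show "reflection \<alpha> v \<in> {v. \<phi> v \<in> dual_roots \<Delta>}"
      if "\<alpha> \<in> S" "v \<in> {v. \<phi> v \<in> dual_roots \<Delta>}" for \<alpha> v
    proof -
      have "\<phi> \<alpha> \<in> dual_roots \<Delta>"
        using that \<phi>(4) S_subset by (auto simp: dual_roots_def)
      then show ?thesis
        using that dual similarity_reflection[OF \<phi>(1,2)] \<phi>(3) by (auto simp: root_system_def)
    qed
  qed
  \<comment> \<open>Both maps are injective on the finite set \<open>\<Delta>\<close>, so counting
    turns the inclusion into an equality.\<close>
  moreover have "card (\<phi> ` \<Delta>) = card (dual_roots \<Delta>)"
  proof -
    have "inj_on coroot \<Delta>"
      by (metis coroot_coroot inj_onI)
    then show ?thesis
      using inj by (simp add: dual_roots_def card_image inj_on_subset)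
  qed
  ultimately have im: "\<phi> ` \<Delta> = dual_roots \<Delta>"
    using finite_roots by (intro card_subset_eq) (auto simp: dual_roots_def)
  have "card (ad_nilpotent_ideals_with (\<phi> ` \<Delta>) (\<phi> ` S) i) = card (ad_nilpotent_ideals_with (dual_roots \<Delta>) S' i)"
    using card_ideals_base_independent dual assms(3) is_simple_roots_image[OF \<phi>(1) bij base]
    unfolding im by blast
  then show ?thesis
    using card_ideals_linear_image[OF \<phi>(1) bij base] by metis
qed

lemma card_ideals_dual_permutation:
  assumes "root_system \<Delta>" "is_simple_roots \<Delta> S" "is_simple_roots (dual_roots \<Delta>) S'"
    and \<sigma>: "\<sigma> ` S = S" "\<And>\<alpha>. \<alpha> \<in> S \<Longrightarrow> norm \<alpha> * norm (\<sigma> \<alpha>) = c"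
    and angles: "\<And>\<alpha> \<beta>. \<alpha> \<in> S \<Longrightarrow> \<beta> \<in> S \<Longrightarrow> sgn (\<sigma> \<alpha>) \<bullet> sgn (\<sigma> \<beta>) = sgn \<alpha> \<bullet> sgn \<beta>"
  shows "card (ad_nilpotent_ideals_with \<Delta> S i) = card (ad_nilpotent_ideals_with (dual_roots \<Delta>) S' i)"
proof -
  interpret based_root_system \<Delta> S
    using assms(1,2) by unfold_locales
  obtain \<phi> where \<phi>: "linear \<phi>" "\<And>\<alpha>. \<alpha> \<in> S \<Longrightarrow> \<phi> \<alpha> = coroot (\<sigma> \<alpha>)"
    using linear_independent_extend[OF indep, of "\<lambda>\<alpha>. coroot (\<sigma> \<alpha>)"] by auto
  have nz: "\<alpha> \<noteq> 0" "\<sigma> \<alpha> \<noteq> 0" if "\<alpha> \<in> S" for \<alpha>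
    using that \<sigma>(1) S_subset zero_notin by (metis imageI subsetD)+
  have "S \<noteq> {}"
  proof
    assume "S = {}"
    then have "(SOME b. b \<in> (Basis :: 'a set)) = 0"
      using span by auto
    then show False
      by (metis SOME_Basis nonzero_Basis)
  qed
  then obtain \<alpha>\<^sub>0 where "\<alpha>\<^sub>0 \<in> S"
    by blast
  then have c: "c > 0"
    using \<sigma>(2)[of \<alpha>\<^sub>0] nz by (metis mult_pos_pos zero_less_norm_iff)
  \<comment> \<open>A coroot has length 2 divided by the length of the root, so
    \<open>\<phi> \<alpha>\<close> has length
    \<open>2 / norm (\<sigma> \<alpha>) = (2 / c) * norm \<alpha>\<close>. All lengths scale by
    \<open>2 / c\<close>, and the angles are kept by assumption.\<close>
  have "\<phi> x \<bullet> \<phi> y = (4 / c\<^sup>2) * (x \<bullet> y)" for x y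
  proof (rule bilinear_eq[where B = S and C = S and S = UNIV and T = UNIV])
    show "bilinear (\<lambda>x y. \<phi> x \<bullet> \<phi> y)" "bilinear (\<lambda>x y. 4 / c\<^sup>2 * (x \<bullet> y))"
      using \<phi>(1) by (auto simp: bilinear_def linear_add linear_scale inner_add_left inner_add_right
          algebra_simps add_divide_distrib intro!: linearI)
    fix \<alpha> \<beta> assume "\<alpha> \<in> S" "\<beta> \<in> S"
    have *: "v = norm v *\<^sub>R sgn v" for v :: 'a
      by (cases "v = 0") (auto simp: sgn_div_norm)
    have co: "coroot v = (2 / norm v) *\<^sub>R sgn v" for v :: 'a
      by (cases "v = 0") (auto simp: sgn_div_norm coroot_def dot_square_norm power2_eq_square field_simps)
    have "\<phi> \<alpha> \<bullet> \<phi> \<beta> = 4 / (norm (\<sigma> \<alpha>) * norm (\<sigma> \<beta>)) * (sgn \<alpha> \<bullet> sgn \<beta>)"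
      using \<phi>(2) \<open>\<alpha> \<in> S\<close> \<open>\<beta> \<in> S\<close> angles by (simp add: co)
    also have "\<dots> = 4 * (norm \<alpha> * norm \<beta>) / ((norm \<alpha> * norm (\<sigma> \<alpha>)) * (norm \<beta> * norm (\<sigma> \<beta>))) * (sgn \<alpha> \<bullet> sgn \<beta>)"
      using nz \<open>\<alpha> \<in> S\<close> \<open>\<beta> \<in> S\<close> by simp
    also have "\<dots> = 4 / c\<^sup>2 * ((norm \<alpha> *\<^sub>R sgn \<alpha>) \<bullet> (norm \<beta> *\<^sub>R sgn \<beta>))"
      using \<sigma>(2) \<open>\<alpha> \<in> S\<close> \<open>\<beta> \<in> S\<close> by (simp add: power2_eq_square)
    also have "\<dots> = 4 / c\<^sup>2 * (\<alpha> \<bullet> \<beta>)"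
      by (simp only: *[symmetric])
    finally show "\<phi> \<alpha> \<bullet> \<phi> \<beta> = 4 / c\<^sup>2 * (\<alpha> \<bullet> \<beta>)" .
  qed (use span in auto)
  moreover have "\<phi> ` S = coroot ` S"
    using \<phi>(2) \<sigma>(1) by (metis (no_types, lifting) image_cong image_image)
  ultimately show ?thesis
    using card_ideals_dual_similarity[OF assms(1-3) \<phi>(1), where k = "4 / c\<^sup>2"] c by simp
qed

subsection \<open>Dynkin diagrams with a multiple bond\<close>

lemma nth_notin_take:
  assumes "distinct xs" "m \<le> k" "k < length xs"
  shows "xs ! k \<notin> set (take m xs)"
  using assms by (auto simp: in_set_conv_nth nth_eq_iff_index_eq)

lemma sum_list_inner_left: "sum_list xs \<bullet> z = (\<Sum>x\<leftarrow>xs. x \<bullet> z)"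
  by (induction xs) (auto simp: inner_add_left)

lemma successively_imp_inner_le:
  fixes x :: "'a::real_inner"
  assumes "xs \<noteq> []" "x \<bullet> hd xs \<le> v" "\<And>y. y \<in> set xs \<Longrightarrow> x \<bullet> y \<le> 0"
  shows "x \<bullet> sum_list xs \<le> v"
proof -
  obtain y ys where xs: "xs = y # ys"
    using assms(1) by (cases xs) auto
  have "sum_list ys \<bullet> x \<le> 0"
    unfolding sum_list_inner_left
    by (intro sum_list_nonpos) (use assms xs in \<open>auto simp: inner_commute\<close>)
  then show ?thesis
    using assms xs by (simp add: inner_add_right inner_commute)
qed

text \<open>The normalised simple roots. The half space given by \<open>h\<close> stands for linear
  independence: nonnegative combinations, not all coefficients zero, are nonzero. The three cases
  for \<open>x \<bullet> y\<close> express that \<open>4 * (x \<bullet> y)\<^sup>2\<close> is 0, 1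
  or at least 2.\<close>

locale obtuse_units =
  fixes U :: "'a::euclidean_space set" and h :: 'a
  assumes finite_U: "finite U"
    and unit: "x \<in> U \<Longrightarrow> x \<bullet> x = 1"
    and obtuse: "x \<in> U \<Longrightarrow> y \<in> U \<Longrightarrow> x \<noteq> y \<Longrightarrow>
      x \<bullet> y = 0 \<or> x \<bullet> y = - 1 / 2 \<or> x \<bullet> y \<le> - (sqrt 2 / 2)"
    and halfspace: "x \<in> U \<Longrightarrow> h \<bullet> x > 0"
begin

lemma inner_nonpos: "x \<in> U \<Longrightarrow> y \<in> U \<Longrightarrow> x \<noteq> y \<Longrightarrow> x \<bullet> y \<le> 0"
  using obtuse[of x y] real_sqrt_ge_zero[of 2] by linarith

lemma inner_bond: "x \<in> U \<Longrightarrow> y \<in> U \<Longrightarrow> x \<noteq> y \<Longrightarrow> x \<bullet> y \<noteq> 0 \<Longrightarrow> x \<bullet> y \<le> - 1 / 2"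
  using obtuse[of x y] real_sqrt_ge_one[of 2] by linarith

text \<open>The head is meant to sit at a multiple bond, the last element is the end that grows. The
  bonds are only bounded from above; that they are simple within an arm follows later in
  \<open>arms_inner\<close>.\<close>

definition chain :: "'a list \<Rightarrow> bool" where
  "chain xs \<longleftrightarrow> xs \<noteq> [] \<and> distinct xs \<and> set xs \<subseteq> U \<and> successively (\<lambda>x y. x \<bullet> y \<le> - 1 / 2) xs"

lemma chain_take:
  assumes "chain xs" "0 < n"
  shows "chain (take n xs)"
proof -
  have "successively (\<lambda>x y. x \<bullet> y \<le> - 1 / 2) (take n xs @ drop n xs)"
    using assms by (simp add: chain_def)
  then show ?thesis
    using assms set_take_subset[of n xs] unfolding chain_def successively_append_iff by auto
qed

lemma chain_extend:
  assumes "chain xs" "x \<in> U" "x \<notin> set xs" "last xs \<bullet> x \<le> - 1 / 2"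
  shows "chain (xs @ [x])"
  using assms by (auto simp: chain_def successively_append_iff)

lemma chain_sum_halfspace: "chain xs \<Longrightarrow> h \<bullet> sum_list xs > 0"
proof (induction xs)
  case (Cons x xs)
  then show ?case
    using halfspace[of x]
    by (cases "xs = []") (auto simp: chain_def inner_add_right successively_Cons intro: add_pos_pos)
qed (simp add: chain_def)

text \<open>Prepending \<open>x\<close> adds 1 for its own norm, at most -1 for its bond to the next
  element, and nothing positive for \<open>z\<close>. So the squared norm never exceeds the bound
  for \<open>last xs + z\<close>.\<close>

lemma chain_norm_plus:
  assumes "chain xs" "last xs \<bullet> z \<le> v" "\<And>x. x \<in> set xs \<Longrightarrow> x \<bullet> z \<le> 0"
  shows "(sum_list xs + z) \<bullet> (sum_list xs + z) \<le> 1 + 2 * v + z \<bullet> z"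
  using assms
proof (induction xs)
  case (Cons x xs)
  have x: "x \<bullet> x = 1" "x \<bullet> z \<le> 0"
    using Cons.prems unit by (auto simp: chain_def)
  show ?case
  proof (cases "xs = []")
    case True
    then show ?thesis
      using Cons.prems x by (simp add: inner_add_left inner_add_right inner_commute)
  next
    case False
    then have "chain xs"
      using Cons.prems by (auto simp: chain_def successively_Cons)
    then have IH: "(sum_list xs + z) \<bullet> (sum_list xs + z) \<le> 1 + 2 * v + z \<bullet> z"
      using Cons False by auto
    have "x \<bullet> sum_list xs \<le> - 1 / 2"
    proof (rule successively_imp_inner_le)
      show "x \<bullet> hd xs \<le> - 1 / 2"
        using Cons.prems False by (simp add: chain_def successively_Cons)
      show "x \<bullet> y \<le> 0" if "y \<in> set xs" for y
        using that Cons.prems by (intro inner_nonpos) (auto simp: chain_def)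
    qed (use False in auto)
    then show ?thesis
      using IH x by (simp add: inner_add_left inner_add_right inner_commute)
  qed
qed (simp add: chain_def)

lemma chain_norm: "chain xs \<Longrightarrow> sum_list xs \<bullet> sum_list xs \<le> 1"
  using chain_norm_plus[of xs 0 0] by simp

text \<open>All cross products are nonpositive, so dropping every pair except the two heads can only
  increase the sum.\<close>

lemma cross_le:
  assumes "chain xs" "chain ys" "set xs \<inter> set ys = {}"
  shows "sum_list xs \<bullet> sum_list ys \<le> hd xs \<bullet> hd ys"
proof -
  have np: "x \<bullet> y \<le> 0" if "x \<in> set xs" "y \<in> set ys" for x y
    using that assms by (intro inner_nonpos) (auto simp: chain_def)
  have ne: "xs \<noteq> []" "ys \<noteq> []"
    using assms by (auto simp: chain_def)
  have "x \<bullet> sum_list ys \<le> 0" if "x \<in> set xs" for x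
    using that np ne by (intro successively_imp_inner_le) auto
  moreover have "hd xs \<bullet> sum_list ys \<le> hd xs \<bullet> hd ys"
    using np ne by (intro successively_imp_inner_le) auto
  ultimately show ?thesis
    using ne by (subst inner_commute, intro successively_imp_inner_le) (auto simp: inner_commute)
qed

definition arms :: "'a list \<Rightarrow> 'a list \<Rightarrow> bool" where
  "arms xs ys \<longleftrightarrow> chain xs \<and> chain ys \<and> set xs \<inter> set ys = {} \<and> hd xs \<bullet> hd ys \<le> - (sqrt 2 / 2)"

lemma arms_sym: "arms xs ys \<longleftrightarrow> arms ys xs"
  by (auto simp: arms_def inner_commute)

lemma arms_take: "arms xs ys \<Longrightarrow> 0 < n \<Longrightarrow> arms (take n xs) ys"
  using set_take_subset[of n xs] by (auto simp: arms_def chain_take)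

text \<open>
  Every bad continuation of an arm yields a vector \<open>z\<close> with which the arm sum shrinks to
  squared norm at most \<open>1/2\<close>; then \<open>\<surd>2 (\<Sum>xs + z) + \<Sum>ys\<close> would have
  norm zero although it lies in an open half space.
\<close>
lemma arms_no_continuation:
  assumes "arms xs ys" "last xs \<bullet> z \<le> - 1 / 2" "\<And>x. x \<in> set xs \<union> set ys \<Longrightarrow> x \<bullet> z \<le> 0"
    and "z \<bullet> z \<le> 1 / 2" "h \<bullet> z \<ge> 0"
  shows False
proof -
  let ?A = "sum_list xs + z" and ?B = "sum_list ys"
  have c: "chain xs" "chain ys"
    using assms by (auto simp: arms_def)
  have "?A \<bullet> ?A \<le> 1 / 2"
    using chain_norm_plus[OF c(1), of z "-1/2"] assms by auto
  moreover have "?B \<bullet> ?B \<le> 1"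
    by (rule chain_norm[OF c(2)])
  moreover have "?A \<bullet> ?B \<le> - (sqrt 2 / 2)"
  proof -
    have "?B \<bullet> z \<le> 0"
      unfolding sum_list_inner_left by (intro sum_list_nonpos) (use assms(3) in auto)
    moreover have "sum_list xs \<bullet> ?B \<le> - (sqrt 2 / 2)"
      using cross_le[OF c] assms(1) by (auto simp: arms_def)
    ultimately show ?thesis
      by (simp add: inner_add_left inner_commute[of ?B z])
  qed
  moreover have "sqrt 2 * (?A \<bullet> ?B) \<le> sqrt 2 * (- (sqrt 2 / 2))"
    using calculation by (intro mult_left_mono) auto
  moreover have "(sqrt 2 *\<^sub>R ?A + ?B) \<bullet> (sqrt 2 *\<^sub>R ?A + ?B) = 2 * (?A \<bullet> ?A) + 2 * (sqrt 2 * (?A \<bullet> ?B)) + ?B \<bullet> ?B"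
    by (simp add: inner_add_left inner_add_right inner_commute algebra_simps)
  ultimately have "(sqrt 2 *\<^sub>R ?A + ?B) \<bullet> (sqrt 2 *\<^sub>R ?A + ?B) \<le> 0"
    by simp
  then have "sqrt 2 *\<^sub>R ?A + ?B = 0"
    by (metis inner_gt_zero_iff not_less)
  moreover have "h \<bullet> (sqrt 2 *\<^sub>R ?A + ?B) > 0"
    using chain_sum_halfspace[OF c(1)] chain_sum_halfspace[OF c(2)] assms(5)
    by (auto simp: inner_add_right intro!: add_pos_pos mult_pos_pos add_pos_nonneg)
  ultimately show False
    by simp
qed

text \<open>The mean of the two continuations serves as \<open>z\<close>: as
  \<open>u \<bullet> v \<le> 0\<close>, its squared norm is at most 1/2, while its product with
  \<open>last xs\<close> is still at most -1/2. Applied to truncated arms, this excludes branching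
  at every vertex of an arm.\<close>

lemma arms_no_branch:
  assumes "arms xs ys" "u \<in> U" "v \<in> U" "u \<noteq> v" "u \<notin> set xs \<union> set ys" "v \<notin> set xs \<union> set ys"
    and "last xs \<bullet> u \<noteq> 0" "last xs \<bullet> v \<noteq> 0"
  shows False
proof -
  have sub: "set xs \<subseteq> U" "set ys \<subseteq> U" and "last xs \<in> set xs"
    using assms(1) by (auto simp: arms_def chain_def)
  show False
  proof (rule arms_no_continuation[OF assms(1)])
    let ?z = "(1/2) *\<^sub>R (u + v)"
    have "last xs \<in> U" "last xs \<noteq> u" "last xs \<noteq> v"
      using assms sub \<open>last xs \<in> set xs\<close> by blast+
    then show "last xs \<bullet> ?z \<le> - 1 / 2"
      using inner_bond[of "last xs" u] inner_bond[of "last xs" v] assms(2,3,7,8)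
      by (simp add: inner_add_right)
    show "x \<bullet> ?z \<le> 0" if "x \<in> set xs \<union> set ys" for x
    proof -
      have "x \<in> U" "x \<noteq> u" "x \<noteq> v"
        using that assms sub by blast+
      then show ?thesis
        using inner_nonpos[of x u] inner_nonpos[of x v] assms(2,3) by (simp add: inner_add_right)
    qed
    show "?z \<bullet> ?z \<le> 1 / 2"
      using inner_nonpos[of u v] unit assms by (simp add: inner_add_right inner_add_left inner_commute)
    show "h \<bullet> ?z \<ge> 0"
      using halfspace[of u] halfspace[of v] assms by (simp add: inner_add_right)
  qed
qed

text \<open>Shrinking \<open>u\<close> by \<open>sqrt 2\<close> gives squared norm exactly 1/2, and
  the stronger bond makes up for the loss in the product with \<open>last xs\<close>.\<close>

lemma arms_no_multiple_bond:
  assumes "arms xs ys" "u \<in> U" "u \<notin> set xs \<union> set ys" "last xs \<bullet> u \<le> - (sqrt 2 / 2)"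
  shows False
proof -
  have sub: "set xs \<subseteq> U" "set ys \<subseteq> U"
    using assms(1) by (auto simp: arms_def chain_def)
  show False
  proof (rule arms_no_continuation[OF assms(1)])
    let ?z = "(1 / sqrt 2) *\<^sub>R u"
    have "1 / sqrt 2 * (last xs \<bullet> u) \<le> 1 / sqrt 2 * (- (sqrt 2 / 2))"
      using assms by (intro mult_left_mono) auto
    then show "last xs \<bullet> ?z \<le> - 1 / 2"
      by simp
    show "x \<bullet> ?z \<le> 0" if "x \<in> set xs \<union> set ys" for x
    proof -
      have "x \<in> U" "x \<noteq> u"
        using that assms sub by blast+
      then show ?thesis
        using inner_nonpos[of x u] assms(2) by (simp add: divide_nonpos_pos)
    qed
    show "?z \<bullet> ?z \<le> 1 / 2"
      using unit assms by simp
    show "h \<bullet> ?z \<ge> 0"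
      using halfspace[of u] assms by simp
  qed
qed

text \<open>This excludes cycles through the multiple bond. With a second bond across, the sum over
  both arms would have squared norm at most 1 + 1 - 2 (sqrt 2 / 2 + 1 / 2) = 1 - sqrt 2 < 0.\<close>

lemma arms_no_cross_bond:
  assumes "arms xs ys" "x \<in> set xs" "y \<in> set ys" "x \<bullet> y \<noteq> 0"
  shows "x = hd xs \<and> y = hd ys"
proof (rule ccontr)
  assume ne: "\<not> ?thesis"
  have c: "chain xs" "chain ys" "set xs \<inter> set ys = {}" "hd xs \<bullet> hd ys \<le> - (sqrt 2 / 2)"
    using assms by (auto simp: arms_def)
  have np: "x \<bullet> y \<le> 0" if "x \<in> set xs" "y \<in> set ys" for x y
    using that c by (intro inner_nonpos) (auto simp: chain_def)
  have xy: "x \<bullet> y \<le> - 1 / 2"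
    using assms c by (intro inner_bond) (auto simp: chain_def)
  have hds: "hd xs \<in> set xs" "hd ys \<in> set ys"
    using c by (auto simp: chain_def)
  have "(\<Sum>p\<in>{(hd xs, hd ys), (x, y)}. - (fst p \<bullet> snd p)) \<le> (\<Sum>p\<in>set xs \<times> set ys. - (fst p \<bullet> snd p))"
    using np hds assms by (intro sum_mono2) auto
  then have "(\<Sum>p\<in>set xs \<times> set ys. fst p \<bullet> snd p) \<le> (\<Sum>p\<in>{(hd xs, hd ys), (x, y)}. fst p \<bullet> snd p)"
    by (simp only: sum_negf neg_le_iff_le)
  also have "\<dots> = hd xs \<bullet> hd ys + x \<bullet> y"
    using ne by auto
  also have "(\<Sum>p\<in>set xs \<times> set ys. fst p \<bullet> snd p) = sum_list xs \<bullet> sum_list ys"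
  proof -
    have "sum_list xs = \<Sum>(set xs)" "sum_list ys = \<Sum>(set ys)"
      using c by (simp_all add: chain_def distinct_sum_list_conv_Sum)
    then have "sum_list xs \<bullet> sum_list ys = (\<Sum>x\<in>set xs. \<Sum>y\<in>set ys. x \<bullet> y)"
      by (simp add: inner_sum_left) (simp add: inner_sum_right)
    then show ?thesis
      by (simp add: sum.cartesian_product case_prod_beta)
  qed
  finally have "sum_list xs \<bullet> sum_list ys \<le> - (sqrt 2 / 2) - 1 / 2"
    using c xy by simp
  moreover have "sqrt 2 > 1"
    by simp
  moreover have "0 \<le> (sum_list xs + sum_list ys) \<bullet> (sum_list xs + sum_list ys)"
    by simp
  then have "0 \<le> sum_list xs \<bullet> sum_list xs + sum_list ys \<bullet> sum_list ys + 2 * (sum_list xs \<bullet> sum_list ys)"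
    by (simp add: inner_add_left inner_add_right inner_commute)
  ultimately show False
    using chain_norm[OF c(1)] chain_norm[OF c(2)] by linarith
qed

text \<open>Truncating the arm after position \<open>i\<close> leaves arms to which the exclusion
  lemmas apply: a multiple bond to the next vertex is ruled out, and a bond to any later vertex
  would be a branch beside \<open>xs ! Suc i\<close>.\<close>

lemma arms_inner:
  assumes "arms xs ys" "i < j" "j < length xs"
  shows "xs ! i \<bullet> xs ! j = (if j = Suc i then - 1 / 2 else 0)"
proof -
  have xs: "distinct xs" "set xs \<subseteq> U" "set xs \<inter> set ys = {}"
    and succ: "successively (\<lambda>x y. x \<bullet> y \<le> - 1 / 2) xs"
    using assms by (auto simp: arms_def chain_def)
  let ?cs = "take (Suc i) xs"
  have cs: "arms ?cs ys" "last ?cs = xs ! i"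
    using assms arms_take[OF assms(1), of "Suc i"] by (simp_all add: take_Suc_conv_app_nth)
  have notin: "xs ! k \<notin> set ?cs \<union> set ys" if "i < k" "k < length xs" for k
    using nth_notin_take[OF xs(1), of "Suc i" k] xs(3) that nth_mem[of k xs] by (auto simp del: nth_mem)
  have inU: "xs ! k \<in> U" if "k < length xs" for k
    using xs that by auto
  have Suc: "xs ! i \<bullet> xs ! Suc i \<le> - 1 / 2"
    using succ assms successively_nth[of _ xs i] by (simp add: successively_conv_nth)
  show ?thesis
  proof (cases "j = Suc i")
    case True
    then have "\<not> xs ! i \<bullet> xs ! j \<le> - (sqrt 2 / 2)"
      using arms_no_multiple_bond[OF cs(1), of "xs ! j"] cs(2) notin inU assms by auto
    then show ?thesis
      using obtuse[of "xs ! i" "xs ! j"] inU assms Suc True xs(1) by (auto simp: nth_eq_iff_index_eq)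
  next
    case False
    then have "xs ! i \<bullet> xs ! j = 0"
      using arms_no_branch[OF cs(1), of "xs ! j" "xs ! Suc i"] cs(2) notin inU assms xs(1) Suc
      by (auto simp: nth_eq_iff_index_eq)
    then show ?thesis
      using False by simp
  qed
qed

text \<open>An outside vertex bonded to an inner \<open>y\<close> would create a branch; bonded to
  the last \<open>y\<close>, it would prolong the arm.\<close>

lemma maximal_arms_absorb:
  assumes "arms xs ys" "\<And>x. \<not> arms (xs @ [x]) ys" "x \<in> U - (set xs \<union> set ys)" "y \<in> set xs"
  shows "y \<bullet> x = 0"
proof (rule ccontr)
  assume ne: "y \<bullet> x \<noteq> 0"
  have xs: "distinct xs" "set xs \<subseteq> U" "set xs \<inter> set ys = {}" "xs \<noteq> []" "chain xs"
    and succ: "successively (\<lambda>x y. x \<bullet> y \<le> - 1 / 2) xs"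
    using assms by (auto simp: arms_def chain_def)
  obtain i where i: "i < length xs" "y = xs ! i"
    using assms by (auto simp: in_set_conv_nth)
  have yx: "y \<bullet> x \<le> - 1 / 2"
    using inner_bond[of y x] ne assms xs by auto
  show False
  proof (cases "Suc i < length xs")
    case True
    have cs: "arms (take (Suc i) xs) ys" "last (take (Suc i) xs) = xs ! i"
      using i arms_take[OF assms(1), of "Suc i"] by (simp_all add: take_Suc_conv_app_nth)
    have "xs ! Suc i \<notin> set (take (Suc i) xs)"
      using nth_notin_take[OF xs(1), of "Suc i" "Suc i"] True by simp
    moreover have "xs ! i \<bullet> xs ! Suc i \<noteq> 0"
      using arms_inner[OF assms(1), of i "Suc i"] True by simp
    moreover have "xs ! Suc i \<in> set xs"
      using True by simp
    ultimately show False
      using arms_no_branch[OF cs(1), of x "xs ! Suc i"] assms xs ne i cs(2) set_take_subset[of "Suc i" xs]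
      by auto
  next
    case False
    then have "last xs = y"
      using i xs by (metis Suc_lessI last_conv_nth diff_Suc_1 length_greater_0_conv less_Suc_eq not_less_eq)
    then have "arms (xs @ [x]) ys"
      using assms yx xs chain_extend[of xs x] by (auto simp: arms_def)
    then show False
      using assms(2) by blast
  qed
qed

text \<open>Take arms of maximal total length, which \<open>card U\<close> bounds. No vertex outside
  them is bonded to them, so connectedness leaves none outside.\<close>

lemma diagram_is_two_arms:
  assumes "arms xs\<^sub>0 ys\<^sub>0"
    and connected: "\<And>A B. A \<noteq> {} \<Longrightarrow> B \<noteq> {} \<Longrightarrow> A \<union> B = U \<Longrightarrow> A \<inter> B = {} \<Longrightarrow> \<exists>x\<in>A. \<exists>y\<in>B. x \<bullet> y \<noteq> 0"
  obtains xs ys where "arms xs ys" "set xs \<union> set ys = U"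
proof -
  define Q where "Q n \<longleftrightarrow> (\<exists>xs ys. arms xs ys \<and> length xs + length ys = n)" for n
  have "Q (length xs\<^sub>0 + length ys\<^sub>0)"
    using assms(1) by (auto simp: Q_def)
  moreover have "n \<le> card U" if n: "Q n" for n
  proof -
    obtain xs ys where a: "arms xs ys" "length xs + length ys = n"
      using n unfolding Q_def by blast
    then have "n = card (set xs \<union> set ys)"
      by (auto simp: arms_def chain_def card_Un_disjoint distinct_card)
    also have "\<dots> \<le> card U"
      using a finite_U by (intro card_mono) (auto simp: arms_def chain_def)
    finally show ?thesis .
  qed
  ultimately obtain n where n: "Q n" "\<And>m. Q m \<Longrightarrow> m \<le> n"
    using GreatestI_nat[of Q] Greatest_le_nat[of Q] by metis
  then obtain xs ys where a: "arms xs ys" "length xs + length ys = n"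
    unfolding Q_def by blast
  have max: "\<not> arms (xs @ [x]) ys" "\<not> arms (ys @ [x]) xs" for x
    using n(2)[of "Suc n"] a(2) by (auto simp: Q_def arms_sym[of "ys @ [x]"]; force)+
  have "set xs \<union> set ys = U"
  proof (rule ccontr)
    assume "set xs \<union> set ys \<noteq> U"
    moreover have "set xs \<union> set ys \<subseteq> U" "xs \<noteq> []"
      using a by (auto simp: arms_def chain_def)
    ultimately obtain x y where "x \<in> set xs \<union> set ys" "y \<in> U - (set xs \<union> set ys)" "x \<bullet> y \<noteq> 0"
      using connected[of "set xs \<union> set ys" "U - (set xs \<union> set ys)"] by fastforce
    then show False
      using maximal_arms_absorb[OF a(1) max(1), of y x]
        maximal_arms_absorb[OF a(1)[unfolded arms_sym[of xs]] max(2), of y x] by auto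
  qed
  then show thesis
    using that a by blast
qed

end

section \<open>Weighted sums and the bound on the arm lengths\<close>

text \<open>The weights fall from the length of the list at the head to 1 at the end. On a path of
  unit vectors with simple bonds this is, up to scale, the fundamental weight at the head: it is
  orthogonal to all members but the head, which makes it the optimal test vector for the bond
  there.\<close>

primrec weighted_sum :: "'a::real_vector list \<Rightarrow> 'a" where
  "weighted_sum [] = 0"
| "weighted_sum (x # xs) = real (length xs + 1) *\<^sub>R x + weighted_sum xs"

lemma inner_weighted_sum:
  assumes "\<And>i. i < length ys \<Longrightarrow> x \<bullet> ys ! i = (if i = 0 then v else 0)"
  shows "x \<bullet> weighted_sum ys = real (length ys) * v"
proof -
  have zero: "x \<bullet> weighted_sum zs = 0" if "\<And>z. z \<in> set zs \<Longrightarrow> x \<bullet> z = 0" for zs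
    using that by (induction zs) (auto simp: inner_add_right)
  show ?thesis
  proof (cases ys)
    case (Cons y zs)
    have "x \<bullet> z = 0" if z: "z \<in> set zs" for z
    proof -
      obtain i where "i < length zs" "z = zs ! i"
        using z by (metis in_set_conv_nth)
      then show ?thesis
        using assms[of "Suc i"] Cons by simp
    qed
    then show ?thesis
      using zero[of zs] assms[of 0] Cons by (simp add: inner_add_right)
  qed simp
qed

lemma norm_weighted_sum:
  assumes "\<And>i. i < length xs \<Longrightarrow> xs ! i \<bullet> xs ! i = 1"
    and "\<And>i j. i < j \<Longrightarrow> j < length xs \<Longrightarrow> xs ! i \<bullet> xs ! j = (if j = Suc i then - 1 / 2 else 0)"
  shows "weighted_sum xs \<bullet> weighted_sum xs = real (length xs) * (real (length xs) + 1) / 2"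
  using assms
proof (induction xs)
  case (Cons x xs)
  let ?n = "real (length xs)"
  have "weighted_sum xs \<bullet> weighted_sum xs = ?n * (?n + 1) / 2"
  proof (rule Cons.IH)
    show "xs ! i \<bullet> xs ! i = 1" if "i < length xs" for i
      using Cons.prems(1)[of "Suc i"] that by simp
    show "xs ! i \<bullet> xs ! j = (if j = Suc i then - 1 / 2 else 0)" if "i < j" "j < length xs" for i j
      using Cons.prems(2)[of "Suc i" "Suc j"] that by simp
  qed
  moreover have "x \<bullet> weighted_sum xs = ?n * (- 1 / 2)"
  proof (rule inner_weighted_sum)
    show "x \<bullet> xs ! i = (if i = 0 then - 1 / 2 else 0)" if "i < length xs" for i
      using Cons.prems(2)[of 0 "Suc i"] that by simp
  qed
  moreover have "x \<bullet> x = 1"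
    using Cons.prems(1)[of 0] by simp
  ultimately show ?case
    by (simp add: inner_add_left inner_add_right inner_commute[of "weighted_sum xs" x] field_simps)
qed simp

lemma weighted_sum_inner_weighted_sum:
  assumes "\<And>i j. i < length xs \<Longrightarrow> j < length ys \<Longrightarrow> xs ! i \<bullet> ys ! j = (if i = 0 \<and> j = 0 then v else 0)"
  shows "weighted_sum xs \<bullet> weighted_sum ys = real (length xs) * real (length ys) * v"
proof -
  have x: "weighted_sum ys \<bullet> xs ! i = (if i = 0 then real (length ys) * v else 0)"
    if "i < length xs" for i
    using inner_weighted_sum[of ys "xs ! i" "if i = 0 then v else 0"] assms[of i] that
    by (auto simp: inner_commute split: if_splits)
  show ?thesis
    using inner_weighted_sum[of xs "weighted_sum ys", OF x] by (simp add: inner_commute)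
qed

context obtuse_units
begin

lemma halfspace_weighted_sum:
  assumes "xs \<noteq> []" "set xs \<subseteq> U"
  shows "h \<bullet> weighted_sum xs > 0"
  using assms
proof (induction xs)
  case (Cons x xs)
  then show ?case
    using halfspace[of x] by (cases "xs = []") (auto simp: inner_add_right intro!: add_pos_pos)
qed simp

lemma arms_cross_inner:
  assumes "arms xs ys" "i < length xs" "j < length ys"
  shows "xs ! i \<bullet> ys ! j = (if i = 0 \<and> j = 0 then hd xs \<bullet> hd ys else 0)"
proof -
  have d: "distinct xs" "distinct ys" "xs \<noteq> []" "ys \<noteq> []"
    using assms by (auto simp: arms_def chain_def)
  then have i: "xs ! i = hd xs \<longleftrightarrow> i = 0" and j: "ys ! j = hd ys \<longleftrightarrow> j = 0"
    using assms(2,3) nth_eq_iff_index_eq[of xs i 0] nth_eq_iff_index_eq[of ys j 0]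
    by (auto simp: hd_conv_nth)
  show ?thesis
  proof (cases "i = 0 \<and> j = 0")
    case True
    then show ?thesis
      using d by (simp add: hd_conv_nth)
  next
    case False
    then show ?thesis
      using arms_no_cross_bond[OF assms(1), of "xs ! i" "ys ! j"] assms(2,3) i j by auto
  qed
qed

text \<open>Strict Cauchy--Schwarz for the two weighted sums.\<close>
lemma arms_length_bound:
  assumes "arms xs ys"
  shows "4 * (hd xs \<bullet> hd ys)\<^sup>2 * (real (length xs) * real (length ys))
    < (real (length xs) + 1) * (real (length ys) + 1)"
proof -
  let ?p = "real (length xs)" and ?q = "real (length ys)" and ?c = "hd xs \<bullet> hd ys"
  let ?A = "weighted_sum xs" and ?B = "weighted_sum ys"
  have s: "set xs \<subseteq> U" "set ys \<subseteq> U" "xs \<noteq> []" "ys \<noteq> []"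
    using assms by (auto simp: arms_def chain_def)
  have assms': "arms ys xs"
    using assms arms_sym by blast
  have A: "?A \<bullet> ?A = ?p * (?p + 1) / 2"
    using s nth_mem by (intro norm_weighted_sum unit arms_inner[OF assms]) auto
  have B: "?B \<bullet> ?B = ?q * (?q + 1) / 2"
    using s nth_mem by (intro norm_weighted_sum unit arms_inner[OF assms']) auto
  have AB: "?A \<bullet> ?B = ?p * ?q * ?c"
    by (rule weighted_sum_inner_weighted_sum) (rule arms_cross_inner[OF assms])
  have pos: "h \<bullet> ?A > 0" "h \<bullet> ?B > 0"
    using halfspace_weighted_sum s by auto
  then have nz: "?A \<noteq> 0" "?B \<noteq> 0"
    by auto
  let ?a = "norm ?A" and ?b = "norm ?B"
  \<comment> \<open>Equality in Cauchy-Schwarz with opposite directions would make this vector zero,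
    but it lies in the open half space. Hence its squared norm is positive, which yields the strict
    inequality.\<close>
  let ?v = "?b *\<^sub>R ?A + ?a *\<^sub>R ?B"
  have "h \<bullet> ?v > 0"
    using pos nz by (auto simp: inner_add_right intro!: add_pos_pos)
  then have "?v \<bullet> ?v > 0"
    by (metis inner_gt_zero_iff inner_zero_right less_irrefl)
  also have "?v \<bullet> ?v = ?b\<^sup>2 * (?A \<bullet> ?A) + ?a\<^sup>2 * (?B \<bullet> ?B) + 2 * ?a * ?b * (?A \<bullet> ?B)"
    by (simp add: inner_add_left inner_add_right inner_commute[of ?B ?A] power2_eq_square algebra_simps)
  also have "\<dots> = 2 * (?a * ?b) * (?a * ?b + ?A \<bullet> ?B)"
    by (simp add: dot_square_norm algebra_simps power2_eq_square)
  finally have v: "0 < 2 * (?a * ?b) * (?a * ?b + ?A \<bullet> ?B)" .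
  have "0 < 2 * (?a * ?b)"
    using nz by simp
  then have "0 < ?a * ?b + ?A \<bullet> ?B"
    using v zero_less_mult_pos by blast
  then have less: "- (?A \<bullet> ?B) < ?a * ?b"
    by linarith
  have "?c \<le> 0"
    using assms real_sqrt_ge_zero[of 2] unfolding arms_def by linarith
  then have "0 \<le> - (?A \<bullet> ?B)"
    unfolding AB by (simp add: mult_nonneg_nonpos)
  then have "(- (?A \<bullet> ?B))\<^sup>2 < (?a * ?b)\<^sup>2"
    using less by (intro power_strict_mono) simp_all
  then have "(?p * ?q * ?c)\<^sup>2 < (?A \<bullet> ?A) * (?B \<bullet> ?B)"
    by (simp add: AB power_mult_distrib dot_square_norm)
  also have "\<dots> = (?p * ?q) * ((?p + 1) * (?q + 1)) / 4"
    by (simp add: A B)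
  \<comment> \<open>One positive factor \<open>?p * ?q\<close> is common to both sides and cancels,
    leaving the bound.\<close>
  finally have "4 * (?p * ?q * ?c)\<^sup>2 < (?p * ?q) * ((?p + 1) * (?q + 1))"
    by simp
  also have "4 * (?p * ?q * ?c)\<^sup>2 = (?p * ?q) * (4 * ?c\<^sup>2 * (?p * ?q))"
    by (simp add: power2_eq_square)
  finally have "(?p * ?q) * (4 * ?c\<^sup>2 * (?p * ?q)) < (?p * ?q) * ((?p + 1) * (?q + 1))" .
  moreover have "0 < ?p * ?q"
    using s by simp
  ultimately show ?thesis
    using mult_less_cancel_left_pos by blast
qed

end

section \<open>From irreducible root systems to two arms\<close>

context based_root_system
begin

text \<open>If the parts were orthogonal, so would be their spans, and simple reflections would
  preserve the union of the spans. By \<open>roots_generated\<close> all roots lie in that union,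
  which splits the root system.\<close>

lemma irreducible_imp_connected:
  assumes "irreducible_root_system \<Delta>" "A \<noteq> {}" "B \<noteq> {}" "A \<union> B = S"
  shows "\<exists>\<alpha>\<in>A. \<exists>\<beta>\<in>B. \<alpha> \<bullet> \<beta> \<noteq> 0"
proof (rule ccontr)
  assume "\<not> ?thesis"
  then have AB: "\<alpha> \<bullet> \<beta> = 0" if "\<alpha> \<in> A" "\<beta> \<in> B" for \<alpha> \<beta>
    using that by blast
  have "orthogonal \<beta> v" if \<beta>: "\<beta> \<in> B" and v: "v \<in> span A" for \<beta> v
    by (rule orthogonal_to_span[OF v]) (metis AB \<beta> inner_commute orthogonal_def)
  then have 1: "orthogonal v \<beta>" if "\<beta> \<in> B" "v \<in> span A" for \<beta> v
    using that orthogonal_commute by blast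
  have "orthogonal v w" if v: "v \<in> span A" and w: "w \<in> span B" for v w
    by (rule orthogonal_to_span[OF w]) (rule 1[OF _ v])
  then have orth: "v \<bullet> w = 0" if "v \<in> span A" "w \<in> span B" for v w
    using that unfolding orthogonal_def by blast
  have fixed: "reflection \<alpha> v = v" if "v \<bullet> \<alpha> = 0" for \<alpha> v :: 'a
    using that by (simp add: reflection_def inner_coroot)
  have stable: "reflection \<alpha> v \<in> span C" if "\<alpha> \<in> C" "v \<in> span C" for \<alpha> v and C :: "'a set"
    unfolding reflection_def using that by (intro span_diff span_scale) (auto intro: span_base)
  have "\<Delta> \<subseteq> span A \<union> span B"
  proof (rule roots_generated)
    show "S \<subseteq> span A \<union> span B"
      using assms(4) span_superset by blast
    show "- v \<in> span A \<union> span B" if "v \<in> span A \<union> span B" for v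
      using that by (auto simp: span_neg)
    fix \<alpha> v assume \<alpha>: "\<alpha> \<in> S" and v: "v \<in> span A \<union> span B"
    consider "\<alpha> \<in> A" "v \<in> span A" | "\<alpha> \<in> B" "v \<in> span B"
      | "\<alpha> \<in> A" "v \<in> span B" | "\<alpha> \<in> B" "v \<in> span A"
      using \<alpha> v assms(4) by blast
    then show "reflection \<alpha> v \<in> span A \<union> span B"
    proof cases
      case 1
      show ?thesis
        by (rule UnI1[OF stable[OF 1]])
    next
      case 2
      show ?thesis
        by (rule UnI2[OF stable[OF 2]])
    next
      case 3
      then have "v \<bullet> \<alpha> = 0"
        using orth[OF span_base, of \<alpha> v] by (simp add: inner_commute)
      then show ?thesis
        using fixed v by simp
    next
      case 4
      then have "v \<bullet> \<alpha> = 0"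
        using orth[OF _ span_base, of v \<alpha>] by simp
      then show ?thesis
        using fixed v by simp
    qed
  qed
  then have un: "(\<Delta> \<inter> span A) \<union> (\<Delta> \<inter> span B) = \<Delta>"
    by blast
  have "v \<notin> \<Delta>" if "v \<in> span A" "v \<in> span B" for v
    using orth[OF that] zero_notin by auto
  then have disj: "(\<Delta> \<inter> span A) \<inter> (\<Delta> \<inter> span B) = {}"
    by (simp only: disjoint_iff Int_iff) metis
  have ne: "\<Delta> \<inter> span C \<noteq> {}" if "C \<noteq> {}" "C \<subseteq> S" for C
  proof -
    obtain \<alpha> where "\<alpha> \<in> C"
      using \<open>C \<noteq> {}\<close> by (meson ex_in_conv)
    then have "\<alpha> \<in> \<Delta> \<inter> span C"
      using \<open>C \<subseteq> S\<close> S_subset span_base by (metis IntI subsetD)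
    then show ?thesis
      by (metis empty_iff)
  qed
  have "\<forall>\<alpha>\<in>\<Delta> \<inter> span A. \<forall>\<beta>\<in>\<Delta> \<inter> span B. \<alpha> \<bullet> \<beta> = 0"
    by (metis orth IntD2)
  then have "\<exists>A B. A \<noteq> {} \<and> B \<noteq> {} \<and> A \<union> B = \<Delta> \<and> A \<inter> B = {} \<and> (\<forall>\<alpha>\<in>A. \<forall>\<beta>\<in>B. \<alpha> \<bullet> \<beta> = 0)"
    using un disj ne[OF assms(2) Un_upper1[of A B, unfolded assms(4)]]
      ne[OF assms(3) Un_upper2[of B A, unfolded assms(4)]]
    by (intro exI[of _ "\<Delta> \<inter> span A"] exI[of _ "\<Delta> \<inter> span B"]) simp
  then show False
    using assms(1) unfolding irreducible_root_system_def by (elim conjE notE)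
qed

text \<open>\<open>m\<close> and \<open>n\<close> are the negated Cartan integers of the pair, and
  their product is the multiplicity of the bond, four times the squared cosine.\<close>

lemma simple_cartan:
  assumes "\<alpha> \<in> S" "\<beta> \<in> S" "\<alpha> \<noteq> \<beta>"
  obtains m n :: nat where "2 * (\<alpha> \<bullet> \<beta>) = - real m * (\<beta> \<bullet> \<beta>)" "2 * (\<alpha> \<bullet> \<beta>) = - real n * (\<alpha> \<bullet> \<alpha>)"
    "4 * (sgn \<alpha> \<bullet> sgn \<beta>)\<^sup>2 = real (m * n)" "sgn \<alpha> \<bullet> sgn \<beta> \<le> 0"
proof -
  have nz: "\<alpha> \<noteq> 0" "\<beta> \<noteq> 0"
    using assms S_subset zero_notin by auto
  have ex: "\<exists>m :: nat. 2 * (\<alpha> \<bullet> \<beta>) = - real m * (\<beta> \<bullet> \<beta>)" if "\<alpha> \<in> S" "\<beta> \<in> S" "\<alpha> \<noteq> \<beta>" for \<alpha> \<beta>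
  proof -
    have pos: "\<beta> \<bullet> \<beta> > 0"
      using that S_subset zero_notin by auto
    have "- (\<alpha> \<bullet> coroot \<beta>) \<ge> 0"
      using simple_inner_nonpos[OF that] pos by (simp add: inner_coroot divide_nonpos_pos)
    moreover have "- (\<alpha> \<bullet> coroot \<beta>) \<in> \<int>"
      using integral that S_subset by (intro Ints_minus) blast
    ultimately obtain m :: nat where "- (\<alpha> \<bullet> coroot \<beta>) = real m"
      by (metis Ints_cases of_int_0_le_iff of_nat_nat)
    then show ?thesis
      using pos by (intro exI[of _ m]) (simp add: inner_coroot field_simps)
  qed
  obtain m n :: nat where mn: "2 * (\<alpha> \<bullet> \<beta>) = - real m * (\<beta> \<bullet> \<beta>)" "2 * (\<alpha> \<bullet> \<beta>) = - real n * (\<alpha> \<bullet> \<alpha>)"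
    using ex[OF assms] ex[OF assms(2,1)] assms(3) by (metis inner_commute)
  have "4 * (sgn \<alpha> \<bullet> sgn \<beta>)\<^sup>2 = (2 * (\<alpha> \<bullet> \<beta>)) * (2 * (\<alpha> \<bullet> \<beta>)) / ((\<alpha> \<bullet> \<alpha>) * (\<beta> \<bullet> \<beta>))"
    by (simp add: sgn_div_norm dot_square_norm field_simps power2_eq_square)
  also have "\<dots> = (real n * (\<alpha> \<bullet> \<alpha>)) * (real m * (\<beta> \<bullet> \<beta>)) / ((\<alpha> \<bullet> \<alpha>) * (\<beta> \<bullet> \<beta>))"
    by (subst mn(1), subst mn(2)) simp
  also have "\<dots> = real (m * n)"
    using nz by simp
  finally have "4 * (sgn \<alpha> \<bullet> sgn \<beta>)\<^sup>2 = real (m * n)" .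
  moreover have "sgn \<alpha> \<bullet> sgn \<beta> \<le> 0"
    using simple_inner_nonpos[OF assms] by (simp add: sgn_div_norm mult_nonneg_nonpos)
  ultimately show thesis
    using that mn by blast
qed

lemma simple_bond_norm:
  assumes "\<alpha> \<in> S" "\<beta> \<in> S" "\<alpha> \<noteq> \<beta>" "sgn \<alpha> \<bullet> sgn \<beta> = - 1 / 2"
  shows "norm \<alpha> = norm \<beta>"
proof -
  obtain m n :: nat where mn: "2 * (\<alpha> \<bullet> \<beta>) = - real m * (\<beta> \<bullet> \<beta>)" "2 * (\<alpha> \<bullet> \<beta>) = - real n * (\<alpha> \<bullet> \<alpha>)"
    "4 * (sgn \<alpha> \<bullet> sgn \<beta>)\<^sup>2 = real (m * n)"
    using simple_cartan[OF assms(1-3)] by metis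
  then have "real (m * n) = 1"
    using assms(4) by (simp add: power2_eq_square)
  then have "m * n = 1"
    using of_nat_eq_1_iff by blast
  then have "m = 1" "n = 1"
    by auto
  then show ?thesis
    using mn by (simp add: norm_eq_sqrt_inner)
qed

lemma multiple_bond_norm:
  assumes "\<alpha> \<in> S" "\<beta> \<in> S" "\<alpha> \<noteq> \<beta>" "4 * (sgn \<alpha> \<bullet> sgn \<beta>)\<^sup>2 = real N" "prime N"
  shows "\<alpha> \<bullet> \<alpha> = N * (\<beta> \<bullet> \<beta>) \<or> \<beta> \<bullet> \<beta> = N * (\<alpha> \<bullet> \<alpha>)"
proof -
  obtain m n :: nat where mn: "2 * (\<alpha> \<bullet> \<beta>) = - real m * (\<beta> \<bullet> \<beta>)" "2 * (\<alpha> \<bullet> \<beta>) = - real n * (\<alpha> \<bullet> \<alpha>)"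
    "4 * (sgn \<alpha> \<bullet> sgn \<beta>)\<^sup>2 = real (m * n)"
    using simple_cartan[OF assms(1-3)] by metis
  then have "m * n = N"
    using assms(4) by (metis of_nat_eq_iff)
  then have "m = 1 \<and> n = N \<or> m = N \<and> n = 1"
    using assms(5) by (metis dvd_triv_left mult.right_neutral mult_cancel1 not_prime_0 prime_nat_iff mult_1)
  then show ?thesis
    using mn by auto
qed

lemma inj_on_sgn_simple: "inj_on sgn S"
proof (rule inj_onI, rule ccontr)
  fix \<alpha> \<beta> assume *: "\<alpha> \<in> S" "\<beta> \<in> S" "sgn \<alpha> = sgn \<beta>" "\<alpha> \<noteq> \<beta>"
  then have "sgn \<beta> \<bullet> sgn \<beta> \<le> 0"
    using simple_cartan[of \<alpha> \<beta>] by metis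
  then show False
    using * S_subset zero_notin by (metis inner_gt_zero_iff not_less sgn_zero_iff subsetD)
qed

lemma obtuse_units_simple: "\<exists>h. obtuse_units (sgn ` S) h"
proof -
  have lin: "linear (\<lambda>v. \<Sum>\<alpha>\<in>S. crd v \<alpha>)"
    by (rule linear_compose_sum) (simp add: crd_linear)
  \<comment> \<open>The vector representing the height functional, which takes the value 1 on every
    simple root.\<close>
  define h where "h = adjoint (\<lambda>v. \<Sum>\<alpha>\<in>S. crd v \<alpha>) 1"
  have h: "h \<bullet> v = (\<Sum>\<alpha>\<in>S. crd v \<alpha>)" for v
    using adjoint_works[OF lin, of v 1] by (simp add: h_def inner_commute)
  have nz: "\<alpha> \<noteq> 0" if "\<alpha> \<in> S" for \<alpha>
    using that S_subset zero_notin by auto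
  have "obtuse_units (sgn ` S) h"
  proof
    show "finite (sgn ` S)"
      using finite_S by simp
  next
    fix x assume "x \<in> sgn ` S"
    then obtain \<alpha> where \<alpha>: "\<alpha> \<in> S" "x = sgn \<alpha>"
      by blast
    show "x \<bullet> x = 1"
      using nz[OF \<alpha>(1)] by (simp add: \<alpha>(2) dot_square_norm norm_sgn)
    have "h \<bullet> \<alpha> = 1"
      using \<alpha>(1) finite_S by (simp add: h crd_simple)
    then show "h \<bullet> x > 0"
      using nz[OF \<alpha>(1)] by (simp add: \<alpha>(2) sgn_div_norm)
  next
    fix x y assume "x \<in> sgn ` S" "y \<in> sgn ` S" "x \<noteq> y"
    then obtain \<alpha> \<beta> where \<alpha>: "\<alpha> \<in> S" "x = sgn \<alpha>" and \<beta>: "\<beta> \<in> S" "y = sgn \<beta>" and "\<alpha> \<noteq> \<beta>"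
      by blast
    then obtain m n :: nat where mn: "4 * (x \<bullet> y)\<^sup>2 = real (m * n)" "x \<bullet> y \<le> 0"
      using simple_cartan[of \<alpha> \<beta>] by metis
    consider "m * n = 0" | "m * n = 1" | "m * n \<ge> 2"
      by linarith
    then show "x \<bullet> y = 0 \<or> x \<bullet> y = - 1 / 2 \<or> x \<bullet> y \<le> - (sqrt 2 / 2)"
    proof cases
      case 1
      then have "4 * (x \<bullet> y)\<^sup>2 = 0"
        using mn(1) by (simp only: of_nat_0)
      then show ?thesis
        by simp
    next
      case 2
      then have "(x \<bullet> y)\<^sup>2 = (1 / 2)\<^sup>2"
        using mn(1) by (simp add: power2_eq_square)
      then show ?thesis
        using mn(2) by (auto simp: power2_eq_iff)
    next
      case 3
      then have "real (m * n) \<ge> 2"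
        by linarith
      then have "(sqrt 2 / 2)\<^sup>2 \<le> (- (x \<bullet> y))\<^sup>2"
        using mn(1) by (simp add: power_divide)
      then have "sqrt 2 / 2 \<le> - (x \<bullet> y)"
        by (rule power2_le_imp_le) (use mn(2) in simp)
      then show ?thesis
        by simp
    qed
  qed
  then show ?thesis
    by (rule exI)
qed

text \<open>Connectedness yields non-orthogonal simple roots of different lengths. A simple bond
  would force equal lengths, so theirs is multiple and starts the two arms. Within an arm all bonds
  are simple, hence the lengths are constant there; \<open>N\<close> is the product of the Cartan
  integers at the bond between the heads.\<close>

lemma base_with_two_lengths:
  assumes "irreducible_root_system \<Delta>" "\<not> (\<exists>r. \<forall>\<alpha>\<in>S. norm \<alpha> = r)"
  obtains a b :: "nat \<Rightarrow> 'a" and p q N :: nat where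
    "0 < p" "0 < q" "inj_on a {..<p}" "inj_on b {..<q}" "a ` {..<p} \<inter> b ` {..<q} = {}"
    "S = a ` {..<p} \<union> b ` {..<q}"
    "\<And>i j. i < j \<Longrightarrow> j < p \<Longrightarrow> sgn (a i) \<bullet> sgn (a j) = (if j = Suc i then - 1 / 2 else 0)"
    "\<And>i j. i < j \<Longrightarrow> j < q \<Longrightarrow> sgn (b i) \<bullet> sgn (b j) = (if j = Suc i then - 1 / 2 else 0)"
    "\<And>i j. i < p \<Longrightarrow> j < q \<Longrightarrow> sgn (a i) \<bullet> sgn (b j) = (if i = 0 \<and> j = 0 then - (sqrt N / 2) else 0)"
    "\<And>i. i < p \<Longrightarrow> norm (a i) = norm (a 0)" "\<And>i. i < q \<Longrightarrow> norm (b i) = norm (b 0)"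
    "N = 2 \<or> N = 3" "a 0 \<bullet> a 0 = N * (b 0 \<bullet> b 0) \<or> b 0 \<bullet> b 0 = N * (a 0 \<bullet> a 0)"
    "N * (p * q) < (p + 1) * (q + 1)"
proof -
  obtain h where "obtuse_units (sgn ` S) h"
    using obtuse_units_simple by blast
  then interpret U: obtuse_units "sgn ` S" h .
  have nz: "\<alpha> \<noteq> 0" if "\<alpha> \<in> S" for \<alpha>
    using that S_subset zero_notin by auto
  obtain \<gamma> where \<gamma>: "\<gamma> \<in> S"
    using assms(2) by blast
  \<comment> \<open>Splitting the base by length gives two nonempty parts, and connectedness finds a
    bond between them.\<close>
  have "{\<alpha> \<in> S. norm \<alpha> = norm \<gamma>} \<noteq> {}" "{\<alpha> \<in> S. norm \<alpha> \<noteq> norm \<gamma>} \<noteq> {}"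
    using \<gamma> assms(2) by blast+
  then obtain \<alpha> \<beta> where \<alpha>\<beta>: "\<alpha> \<in> S" "\<beta> \<in> S" "norm \<alpha> \<noteq> norm \<beta>" "\<alpha> \<bullet> \<beta> \<noteq> 0"
    using irreducible_imp_connected[OF assms(1), of "{\<alpha> \<in> S. norm \<alpha> = norm \<gamma>}" "{\<alpha> \<in> S. norm \<alpha> \<noteq> norm \<gamma>}"]
    by fastforce
  have "sgn \<alpha> \<bullet> sgn \<beta> \<noteq> 0"
    using \<alpha>\<beta> nz by (simp add: sgn_div_norm)
  then have "sgn \<alpha> \<bullet> sgn \<beta> \<le> - (sqrt 2 / 2)"
    using U.obtuse[of "sgn \<alpha>" "sgn \<beta>"] simple_bond_norm[of \<alpha> \<beta>] \<alpha>\<beta> inj_on_sgn_simple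
    by (auto simp: inj_on_def)
  then have "U.arms [sgn \<alpha>] [sgn \<beta>]"
    using \<alpha>\<beta> inj_on_sgn_simple by (auto simp: U.arms_def U.chain_def inj_on_def)
  then obtain xs ys where arms: "U.arms xs ys" "set xs \<union> set ys = sgn ` S"
  proof (rule U.diagram_is_two_arms)
    fix A B assume AB: "A \<noteq> {}" "B \<noteq> {}" "A \<union> B = sgn ` S" "A \<inter> B = {}"
    let ?A = "{\<alpha> \<in> S. sgn \<alpha> \<in> A}" and ?B = "{\<alpha> \<in> S. sgn \<alpha> \<in> B}"
    have "A \<subseteq> sgn ` S" "B \<subseteq> sgn ` S"
      using AB(3) by blast+
    then have "?A \<noteq> {}" "?B \<noteq> {}"
      using AB(1,2) by fast+
    moreover have "?A \<union> ?B = S"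
      using AB(3) by (auto simp: set_eq_iff)
    ultimately obtain \<alpha> \<beta> where "\<alpha> \<in> ?A" "\<beta> \<in> ?B" "\<alpha> \<bullet> \<beta> \<noteq> 0"
      using irreducible_imp_connected[OF assms(1), of ?A ?B] by blast
    moreover from this have "sgn \<alpha> \<bullet> sgn \<beta> \<noteq> 0"
      using nz by (simp add: sgn_div_norm)
    ultimately show "\<exists>x\<in>A. \<exists>y\<in>B. x \<bullet> y \<noteq> 0"
      by blast
  qed blast
  define a where "a i = inv_into S sgn (xs ! i)" for i
  define b where "b i = inv_into S sgn (ys ! i)" for i
  define p where "p = length xs"
  define q where "q = length ys"
  have s: "set xs \<subseteq> sgn ` S" "set ys \<subseteq> sgn ` S" "xs \<noteq> []" "ys \<noteq> []" "distinct xs" "distinct ys"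
    "set xs \<inter> set ys = {}"
    using arms by (auto simp: U.arms_def U.chain_def)
  have a: "a i \<in> S" "sgn (a i) = xs ! i" if "i < p" for i
    using that s by (auto simp: a_def p_def inv_into_into f_inv_into_f subset_iff)
  have b: "b i \<in> S" "sgn (b i) = ys ! i" if "i < q" for i
    using that s by (auto simp: b_def q_def inv_into_into f_inv_into_f subset_iff)
  have sa: "sgn ` a ` {..<p} = set xs"
    using a(2) by (auto simp: p_def set_conv_nth image_image)
  have sb: "sgn ` b ` {..<q} = set ys"
    using b(2) by (auto simp: q_def set_conv_nth image_image)
  have pq: "0 < p" "0 < q"
    using s by (auto simp: p_def q_def)
  have aa: "sgn (a i) \<bullet> sgn (a j) = (if j = Suc i then - 1 / 2 else 0)" if "i < j" "j < p" for i j
    using U.arms_inner[OF arms(1), of i j] that a(2) by (simp add: p_def)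
  have bb: "sgn (b i) \<bullet> sgn (b j) = (if j = Suc i then - 1 / 2 else 0)" if "i < j" "j < q" for i j
    using U.arms_inner[OF arms(1)[unfolded U.arms_sym[of xs]], of i j] that b(2) by (simp add: q_def)
  have inja: "inj_on a {..<p}"
  proof (rule inj_onI)
    fix i j assume ij: "i \<in> {..<p}" "j \<in> {..<p}" "a i = a j"
    then have "xs ! i = xs ! j"
      using a(2)[of i] a(2)[of j] by simp
    then show "i = j"
      using ij s(5) by (simp add: nth_eq_iff_index_eq p_def)
  qed
  have injb: "inj_on b {..<q}"
  proof (rule inj_onI)
    fix i j assume ij: "i \<in> {..<q}" "j \<in> {..<q}" "b i = b j"
    then have "ys ! i = ys ! j"
      using b(2)[of i] b(2)[of j] by simp
    then show "i = j"
      using ij s(6) by (simp add: nth_eq_iff_index_eq q_def)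
  qed
  have disj: "a ` {..<p} \<inter> b ` {..<q} = {}"
  proof -
    have "sgn ` (a ` {..<p} \<inter> b ` {..<q}) \<subseteq> set xs \<inter> set ys"
      unfolding sa[symmetric] sb[symmetric] by blast
    then show ?thesis
      using s(7) by simp
  qed
  have norma: "norm (a i) = norm (a 0)" if "i < p" for i
    using that
  proof (induction i)
    case (Suc i)
    have "a i \<noteq> a (Suc i)"
      using inja Suc.prems by (auto dest: inj_onD)
    then show ?case
      using Suc simple_bond_norm[of "a i" "a (Suc i)"] a aa[of i "Suc i"] by simp
  qed simp
  have normb: "norm (b i) = norm (b 0)" if "i < q" for i
    using that
  proof (induction i)
    case (Suc i)
    have "b i \<noteq> b (Suc i)"
      using injb Suc.prems by (auto dest: inj_onD)
    then show ?case
      using Suc simple_bond_norm[of "b i" "b (Suc i)"] b bb[of i "Suc i"] by simp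
  qed simp
  have hd: "hd xs = sgn (a 0)" "hd ys = sgn (b 0)"
    using s pq a(2) b(2) by (auto simp: hd_conv_nth)
  have ne: "a 0 \<noteq> b 0"
    using disj pq by auto
  have ab0: "a 0 \<in> S" "b 0 \<in> S"
    using a b pq by auto
  have multi: "sgn (a 0) \<bullet> sgn (b 0) \<le> - (sqrt 2 / 2)"
    using arms(1) by (simp add: U.arms_def hd)
  obtain m n :: nat where mn: "4 * (sgn (a 0) \<bullet> sgn (b 0))\<^sup>2 = real (m * n)" "sgn (a 0) \<bullet> sgn (b 0) \<le> 0"
    using simple_cartan[OF ab0 ne] by metis
  define N where "N = m * n"
  have "real N * (real p * real q) < (real p + 1) * (real q + 1)"
    using U.arms_length_bound[OF arms(1)] mn(1) by (simp add: hd N_def p_def q_def)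
  then have bound: "N * (p * q) < (p + 1) * (q + 1)"
    using of_nat_less_iff[where 'a = real, of "N * (p * q)" "(p + 1) * (q + 1)"]
    by (simp only: of_nat_mult of_nat_add of_nat_1)
  have "(sqrt 2 / 2)\<^sup>2 \<le> (- (sgn (a 0) \<bullet> sgn (b 0)))\<^sup>2"
    using multi by (intro power_mono) auto
  then have "real N \<ge> 2"
    using mn(1) by (simp add: N_def power_divide)
  then have "N \<ge> 2"
    by simp
  \<comment> \<open>Since \<open>p\<close> and \<open>q\<close> are at least 1,
    \<open>(p + 1) * (q + 1)\<close> is at most \<open>4 * (p * q)\<close>, so the length bound
    itself rules out \<open>N \<ge> 4\<close>.\<close>
  moreover have "N < 4"
  proof (rule ccontr)
    assume "\<not> N < 4"
    then have "4 * (p * q) \<le> N * (p * q)"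
      by (intro mult_le_mono1) simp
    then have "4 * (p * q) < (p + 1) * (q + 1)"
      using bound by linarith
    moreover have "p + 1 \<le> 2 * p" "q + 1 \<le> 2 * q"
      using pq by auto
    then have "(p + 1) * (q + 1) \<le> (2 * p) * (2 * q)"
      by (rule mult_le_mono)
    ultimately show False
      by simp
  qed
  ultimately have N: "N = 2 \<or> N = 3"
    by linarith
  have "(- (2 * (sgn (a 0) \<bullet> sgn (b 0))))\<^sup>2 = real N"
    using mn(1) by (simp add: N_def power_mult_distrib)
  then have "sqrt N = - (2 * (sgn (a 0) \<bullet> sgn (b 0)))"
    using mn(2) by (intro real_sqrt_unique) auto
  then have c0: "sgn (a 0) \<bullet> sgn (b 0) = - (sqrt N / 2)"
    by simp
  have ab: "sgn (a i) \<bullet> sgn (b j) = (if i = 0 \<and> j = 0 then - (sqrt N / 2) else 0)" if "i < p" "j < q" for i j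
    using U.arms_cross_inner[OF arms(1), of i j] that a(2) b(2) c0 by (simp add: p_def q_def hd)
  have "prime N"
    using N by auto
  moreover have "4 * (sgn (a 0) \<bullet> sgn (b 0))\<^sup>2 = real N"
    using mn(1) by (simp add: N_def)
  ultimately have len: "a 0 \<bullet> a 0 = N * (b 0 \<bullet> b 0) \<or> b 0 \<bullet> b 0 = N * (a 0 \<bullet> a 0)"
    using multiple_bond_norm[OF ab0 ne] by blast
  have eq: "sgn ` (a ` {..<p} \<union> b ` {..<q}) = sgn ` S"
    unfolding image_Un sa sb by (rule arms(2))
  have sub: "a ` {..<p} \<union> b ` {..<q} \<subseteq> S"
    using a(1) b(1) by blast
  have Sab: "S = a ` {..<p} \<union> b ` {..<q}"
    by (rule inj_on_image_eq_iff[OF inj_on_sgn_simple sub subset_refl, THEN iffD1, OF eq, symmetric])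
  show thesis
    by (rule that[OF pq inja injb disj Sab aa bb ab norma normb N len bound])
qed

end

subsection \<open>Positive roots of type B and C as a folded triangle\<close>

text \<open>
  The simple roots \<open>\<alpha> 0, ..., \<alpha> (n - 1)\<close> are laid out along the integers, and the negative half
  is folded back onto the positive one: for \<open>r = 0\<close> around the vertex \<open>0\<close> (type C), for
  \<open>r = 1\<close> around the gap left of it (type B). The positive roots are then the sums over the
  intervals \<open>{k..<l}\<close> with \<open>- l < k < l\<close>, and the root order becomes inclusion of
  intervals, independently of \<open>r\<close>.
\<close>

definition fold_index :: "int \<Rightarrow> int \<Rightarrow> nat" where
  "fold_index r t = nat (if t \<ge> 0 then t else - t - r)"

definition folded_sum :: "int \<Rightarrow> (nat \<Rightarrow> 'a) \<Rightarrow> int \<Rightarrow> int \<Rightarrow> 'a::real_vector" where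
  "folded_sum r \<alpha> l k = (\<Sum>t\<in>{k..<l}. \<alpha> (fold_index r t))"

definition triangle :: "nat \<Rightarrow> (int \<times> int) set" where
  "triangle n = {(l, k). 1 \<le> l \<and> l \<le> int n \<and> - l < k \<and> k < l}"

definition fold_mult :: "int \<Rightarrow> int \<Rightarrow> int \<Rightarrow> nat \<Rightarrow> nat" where
  "fold_mult r l k m = card {t \<in> {k..<l}. fold_index r t = m}"

lemma fold_index_less:
  assumes "(l, k) \<in> triangle n" "t \<in> {k..<l}" "r = 0 \<or> r = 1"
  shows "fold_index r t < n"
  using assms by (auto simp: triangle_def fold_index_def)

lemma folded_sum_extend_right:
  assumes "k \<le> l" "0 \<le> l"
  shows "folded_sum r \<alpha> (l + 1) k = folded_sum r \<alpha> l k + \<alpha> (nat l)"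
proof -
  have "{k..<l + 1} = insert l {k..<l}"
    using assms by auto
  then show ?thesis
    using assms by (simp add: folded_sum_def fold_index_def)
qed

lemma folded_sum_extend_left:
  assumes "k \<le> l"
  shows "folded_sum r \<alpha> l (k - 1) = folded_sum r \<alpha> l k + \<alpha> (fold_index r (k - 1))"
proof -
  have "{k - 1..<l} = insert (k - 1) {k..<l}"
    using assms by auto
  then show ?thesis
    by (simp add: folded_sum_def)
qed

lemma folded_sum_simple: "folded_sum r \<alpha> (int m + 1) (int m) = \<alpha> m"
proof -
  have "{int m..<int m + 1} = {int m}"
    by auto
  then show ?thesis
    by (simp add: folded_sum_def fold_index_def)
qed

lemma folded_sum_eq_sum_mult:
  assumes "(l, k) \<in> triangle n" "r = 0 \<or> r = 1"
  shows "folded_sum r \<alpha> l k = (\<Sum>m<n. real (fold_mult r l k m) *\<^sub>R \<alpha> m)"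
proof -
  have "folded_sum r \<alpha> l k = (\<Sum>m<n. \<Sum>t\<in>{t \<in> {k..<l}. fold_index r t = m}. \<alpha> (fold_index r t))"
    unfolding folded_sum_def
    by (rule sum.group[symmetric]) (use fold_index_less assms in auto)
  also have "\<dots> = (\<Sum>m<n. real (fold_mult r l k m) *\<^sub>R \<alpha> m)"
  proof (rule sum.cong[OF refl])
    fix m
    have "(\<Sum>t\<in>{t \<in> {k..<l}. fold_index r t = m}. \<alpha> (fold_index r t)) = (\<Sum>t\<in>{t \<in> {k..<l}. fold_index r t = m}. \<alpha> m)"
      by (rule sum.cong) auto
    then show "(\<Sum>t\<in>{t \<in> {k..<l}. fold_index r t = m}. \<alpha> (fold_index r t)) = real (fold_mult r l k m) *\<^sub>R \<alpha> m"
      by (simp add: fold_mult_def sum_constant_scaleR)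
  qed
  finally show ?thesis .
qed

lemma finite_fold_fibre: "finite {t \<in> {k..<l}. fold_index r t = m}"
  by (rule finite_subset[of _ "{k..<l}"]) auto

lemma fold_mult_pos_iff: "0 < fold_mult r l k m \<longleftrightarrow> (\<exists>t\<in>{k..<l}. fold_index r t = m)"
  unfolding fold_mult_def card_gt_0_iff using finite_fold_fibre by blast

text \<open>The right ends are compared by the top index \<open>l - 1\<close>, which must occur in
  the larger root. The left ends are compared by support as long as one of them has not crossed the
  fold, and by a multiplicity of 2 once both have.\<close>

lemma triangle_order:
  assumes lk: "(l, k) \<in> triangle n" and lk': "(l', k') \<in> triangle n" and r: "r = 0 \<or> r = 1"
    and le: "\<And>m. m < n \<Longrightarrow> fold_mult r l k m \<le> fold_mult r l' k' m"
  shows "l \<le> l' \<and> k' \<le> k"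
proof
  have transfer: "\<exists>t'\<in>{k'..<l'}. fold_index r t' = fold_index r t" if "t \<in> {k..<l}" for t
  proof -
    have "0 < fold_mult r l k (fold_index r t)"
      using that fold_mult_pos_iff by blast
    then have "0 < fold_mult r l' k' (fold_index r t)"
      using le[OF fold_index_less[OF lk that r]] by simp
    then show ?thesis
      using fold_mult_pos_iff by blast
  qed
  have b: "1 \<le> l" "l \<le> int n" "- l < k" "k < l" "1 \<le> l'" "l' \<le> int n" "- l' < k'" "k' < l'"
    using lk lk' by (auto simp: triangle_def)
  obtain t where "t \<in> {k'..<l'}" "fold_index r t = fold_index r (l - 1)"
    using transfer[of "l - 1"] b by auto
  then show "l \<le> l'"
    using b r by (auto simp: fold_index_def split: if_splits)
  show "k' \<le> k"
  proof (rule ccontr)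
    assume "\<not> k' \<le> k"
    then have kk: "k < k'"
      by simp
    show False
    proof (cases "0 \<le> k \<or> 0 < k'")
      case True
      \<comment> \<open>Here \<open>k' > max k 0\<close>, so every index met from \<open>k'\<close>
        on is larger than \<open>max k 0\<close>.\<close>
      obtain t where "t \<in> {k'..<l'}" "fold_index r t = fold_index r (max k 0)"
        using transfer[of "max k 0"] b by auto
      then show False
        using True kk by (auto simp: fold_index_def max_def split: if_splits)
    next
      case False
      \<comment> \<open>With \<open>k < 0\<close> and \<open>k' \<le> 0\<close>, the index of
        \<open>k\<close> is hit twice from \<open>k\<close> on, at \<open>k\<close> itself and at
        its mirror image \<open>int m\<close>, but from \<open>k' > k\<close> on at most
        once.\<close>
      define m where "m = fold_index r k"
      have "m < n"
        unfolding m_def by (rule fold_index_less[OF lk _ r]) (use b in auto)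
      have "{k, int m} \<subseteq> {t \<in> {k..<l}. fold_index r t = m}"
        using False b r by (auto simp: m_def fold_index_def)
      then have "card {k, int m} \<le> fold_mult r l k m"
        unfolding fold_mult_def by (rule card_mono[OF finite_fold_fibre])
      also have "card {k, int m} = 2"
        using False by simp
      finally have "2 \<le> fold_mult r l' k' m"
        using le[OF \<open>m < n\<close>] by simp
      moreover have "{t \<in> {k'..<l'}. fold_index r t = m} \<subseteq> {int m}"
        using False kk r by (auto simp: m_def fold_index_def split: if_splits)
      then have "fold_mult r l' k' m \<le> card {int m}"
        unfolding fold_mult_def by (intro card_mono) auto
      ultimately show False
        by simp
    qed
  qed
qed

section \<open>Ideals as up-closed sets of intervals\<close>

locale folded_root_system = based_root_system +
  fixes \<alpha> :: "nat \<Rightarrow> 'a" and n :: nat and r :: int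
  assumes r: "r = 0 \<or> r = 1"
    and inj_\<alpha>: "inj_on \<alpha> {..<n}"
    and S_eq: "S = \<alpha> ` {..<n}"
    and P_eq: "P = (\<lambda>(l, k). folded_sum r \<alpha> l k) ` triangle n"
begin

abbreviation rt :: "int \<times> int \<Rightarrow> 'a" where "rt \<equiv> \<lambda>(l, k). folded_sum r \<alpha> l k"

lemma crd_folded_sum:
  assumes "(l, k) \<in> triangle n" "m < n"
  shows "crd (folded_sum r \<alpha> l k) (\<alpha> m) = real (fold_mult r l k m)"
proof -
  have "crd (folded_sum r \<alpha> l k) (\<alpha> m) = (\<Sum>j<n. real (fold_mult r l k j) * crd (\<alpha> j) (\<alpha> m))"
    unfolding folded_sum_eq_sum_mult[OF assms(1) r]
    by (simp add: linear_sum[OF crd_linear] linear_scale[OF crd_linear])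
  also have "\<dots> = (\<Sum>j<n. if j = m then real (fold_mult r l k j) else 0)"
  proof (rule sum.cong[OF refl])
    fix j assume "j \<in> {..<n}"
    then have "crd (\<alpha> j) (\<alpha> m) = (if j = m then 1 else 0)"
      using crd_simple[of "\<alpha> j" "\<alpha> m"] S_eq inj_\<alpha> assms(2) by (auto simp: inj_on_def)
    then show "real (fold_mult r l k j) * crd (\<alpha> j) (\<alpha> m) = (if j = m then real (fold_mult r l k j) else 0)"
      by simp
  qed
  finally show ?thesis
    using assms(2) by simp
qed

lemma triangle_order_if_crd_le:
  assumes "(l, k) \<in> triangle n" "(l', k') \<in> triangle n"
    and "\<And>\<beta>. \<beta> \<in> S \<Longrightarrow> crd (folded_sum r \<alpha> l k) \<beta> \<le> crd (folded_sum r \<alpha> l' k') \<beta>"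
  shows "l \<le> l' \<and> k' \<le> k"
proof (rule triangle_order[OF assms(1,2) r])
  fix m assume m: "m < n"
  then have "crd (folded_sum r \<alpha> l k) (\<alpha> m) \<le> crd (folded_sum r \<alpha> l' k') (\<alpha> m)"
    using assms(3) S_eq by blast
  then show "fold_mult r l k m \<le> fold_mult r l' k' m"
    using crd_folded_sum[OF assms(1) m] crd_folded_sum[OF assms(2) m] by simp
qed

lemma inj_rt: "inj_on rt (triangle n)"
proof (rule inj_onI)
  fix x y assume *: "x \<in> triangle n" "y \<in> triangle n" "rt x = rt y"
  obtain l k l' k' where xy: "x = (l, k)" "y = (l', k')"
    by (cases x, cases y)
  then have "l \<le> l' \<and> k' \<le> k" "l' \<le> l \<and> k \<le> k'"
    using triangle_order_if_crd_le[of l k l' k'] triangle_order_if_crd_le[of l' k' l k] * by auto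
  then show "x = y"
    using xy by simp
qed

definition up_closed :: "(int \<times> int) set \<Rightarrow> bool" where
  "up_closed U \<longleftrightarrow> (\<forall>l k l' k'. (l, k) \<in> U \<longrightarrow> (l', k') \<in> triangle n \<longrightarrow> l \<le> l' \<longrightarrow> k' \<le> k \<longrightarrow> (l', k') \<in> U)"

text \<open>Enlarging an interval by one point adds one simple root, so an ideal climbs the order
  one step at a time. Conversely, adding a positive root does not decrease any coordinate, and
  \<open>triangle_order\<close> turns this into inclusion of intervals.\<close>

lemma ideal_iff_up_closed:
  assumes "U \<subseteq> triangle n"
  shows "rt ` U \<in> ad_nilpotent_ideals \<Delta> S \<longleftrightarrow> up_closed U"
proof
  assume ideal: "rt ` U \<in> ad_nilpotent_ideals \<Delta> S"
  have step: "y \<in> U" if "x \<in> U" "y \<in> triangle n" "rt y = rt x + \<alpha> m" "m < n" for x y m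
  proof -
    have "rt y \<in> P"
      unfolding P_eq using that(2) by (rule imageI)
    then have "rt x + \<alpha> m \<in> \<Delta>"
      using that(3) P_subset by (metis subsetD)
    moreover have "\<alpha> m \<in> P"
      using that(4) S_eq simple_in_P by (metis imageI lessThan_iff)
    ultimately have "rt x + \<alpha> m \<in> rt ` U"
      using ideal that(1) by (simp add: ad_nilpotent_ideals_def)
    then show ?thesis
      using inj_on_image_mem_iff[OF inj_rt that(2) assms] that(3) by simp
  qed
  have right: "(l + int d, k) \<in> U" if "(l, k) \<in> U" "(l + int d, k) \<in> triangle n" for l k d
    using that(2)
  proof (induction d)
    case (Suc d)
    have lk: "1 \<le> l" "- l < k" "k < l"
      using that(1) assms by (auto simp: triangle_def)
    then have d: "(l + int d, k) \<in> triangle n" "nat (l + int d) < n"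
      using Suc.prems by (auto simp: triangle_def)
    show ?case
    proof (rule step[OF Suc.IH[OF d(1)] Suc.prems _ d(2)])
      show "rt (l + int (Suc d), k) = rt (l + int d, k) + \<alpha> (nat (l + int d))"
        using folded_sum_extend_right[of k "l + int d" r \<alpha>] lk by (simp add: algebra_simps)
    qed
  qed (use that in simp)
  have left: "(l, k - int d) \<in> U" if "(l, k) \<in> U" "(l, k - int d) \<in> triangle n" for l k d
    using that(2)
  proof (induction d)
    case (Suc d)
    have lk: "1 \<le> l" "- l < k" "k < l"
      using that(1) assms by (auto simp: triangle_def)
    then have d: "(l, k - int d) \<in> triangle n"
      using Suc.prems by (auto simp: triangle_def)
    have f: "fold_index r (k - int d - 1) < n"
      by (rule fold_index_less[OF Suc.prems _ r]) (use lk in auto)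
    show ?case
    proof (rule step[OF Suc.IH[OF d] Suc.prems _ f])
      show "rt (l, k - int (Suc d)) = rt (l, k - int d) + \<alpha> (fold_index r (k - int d - 1))"
        using folded_sum_extend_left[of "k - int d" l r \<alpha>] lk by (simp add: algebra_simps)
    qed
  qed (use that in simp)
  show "up_closed U"
    unfolding up_closed_def
  proof (intro allI impI)
    fix l k l' k' assume *: "(l, k) \<in> U" "(l', k') \<in> triangle n" "l \<le> l'" "k' \<le> k"
    have "(l, k) \<in> triangle n"
      using * assms by blast
    \<comment> \<open>The right end moves first: \<open>k'\<close> may be below \<open>- l\<close>,
      but with \<open>l'\<close> in place all intermediate pairs stay in the triangle.\<close>
    then have "(l + int (nat (l' - l)), k) \<in> triangle n"
      using * by (auto simp: triangle_def)
    then have "(l', k) \<in> U"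
      using right[OF *(1)] * by fastforce
    moreover have "(l', k - int (nat (k - k'))) \<in> triangle n"
      using * by simp
    ultimately have "(l', k - int (nat (k - k'))) \<in> U"
      by (rule left)
    then show "(l', k') \<in> U"
      using * by simp
  qed
next
  assume up: "up_closed U"
  show "rt ` U \<in> ad_nilpotent_ideals \<Delta> S"
    unfolding ad_nilpotent_ideals_def
  proof (intro CollectI conjI ballI impI)
    show "rt ` U \<subseteq> P"
      unfolding P_eq using assms by (rule image_mono)
    fix \<gamma> \<nu> assume \<gamma>: "\<gamma> \<in> rt ` U" and \<nu>: "\<nu> \<in> P" and sum: "\<gamma> + \<nu> \<in> \<Delta>"
    obtain l k where lk: "(l, k) \<in> U" "\<gamma> = rt (l, k)"
      using \<gamma> by (metis imageE surj_pair)
    have lkT: "(l, k) \<in> triangle n"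
      using lk assms by blast
    have \<gamma>P: "\<gamma> \<in> P"
      unfolding P_eq lk(2) using lkT by (rule imageI)
    have crd_add: "crd (\<gamma> + \<nu>) \<beta> = crd \<gamma> \<beta> + crd \<nu> \<beta>" for \<beta>
      by (rule linear_add[OF crd_linear])
    obtain \<beta> where "crd \<nu> \<beta> > 0"
      using exists_simple_inner_pos[OF \<nu>] by metis
    then have "crd (\<gamma> + \<nu>) \<beta> > 0"
      using crd_P_nonneg[OF \<gamma>P, of \<beta>] by (simp add: crd_add)
    then have "\<gamma> + \<nu> \<in> P"
      by (rule P_I[OF sum])
    then obtain l' k' where lk': "(l', k') \<in> triangle n" "\<gamma> + \<nu> = rt (l', k')"
      unfolding P_eq by (metis imageE surj_pair)
    have "crd (rt (l, k)) \<beta> \<le> crd (rt (l', k')) \<beta>" for \<beta>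
      unfolding lk'(2)[symmetric] lk(2)[symmetric] crd_add using crd_P_nonneg[OF \<nu>] by simp
    then have "l \<le> l' \<and> k' \<le> k"
      using triangle_order_if_crd_le[OF lkT lk'(1)] by simp
    then have "(l', k') \<in> U"
      using up lk(1) lk'(1) unfolding up_closed_def by metis
    then show "\<gamma> + \<nu> \<in> rt ` U"
      unfolding lk'(2) by (rule imageI)
  qed
qed

end

text \<open>Roots with the same interval correspond. Up-closedness refers to intervals only, and the
  simple root of index \<open>m\<close> is the interval \<open>{m..<m + 1}\<close> for either
  folding, so the values of \<open>r\<close> and \<open>r'\<close> may differ.\<close>

lemma card_ideals_folded_eq:
  assumes "folded_root_system \<Delta> S \<alpha> n r" "folded_root_system \<Delta>' S' \<alpha>' n r'"
  shows "card (ad_nilpotent_ideals_with \<Delta>' S' i) = card (ad_nilpotent_ideals_with \<Delta> S i)"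
proof -
  interpret A: folded_root_system \<Delta> S \<alpha> n r
    by (rule assms(1))
  interpret B: folded_root_system \<Delta>' S' \<alpha>' n r'
    by (rule assms(2))
  define h where "h = B.rt \<circ> inv_into (triangle n) A.rt"
  have h: "h (A.rt x) = B.rt x" if "x \<in> triangle n" for x
    using inv_into_f_f[OF A.inj_rt that] by (simp add: h_def)
  have h_image: "h ` A.rt ` U = B.rt ` U" if "U \<subseteq> triangle n" for U
    unfolding image_image by (rule image_cong[OF refl]) (use h that in blast)
  show ?thesis
  proof (rule card_ideals_transport)
    have "bij_betw (inv_into (triangle n) A.rt) A.P (triangle n)"
      unfolding A.P_eq by (rule bij_betw_inv_into) (rule inj_on_imp_bij_betw[OF A.inj_rt])
    moreover have "bij_betw B.rt (triangle n) B.P"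
      unfolding B.P_eq by (rule inj_on_imp_bij_betw[OF B.inj_rt])
    ultimately show "bij_betw h A.P B.P"
      unfolding h_def by (rule bij_betw_trans)
    show "S \<subseteq> A.P"
      using A.simple_in_P by blast
    have "h (\<alpha> m) = \<alpha>' m" if "m < n" for m
    proof -
      have "(int m + 1, int m) \<in> triangle n"
        using that by (auto simp: triangle_def)
      then show ?thesis
        using h[of "(int m + 1, int m)"] folded_sum_simple[of r \<alpha> m] folded_sum_simple[of r' \<alpha>' m] by simp
    qed
    then show "S' = h ` S"
      unfolding A.S_eq B.S_eq image_image by (intro image_cong) auto
    fix I assume "I \<subseteq> A.P"
    then obtain U where U: "U \<subseteq> triangle n" "I = A.rt ` U"
      unfolding A.P_eq by (metis subset_imageE)
    show "h ` I \<in> ad_nilpotent_ideals \<Delta>' S' \<longleftrightarrow> I \<in> ad_nilpotent_ideals \<Delta> S"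
      unfolding U(2) h_image[OF U(1)] A.ideal_iff_up_closed[OF U(1)] B.ideal_iff_up_closed[OF U(1)]
        A.up_closed_def B.up_closed_def ..
  qed
qed

subsection \<open>Root systems of type B and C in coordinates\<close>

text \<open>Type B for \<open>c = 1\<close>, type C for \<open>c = 2\<close>.\<close>

definition bc_roots :: "real \<Rightarrow> (nat \<Rightarrow> 'a) \<Rightarrow> nat \<Rightarrow> 'a::euclidean_space set" where
  "bc_roots c e n = {s *\<^sub>R c *\<^sub>R e i | s i. s \<in> {1, -1} \<and> i < n} \<union>
     {s *\<^sub>R e i + t *\<^sub>R e j | s t i j. s \<in> {1, -1} \<and> t \<in> {1, -1} \<and> i < n \<and> j < n \<and> i \<noteq> j}"

text \<open>The usual numbering reversed: the exceptional simple root comes first, at the point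
  around which the diagram is folded.\<close>

definition bc_simple :: "real \<Rightarrow> (nat \<Rightarrow> 'a) \<Rightarrow> nat \<Rightarrow> 'a::euclidean_space" where
  "bc_simple c e k = (if k = 0 then c *\<^sub>R e 0 else e k - e (k - 1))"

lemma bc_rootsI:
  "s \<in> {1, -1} \<Longrightarrow> i < n \<Longrightarrow> s *\<^sub>R c *\<^sub>R e i \<in> bc_roots c e n"
  "s \<in> {1, -1} \<Longrightarrow> t \<in> {1, -1} \<Longrightarrow> i < n \<Longrightarrow> j < n \<Longrightarrow> i \<noteq> j \<Longrightarrow> s *\<^sub>R e i + t *\<^sub>R e j \<in> bc_roots c e n"
  unfolding bc_roots_def by blast+

lemma bc_rootsE:
  assumes "v \<in> bc_roots c e n"
  obtains (single) s i where "v = s *\<^sub>R c *\<^sub>R e i" "s \<in> {1, -1}" "i < n"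
  | (pair) s t i j where "v = s *\<^sub>R e i + t *\<^sub>R e j" "s \<in> {1, -1}" "t \<in> {1, -1}" "j < i" "i < n"
proof -
  consider s i where "v = s *\<^sub>R c *\<^sub>R e i" "s \<in> {1, -1}" "i < n"
    | s t i j where "v = s *\<^sub>R e i + t *\<^sub>R e j" "s \<in> {1, -1}" "t \<in> {1, -1}" "i < n" "j < n" "i \<noteq> j"
    using assms unfolding bc_roots_def by blast
  then show thesis
  proof cases
    case 1
    then show thesis
      by (rule single)
  next
    case (2 s t i j)
    show thesis
    proof (cases "j < i")
      case True
      then show thesis
        using pair[of s i t j] 2 by blast
    next
      case False
      then have "i < j" "v = t *\<^sub>R e j + s *\<^sub>R e i"
        using 2 by auto
      then show thesis
        using pair[of t j s i] 2 by blast
    qed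
  qed
qed

lemma bc_roots_minus: "v \<in> bc_roots c e n \<Longrightarrow> - v \<in> bc_roots c e n"
proof (erule bc_rootsE)
  fix s :: real and i assume v: "v = s *\<^sub>R c *\<^sub>R e i" "s \<in> {1, -1}" "i < n"
  then have "- v = (- s) *\<^sub>R c *\<^sub>R e i"
    by simp
  then show ?thesis
    using bc_rootsI(1)[of "- s" i n c e] v by auto
next
  fix s t :: real and i j
  assume v: "v = s *\<^sub>R e i + t *\<^sub>R e j" "s \<in> {1, -1}" "t \<in> {1, -1}" "j < i" "i < n"
  then have "- v = (- s) *\<^sub>R e i + (- t) *\<^sub>R e j"
    by simp
  then show ?thesis
    using bc_rootsI(2)[of "- s" "- t" i n j e c] v by auto
qed

lemma bc_roots_signed_permutation:
  assumes "linear f" "v \<in> bc_roots c e n"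
    and "\<And>i. i < n \<Longrightarrow> \<sigma> i \<in> {1, -1} \<and> \<pi> i < n \<and> f (e i) = \<sigma> i *\<^sub>R e (\<pi> i)"
    and "inj_on \<pi> {..<n}"
  shows "f v \<in> bc_roots c e n"
  using assms(2)
proof (cases rule: bc_rootsE)
  case (single s i)
  then have "f v = (s * \<sigma> i) *\<^sub>R c *\<^sub>R e (\<pi> i)"
    using assms(3)[of i] by (simp add: linear_scale[OF assms(1)])
  moreover have "s * \<sigma> i \<in> {1, -1}"
    using single assms(3)[of i] by auto
  ultimately show ?thesis
    using bc_rootsI(1)[of "s * \<sigma> i" "\<pi> i" n c e] single assms(3)[of i] by simp
next
  case (pair s t i j)
  have ij: "i < n" "j < n"
    using pair by auto
  have "f v = (s * \<sigma> i) *\<^sub>R e (\<pi> i) + (t * \<sigma> j) *\<^sub>R e (\<pi> j)"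
    using pair assms(3)[OF ij(1)] assms(3)[OF ij(2)]
    by (simp add: linear_scale[OF assms(1)] linear_add[OF assms(1)])
  moreover have "s * \<sigma> i \<in> {1, -1}" "t * \<sigma> j \<in> {1, -1}"
    using pair assms(3)[OF ij(1)] assms(3)[OF ij(2)] by auto
  moreover have "\<pi> i \<noteq> \<pi> j"
    using assms(4) ij pair(4) by (auto dest: inj_onD)
  ultimately show ?thesis
    using bc_rootsI(2)[of "s * \<sigma> i" "t * \<sigma> j" "\<pi> i" n "\<pi> j" e c] assms(3)[OF ij(1)] assms(3)[OF ij(2)] by simp
qed

subsubsection \<open>Positive roots\<close>

text \<open>A potential whose increments are the folded simple roots, so that interval sums
  telescope. It runs through ..., \<open>- e 1\<close>, \<open>- e 0\<close>, \<open>e 0\<close>,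
  \<open>e 1\<close>, ..., with an additional 0 in the middle when \<open>r = 1\<close>; the middle
  increments give the root \<open>2 e 0\<close> of type C or twice the root \<open>e 0\<close> of
  type B.\<close>

definition fold_position :: "(nat \<Rightarrow> 'a) \<Rightarrow> int \<Rightarrow> int \<Rightarrow> 'a::euclidean_space" where
  "fold_position e r t =
     (if t \<ge> 1 then e (nat (t - 1)) else if r = 1 \<and> t = 0 then 0 else - e (nat (- t - r)))"

lemma bc_simple_fold:
  assumes "c = 1 \<and> r = 1 \<or> c = 2 \<and> r = 0"
  shows "bc_simple c e (fold_index r t) = fold_position e r (t + 1) - fold_position e r t"
proof -
  consider "t \<ge> 1" | "t = 0" | "t = -1" | "t \<le> -2"
    by linarith
  then show ?thesis
  proof cases
    case 1
    then have "nat t - 1 = nat (t - 1)" "nat t \<noteq> 0"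
      by auto
    then show ?thesis
      using 1 by (simp add: bc_simple_def fold_index_def fold_position_def)
  next
    case 4
    have "nat (- t - r) - 1 = nat (- t - 1 - r)" "nat (- t - r) \<noteq> 0" "- (t + 1) - r = - t - 1 - r"
      using 4 assms by auto
    then show ?thesis
      using 4 assms by (auto simp: bc_simple_def fold_index_def fold_position_def)
  qed (use assms in \<open>auto simp: bc_simple_def fold_index_def fold_position_def scaleR_2\<close>)
qed

lemma folded_sum_bc_simple:
  assumes "c = 1 \<and> r = 1 \<or> c = 2 \<and> r = 0" "k \<le> l"
  shows "folded_sum r (bc_simple c e) l k = fold_position e r l - fold_position e r k"
proof -
  have "folded_sum r (bc_simple c e) (k + int d) k = fold_position e r (k + int d) - fold_position e r k" for d
  proof (induction d)
    case (Suc d)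
    have "{k..<k + int (Suc d)} = insert (k + int d) {k..<k + int d}"
      by auto
    then have "folded_sum r (bc_simple c e) (k + int (Suc d)) k =
        bc_simple c e (fold_index r (k + int d)) + folded_sum r (bc_simple c e) (k + int d) k"
      by (simp add: folded_sum_def)
    then show ?case
      using Suc by (simp add: bc_simple_fold[OF assms(1)] algebra_simps)
  qed (simp add: folded_sum_def)
  from this[of "nat (l - k)"] show ?thesis
    using assms(2) by simp
qed

lemma folded_sum_in_bc_roots:
  assumes cr: "c = 1 \<and> r = 1 \<or> c = 2 \<and> r = 0" and lk: "(l, k) \<in> triangle n"
  shows "folded_sum r (bc_simple c e) l k \<in> bc_roots c e n"
proof -
  have b: "1 \<le> l" "l \<le> int n" "- l < k" "k < l"
    using lk by (auto simp: triangle_def)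
  have eq: "folded_sum r (bc_simple c e) l k = e (nat (l - 1)) - fold_position e r k"
    using folded_sum_bc_simple[OF cr, of k l e] b by (simp add: fold_position_def)
  have l: "nat (l - 1) < n"
    using b by linarith
  \<comment> \<open>According to the potential at \<open>k\<close>: a positive coordinate vector
    gives a difference, the middle 0 of type B or the exact mirror image of \<open>l\<close> in type
    C gives a multiple of one coordinate vector, anything else gives a sum.\<close>
  consider "k \<ge> 1" | "k = 0" "r = 1" | "k = 1 - l" "r = 0" | "k \<le> 0" "k - 1 + r \<noteq> - l" "k \<noteq> 0 \<or> r \<noteq> 1"
    using cr b by (cases "k \<ge> 1"; cases "k = 0"; cases "k = 1 - l") auto
  then show ?thesis
  proof cases
    case 1
    then have "folded_sum r (bc_simple c e) l k = 1 *\<^sub>R e (nat (l - 1)) + (- 1) *\<^sub>R e (nat (k - 1))"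
      using eq by (simp add: fold_position_def)
    moreover have "nat (k - 1) < n" "nat (l - 1) \<noteq> nat (k - 1)"
      using b 1 by linarith+
    ultimately show ?thesis
      using bc_rootsI(2)[of 1 "-1" "nat (l - 1)" n "nat (k - 1)"] l by simp
  next
    case 2
    then have "folded_sum r (bc_simple c e) l k = 1 *\<^sub>R c *\<^sub>R e (nat (l - 1))"
      using eq cr by (simp add: fold_position_def)
    then show ?thesis
      using bc_rootsI(1)[of 1 "nat (l - 1)" n] l by simp
  next
    case 3
    then have "folded_sum r (bc_simple c e) l k = 1 *\<^sub>R c *\<^sub>R e (nat (l - 1))"
      using eq cr b by (simp add: fold_position_def scaleR_2)
    then show ?thesis
      using bc_rootsI(1)[of 1 "nat (l - 1)" n] l by simp
  next
    case 4
    then have "folded_sum r (bc_simple c e) l k = 1 *\<^sub>R e (nat (l - 1)) + 1 *\<^sub>R e (nat (- k - r))"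
      using eq by (auto simp: fold_position_def)
    moreover have "nat (- k - r) < n" "nat (l - 1) \<noteq> nat (- k - r)"
      using b 4 cr by linarith+
    ultimately show ?thesis
      using bc_rootsI(2)[of 1 1 "nat (l - 1)" n "nat (- k - r)"] l by simp
  qed
qed

lemma bc_root_folded_sum:
  assumes cr: "c = 1 \<and> r = 1 \<or> c = 2 \<and> r = 0" and v: "v \<in> bc_roots c e n"
  obtains l k where "(l, k) \<in> triangle n"
    "v = folded_sum r (bc_simple c e) l k \<or> v = - folded_sum r (bc_simple c e) l k"
  using v
proof (cases rule: bc_rootsE)
  case (single s i)
  define l k where "l = int i + 1" and "k = (if r = 1 then 0 else - int i)"
  have "(l, k) \<in> triangle n"
    using single by (auto simp: triangle_def l_def k_def)
  moreover have "folded_sum r (bc_simple c e) l k = c *\<^sub>R e i"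
    using folded_sum_bc_simple[OF cr, of k l e] cr
    by (auto simp: l_def k_def fold_position_def scaleR_2)
  ultimately show thesis
    using that[of l k] single by auto
next
  case (pair s t i j)
  define l k where "l = int i + 1" and "k = (if s = t then - int j - r else int j + 1)"
  have k: "k \<le> l" "(l, k) \<in> triangle n"
    using pair cr by (auto simp: triangle_def l_def k_def)
  have "fold_position e r k = (if s = t then - e j else e j)"
    using cr by (auto simp: k_def fold_position_def)
  then have "folded_sum r (bc_simple c e) l k = (if s = t then e i + e j else e i - e j)"
    using folded_sum_bc_simple[OF cr k(1), of e] by (simp add: l_def fold_position_def)
  then show thesis
    using that[OF k(2)] pair by auto
qed

lemma bc_simple_span:
  assumes "c \<noteq> 0"
  shows "e ` {..<n} \<subseteq> span (bc_simple c e ` {..<n})"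
proof -
  have "e k \<in> span (bc_simple c e ` {..<n})" if "k < n" for k
    using that
  proof (induction k)
    case 0
    have "e 0 = (1 / c) *\<^sub>R bc_simple c e 0"
      using assms by (simp add: bc_simple_def)
    moreover have "bc_simple c e 0 \<in> bc_simple c e ` {..<n}"
      using 0 by simp
    ultimately show ?case
      by (metis span_base span_scale)
  next
    case (Suc k)
    have "e (Suc k) = bc_simple c e (Suc k) + e k"
      by (simp add: bc_simple_def)
    moreover have "bc_simple c e (Suc k) \<in> bc_simple c e ` {..<n}"
      using Suc.prems by blast
    ultimately show ?case
      using Suc by (metis Suc_lessD span_add span_base)
  qed
  then show ?thesis
    by blast
qed

lemma bc_folded_root_system:
  fixes e :: "nat \<Rightarrow> 'a::euclidean_space"
  assumes cr: "c = 1 \<and> r = 1 \<or> c = 2 \<and> r = 0" and root_system: "root_system (bc_roots c e n)"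
    and span: "span (e ` {..<n}) = UNIV" and n: "n = DIM('a)"
  shows "folded_root_system (bc_roots c e n) (bc_simple c e ` {..<n}) (bc_simple c e) n r"
proof -
  let ?\<alpha> = "bc_simple c e" and ?\<Delta> = "bc_roots c e n"
  let ?S = "bc_simple c e ` {..<n}"
  have r01: "r = 0 \<or> r = 1"
    using cr by blast
  have "c \<noteq> 0"
    using cr by auto
  then have span': "span ?S = UNIV"
    using bc_simple_span[of c e n] span span_minimal subspace_span by (metis top.extremum_uniqueI)
  \<comment> \<open>A spanning set indexed by \<open>n = DIM('a)\<close> elements: counting yields
    both injectivity of the indexing and independence.\<close>
  have card: "card ?S = n"
  proof (rule antisym)
    show "card ?S \<le> n"
      using card_image_le[of "{..<n}" ?\<alpha>] by simp
    have "dim (UNIV :: 'a set) \<le> card ?S"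
      by (rule dim_le_card) (use span' in auto)
    then show "n \<le> card ?S"
      using n by simp
  qed
  have inj: "inj_on ?\<alpha> {..<n}"
    by (rule eq_card_imp_inj_on) (use card in auto)
  have indep: "independent ?S"
    by (rule card_le_dim_spanning[of _ UNIV]) (use span' card n in auto)
  have pos: "folded_sum r ?\<alpha> l k \<in> positive_roots ?\<Delta> ?S" if lk: "(l, k) \<in> triangle n" for l k
  proof -
    have "folded_sum r ?\<alpha> l k = (\<Sum>m<n. real (fold_mult r l k m) *\<^sub>R ?\<alpha> m)"
      by (rule folded_sum_eq_sum_mult[OF lk r01])
    also have "\<dots> = (\<Sum>\<beta>\<in>?S. real (fold_mult r l k (inv_into {..<n} ?\<alpha> \<beta>)) *\<^sub>R \<beta>)"
      using inj by (simp add: sum.reindex inv_into_f_f)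
    finally have "\<exists>d :: 'a \<Rightarrow> nat. folded_sum r ?\<alpha> l k = (\<Sum>\<beta>\<in>?S. real (d \<beta>) *\<^sub>R \<beta>)"
      by (rule exI[of _ "\<lambda>\<beta>. fold_mult r l k (inv_into {..<n} ?\<alpha> \<beta>)"])
    moreover have "folded_sum r ?\<alpha> l k \<in> ?\<Delta>"
      by (rule folded_sum_in_bc_roots[OF cr lk])
    ultimately show ?thesis
      unfolding positive_roots_def mem_Collect_eq by (intro conjI)
  qed
  have simple: "is_simple_roots ?\<Delta> ?S"
    unfolding is_simple_roots_def
  proof (intro conjI ballI)
    show "?S \<subseteq> ?\<Delta>"
    proof (rule image_subsetI)
      fix m assume "m \<in> {..<n}"
      then have "(int m + 1, int m) \<in> triangle n"
        by (auto simp: triangle_def)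
      then have "folded_sum r ?\<alpha> (int m + 1) (int m) \<in> ?\<Delta>"
        by (rule folded_sum_in_bc_roots[OF cr])
      then show "?\<alpha> m \<in> ?\<Delta>"
        by (simp only: folded_sum_simple)
    qed
    fix \<beta> assume "\<beta> \<in> ?\<Delta>"
    then obtain l k where lk: "(l, k) \<in> triangle n" "\<beta> = folded_sum r ?\<alpha> l k \<or> \<beta> = - folded_sum r ?\<alpha> l k"
      by (rule bc_root_folded_sum[OF cr])
    from lk(2) show "\<beta> \<in> positive_roots ?\<Delta> ?S \<or> - \<beta> \<in> positive_roots ?\<Delta> ?S"
      using pos[OF lk(1)] by (elim disjE) simp_all
  qed (fact indep span')+
  interpret based_root_system ?\<Delta> ?S
    by (rule based_root_system.intro[OF root_system simple])
  have "P = (\<lambda>(l, k). folded_sum r ?\<alpha> l k) ` triangle n"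
  proof (intro equalityI subsetI)
    fix \<beta> assume \<beta>: "\<beta> \<in> P"
    have "\<beta> \<in> ?\<Delta>"
      by (rule subsetD[OF P_subset \<beta>])
    then obtain l k where lk: "(l, k) \<in> triangle n" "\<beta> = folded_sum r ?\<alpha> l k \<or> \<beta> = - folded_sum r ?\<alpha> l k"
      by (rule bc_root_folded_sum[OF cr])
    from lk(2) have "\<beta> = folded_sum r ?\<alpha> l k"
      using minus_notin_P[OF pos[OF lk(1)]] \<beta> by (elim disjE) simp_all
    then show "\<beta> \<in> (\<lambda>(l, k). folded_sum r ?\<alpha> l k) ` triangle n"
      using lk(1) by (intro image_eqI[of _ _ "(l, k)"]) simp_all
  next
    fix \<beta> assume "\<beta> \<in> (\<lambda>(l, k). folded_sum r ?\<alpha> l k) ` triangle n"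
    then obtain l k where "(l, k) \<in> triangle n" "\<beta> = folded_sum r ?\<alpha> l k"
      by auto
    then show "\<beta> \<in> P"
      using pos by simp
  qed
  then show ?thesis
    using r01 inj by unfold_locales simp_all
qed

subsection \<open>Recognition and duality\<close>

lemma reflection_fixes: "v \<bullet> \<alpha> = 0 \<Longrightarrow> reflection \<alpha> v = v"
  by (simp add: reflection_def inner_coroot)

text \<open>The common squared length \<open>M\<close> is left free because a root system comes with
  an arbitrary scale and dualising rescales \<open>e\<close> by \<open>1 / M\<close>.\<close>

locale scaled_orthonormal =
  fixes e :: "nat \<Rightarrow> 'a::euclidean_space" and n :: nat and M c :: real
  assumes orth: "i < n \<Longrightarrow> j < n \<Longrightarrow> e i \<bullet> e j = (if i = j then M else 0)"
    and M: "M > 0" and c: "c = 1 \<or> c = 2"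
begin

lemma reflection_single:
  assumes "k < n" "i < n"
  shows "reflection (c *\<^sub>R e k) (e i) = (if i = k then - 1 else 1) *\<^sub>R e i"
proof (cases "i = k")
  case True
  have "reflection (c *\<^sub>R e k) (e k) = reflection (e k) (e k)"
    using c by (intro reflection_scaleR_root) auto
  then show ?thesis
    using True by simp
next
  case False
  then show ?thesis
    using assms by (simp add: reflection_fixes orth)
qed

lemma reflection_difference:
  assumes "Suc k < n" "i < n"
  shows "reflection (e (Suc k) - e k) (e i) = e (Transposition.transpose k (Suc k) i)"
proof -
  let ?a = "e (Suc k) - e k"
  have a: "?a \<bullet> ?a = 2 * M"
    using assms by (simp add: inner_diff_left inner_diff_right orth)
  consider "i = k" | "i = Suc k" | "i \<noteq> k" "i \<noteq> Suc k"
    by blast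
  then show ?thesis
  proof cases
    case 1
    then have "e i \<bullet> coroot ?a = - 1"
      using assms a M by (simp add: inner_coroot inner_diff_right orth)
    then show ?thesis
      using 1 by (simp add: reflection_def)
  next
    case 2
    then have "e i \<bullet> coroot ?a = 1"
      using assms a M by (simp add: inner_coroot inner_diff_right orth)
    then show ?thesis
      using 2 by (simp add: reflection_def)
  next
    case 3
    then show ?thesis
      using assms by (simp add: reflection_fixes inner_diff_right orth Transposition.transpose_def)
  qed
qed

lemma reflection_bc_simple:
  assumes "k < n" "v \<in> bc_roots c e n"
  shows "reflection (bc_simple c e k) v \<in> bc_roots c e n"
proof (cases k)
  case 0
  show ?thesis
  proof (rule bc_roots_signed_permutation[OF linear_reflection assms(2)])
    show "(if i = 0 then - 1 else 1) \<in> {1, - 1 :: real} \<and> id i < n \<and>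
      reflection (bc_simple c e k) (e i) = (if i = 0 then - 1 else 1) *\<^sub>R e (id i)" if "i < n" for i
      using reflection_single[of 0 i] that assms(1) 0 by (simp add: bc_simple_def)
  qed simp
next
  case (Suc k')
  show ?thesis
  proof (rule bc_roots_signed_permutation[OF linear_reflection assms(2)])
    show "1 \<in> {1, - 1 :: real} \<and> Transposition.transpose k' k i < n \<and>
      reflection (bc_simple c e k) (e i) = 1 *\<^sub>R e (Transposition.transpose k' k i)" if "i < n" for i
      using reflection_difference[of k' i] that assms(1) Suc by (auto simp: bc_simple_def Transposition.transpose_def)
  qed simp
qed

text \<open>Roots \<open>e i + e j\<close> and \<open>e i - e j\<close> have squared length
  \<open>2 * M\<close>, so their coroots are just rescaled by \<open>1 / M\<close>; the coroot of
  \<open>c e i\<close> is \<open>(2 / c) / M\<close> times \<open>e i\<close>. Since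
  \<open>2 / c\<close> exchanges 1 and 2, types B and C are exchanged.\<close>

lemma dual_bc_roots: "dual_roots (bc_roots c e n) = bc_roots (2 / c) (\<lambda>i. (1 / M) *\<^sub>R e i) n"
proof -
  let ?f = "\<lambda>i. (1 / M) *\<^sub>R e i"
  have coroot_single: "coroot (s *\<^sub>R c *\<^sub>R e i) = s *\<^sub>R (2 / c) *\<^sub>R ?f i" if "s \<in> {1, -1}" "i < n" for s i
  proof -
    have "coroot (e i) = 2 *\<^sub>R ?f i"
      using that by (simp add: coroot_def orth)
    then show ?thesis
      using that(1) by (auto simp: coroot_scaleR)
  qed
  have coroot_pair: "coroot (s *\<^sub>R e i + t *\<^sub>R e j) = s *\<^sub>R ?f i + t *\<^sub>R ?f j"
    if "s \<in> {1, -1}" "t \<in> {1, -1}" "i < n" "j < n" "i \<noteq> j" for s t i j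
  proof -
    have "(s *\<^sub>R e i + t *\<^sub>R e j) \<bullet> (s *\<^sub>R e i + t *\<^sub>R e j) = 2 * M"
      using that by (auto simp: inner_add_left inner_add_right orth)
    then show ?thesis
      by (simp add: coroot_def scaleR_add_right mult.commute)
  qed
  show ?thesis
  proof (intro equalityI subsetI)
    fix w assume "w \<in> dual_roots (bc_roots c e n)"
    then obtain v where v: "v \<in> bc_roots c e n" "w = coroot v"
      by (auto simp: dual_roots_def)
    from v(1) show "w \<in> bc_roots (2 / c) ?f n"
    proof (cases rule: bc_rootsE)
      case (single s i)
      show ?thesis
        unfolding v(2) single(1) coroot_single[OF single(2,3)]
        by (rule bc_rootsI(1)[OF single(2,3)])
    next
      case (pair s t i j)
      have ij: "j < n" "i \<noteq> j"
        using pair by auto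
      show ?thesis
        unfolding v(2) pair(1) coroot_pair[OF pair(2,3,5) ij]
        by (rule bc_rootsI(2)[OF pair(2,3,5) ij])
    qed
  next
    fix w assume "w \<in> bc_roots (2 / c) ?f n"
    then show "w \<in> dual_roots (bc_roots c e n)"
    proof (cases rule: bc_rootsE)
      case (single s i)
      show ?thesis
        unfolding single(1) dual_roots_def coroot_single[OF single(2,3), symmetric]
        by (rule imageI[OF bc_rootsI(1)[OF single(2,3)]])
    next
      case (pair s t i j)
      have ij: "j < n" "i \<noteq> j"
        using pair by auto
      show ?thesis
        unfolding pair(1) dual_roots_def coroot_pair[OF pair(2,3,5) ij, symmetric]
        by (rule imageI[OF bc_rootsI(2)[OF pair(2,3,5) ij]])
    qed
  qed
qed

lemma independent_e: "inj_on e {..<n}" "independent (e ` {..<n})"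
proof -
  show "inj_on e {..<n}"
  proof (rule inj_onI)
    fix i j assume ij: "i \<in> {..<n}" "j \<in> {..<n}" "e i = e j"
    then have "e i \<bullet> e j = M"
      using orth[of j j] by simp
    then show "i = j"
      using orth[of i j] ij M by (simp split: if_splits)
  qed
  show "independent (e ` {..<n})"
  proof (rule pairwise_orthogonal_independent)
    show "pairwise orthogonal (e ` {..<n})"
      by (auto simp: pairwise_def orthogonal_def orth)
    show "0 \<notin> e ` {..<n}"
    proof
      assume "0 \<in> e ` {..<n}"
      then obtain i where "i < n" "e i = 0"
        by auto
      then show False
        using orth[of i i] M by simp
    qed
  qed
qed

text \<open>Reflections in \<open>e (Suc k) - e k\<close> move indices upward and the reflection in
  \<open>c e j\<close> flips one sign, so all these vectors are reached from the simple ones up to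
  negation.\<close>

lemma bc_roots_subset:
  assumes "root_system \<Delta>" "bc_simple c e ` {..<n} \<subseteq> \<Delta>"
  shows "bc_roots c e n \<subseteq> \<Delta>"
proof -
  have refl: "reflection \<alpha> \<beta> \<in> \<Delta>" if "\<alpha> \<in> \<Delta>" "\<beta> \<in> \<Delta>" for \<alpha> \<beta>
    using assms(1) that by (auto simp: root_system_def)
  have minus: "- \<beta> \<in> \<Delta>" if "\<beta> \<in> \<Delta>" for \<beta>
    using refl[OF that that] by simp
  have simple: "e (Suc k) - e k \<in> \<Delta>" if "Suc k < n" for k
  proof -
    have "bc_simple c e (Suc k) \<in> \<Delta>"
      using assms(2) that by blast
    then show ?thesis
      by (simp add: bc_simple_def)
  qed
  have mult_e: "c *\<^sub>R e i \<in> \<Delta>" if "i < n" for i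
    using that
  proof (induction i)
    case 0
    then have "bc_simple c e 0 \<in> \<Delta>"
      using assms(2) by blast
    then show ?case
      by (simp add: bc_simple_def)
  next
    case (Suc i)
    have "reflection (e (Suc i) - e i) (c *\<^sub>R e i) = c *\<^sub>R e (Suc i)"
      using reflection_difference[of i i] Suc.prems by (simp add: linear_scale[OF linear_reflection])
    then show ?case
      using refl[OF simple[OF Suc.prems], of "c *\<^sub>R e i"] Suc by simp
  qed
  have diff: "e i - e j \<in> \<Delta>" if "j < i" "i < n" for i j
    using that
  proof (induction i)
    case (Suc i)
    show ?case
    proof (cases "j = i")
      case True
      then show ?thesis
        using simple Suc.prems by simp
    next
      case False
      then have "j < i"
        using Suc.prems by simp
      then have "reflection (e (Suc i) - e i) (e i - e j) = e (Suc i) - e j"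
        using reflection_difference[of i i] reflection_difference[of i j] Suc.prems
        by (simp add: linear_diff[OF linear_reflection] Transposition.transpose_def)
      then show ?thesis
        using refl[OF simple[OF Suc.prems(2)], of "e i - e j"] Suc \<open>j < i\<close> by simp
    qed
  qed simp
  have sum: "e i + e j \<in> \<Delta>" if "j < i" "i < n" for i j
  proof -
    have "reflection (c *\<^sub>R e j) (e i - e j) = e i + e j"
      using reflection_single[of j i] reflection_single[of j j] that
      by (simp add: linear_diff[OF linear_reflection])
    then show ?thesis
      using refl[OF mult_e diff[OF that], of j] that by simp
  qed
  show ?thesis
  proof
    fix v assume "v \<in> bc_roots c e n"
    then show "v \<in> \<Delta>"
    proof (cases rule: bc_rootsE)
      case (single s i)
      then show ?thesis
        using mult_e[of i] minus[of "c *\<^sub>R e i"] by auto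
    next
      case (pair s t i j)
      have "- e i + e j = - (e i - e j)" "- e i - e j = - (e i + e j)"
        by simp_all
      then show ?thesis
        using pair diff[of j i] sum[of j i] minus[of "e i - e j"] minus[of "e i + e j"] by auto
    qed
  qed
qed

end

section \<open>Recognition from the base and the duality case by case\<close>

context based_root_system
begin

text \<open>The inner products of the base alone determine the root system:
  \<open>roots_generated\<close> gives one inclusion, \<open>bc_roots_subset\<close> the
  other.\<close>

lemma bc_recognition:
  assumes S_eq: "S = insert b (a ` {..<p})" and M: "M > 0" and c: "c = 1 \<or> c = 2"
    and norm_a: "\<And>i. i < p \<Longrightarrow> a i \<bullet> a i = 2 * M"
    and aa: "\<And>i j. i < j \<Longrightarrow> j < p \<Longrightarrow> a i \<bullet> a j = (if j = Suc i then - M else 0)"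
    and ab: "\<And>i. i < p \<Longrightarrow> a i \<bullet> b = (if i = 0 then - c * M else 0)" and norm_b: "b \<bullet> b = c * c * M"
  obtains e where "scaled_orthonormal e (Suc p) M c" "S = bc_simple c e ` {..<Suc p}"
    "\<Delta> = bc_roots c e (Suc p)"
proof -
  define e where "e k = (1 / c) *\<^sub>R b + (\<Sum>i<k. a i)" for k
  have c0: "c \<noteq> 0"
    using c by auto
  have e_Suc: "e (Suc k) = e k + a k" for k
    by (simp add: e_def)
  have ae: "a k \<bullet> e j = (if j = k then - M else 0)" if "j \<le> k" "k < p" for j k
    using that
  proof (induction j)
    case 0
    then show ?case
      using ab[of k] c0 by (simp add: e_def)
  next
    case (Suc j)
    then show ?case
      using aa[of j k] by (auto simp: e_Suc inner_add_right inner_commute[of "a k" "a j"])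
  qed
  have ee: "e i \<bullet> e j = (if i = j then M else 0)" if "j \<le> i" "i \<le> p" for i j
    using that
  proof (induction i arbitrary: j)
    case 0
    then show ?case
      using norm_b c0 by (simp add: e_def)
  next
    case (Suc i)
    show ?case
    proof (cases "j = Suc i")
      case True
      have "e i \<bullet> e i = M" "a i \<bullet> e i = - M"
        using Suc.IH[of i] Suc.prems ae[of i i] by simp_all
      then show ?thesis
        using True norm_a[of i] Suc.prems
        by (simp add: e_Suc inner_add_left inner_add_right inner_commute[of "e i" "a i"])
    next
      case False
      then have "j \<le> i"
        using Suc.prems by simp
      then show ?thesis
        using False Suc.IH[of j] Suc.prems ae[of j i] by (simp add: e_Suc inner_add_left)
    qed
  qed
  interpret scaled_orthonormal e "Suc p" M c
  proof
    show "e i \<bullet> e j = (if i = j then M else 0)" if "i < Suc p" "j < Suc p" for i j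
      using ee[of j i] ee[of i j] that by (cases "j \<le> i") (auto simp: inner_commute)
  qed (use M c in auto)
  have simple0: "bc_simple c e 0 = b"
    using c0 by (simp add: bc_simple_def e_def)
  have simple_Suc: "bc_simple c e (Suc k) = a k" for k
    by (simp add: bc_simple_def e_Suc)
  have S: "S = bc_simple c e ` {..<Suc p}"
    unfolding S_eq lessThan_Suc_eq_insert_0 by (simp add: simple0 image_image simple_Suc)
  have "\<Delta> \<subseteq> bc_roots c e (Suc p)"
  proof (rule roots_generated)
    show "S \<subseteq> bc_roots c e (Suc p)"
    proof
      fix v assume "v \<in> S"
      then obtain k where k: "k < Suc p" "v = bc_simple c e k"
        using S by auto
      show "v \<in> bc_roots c e (Suc p)"
      proof (cases k)
        case 0
        then show ?thesis
          using bc_rootsI(1)[of 1 0 "Suc p" c e] k by (simp add: bc_simple_def)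
      next
        case (Suc k')
        then show ?thesis
          using bc_rootsI(2)[of 1 "-1" k "Suc p" k' e c] k by (simp add: bc_simple_def)
      qed
    qed
  next
    fix \<alpha> v assume "\<alpha> \<in> S" "v \<in> bc_roots c e (Suc p)"
    then show "reflection \<alpha> v \<in> bc_roots c e (Suc p)"
      using reflection_bc_simple S by auto
  qed (rule bc_roots_minus)
  moreover have "bc_roots c e (Suc p) \<subseteq> \<Delta>"
    using bc_roots_subset[OF root_system] S S_subset by simp
  ultimately show thesis
    using that[OF scaled_orthonormal_axioms S] by blast
qed

text \<open>The system and its dual are both folded triangles of the same size, with the two
  foldings exchanged.\<close>

lemma card_ideals_dual_bc:
  assumes S': "is_simple_roots (dual_roots \<Delta>) S'"
    and e: "scaled_orthonormal e n M c" "S = bc_simple c e ` {..<n}" "\<Delta> = bc_roots c e n"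
  shows "card (ad_nilpotent_ideals_with \<Delta> S i) = card (ad_nilpotent_ideals_with (dual_roots \<Delta>) S' i)"
proof -
  interpret scaled_orthonormal e n M c
    by (rule e(1))
  let ?f = "\<lambda>i. (1 / M) *\<^sub>R e i"
  define r r' :: int where "r = (if c = 1 then 1 else 0)" and "r' = (if c = 1 then 0 else 1)"
  have cr: "c = 1 \<and> r = 1 \<or> c = 2 \<and> r = 0" "2 / c = 1 \<and> r' = 1 \<or> 2 / c = 2 \<and> r' = 0"
    using c by (auto simp: r_def r'_def)
  have "bc_simple c e k \<in> span (e ` {..<n})" if "k < n" for k
  proof -
    have "e 0 \<in> span (e ` {..<n})" "e k \<in> span (e ` {..<n})" "e (k - 1) \<in> span (e ` {..<n})"
      using that by (auto intro!: span_base)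
    then show ?thesis
      by (simp add: bc_simple_def span_diff span_scale)
  qed
  then have "S \<subseteq> span (e ` {..<n})"
    unfolding e(2) by blast
  then have span_e: "span (e ` {..<n}) = UNIV"
    using span span_minimal subspace_span by (metis top.extremum_uniqueI)
  have "dim (UNIV :: 'a set) = card (e ` {..<n})"
    using dim_eq_card[OF _ independent_e(2)] span_e by (metis span_UNIV)
  then have n: "n = DIM('a)"
    using independent_e(1) by (simp add: card_image)
  have "e k \<in> span (?f ` {..<n})" if "k < n" for k
  proof -
    have "e k = M *\<^sub>R ?f k"
      using M by simp
    moreover have "?f k \<in> ?f ` {..<n}"
      using that by (intro imageI) simp
    ultimately show ?thesis
      by (metis span_base span_scale)
  qed
  then have "e ` {..<n} \<subseteq> span (?f ` {..<n})"
    by blast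
  then have span_f: "span (?f ` {..<n}) = UNIV"
    using span_e span_minimal subspace_span by (metis top.extremum_uniqueI)
  have dual: "root_system (bc_roots (2 / c) ?f n)"
    using root_system_dual[OF root_system] unfolding e(3) dual_bc_roots .
  have A: "folded_root_system \<Delta> S (bc_simple c e) n r"
    unfolding e(2) e(3) by (rule bc_folded_root_system[OF cr(1) root_system[unfolded e(3)] span_e n])
  have B: "folded_root_system (bc_roots (2 / c) ?f n) (bc_simple (2 / c) ?f ` {..<n}) (bc_simple (2 / c) ?f) n r'"
    by (rule bc_folded_root_system[OF cr(2) dual span_f n])
  then have base': "is_simple_roots (dual_roots \<Delta>) (bc_simple (2 / c) ?f ` {..<n})"
    unfolding e(3) dual_bc_roots by (simp add: folded_root_system_def based_root_system_def)
  have "card (ad_nilpotent_ideals_with \<Delta> S i) =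
      card (ad_nilpotent_ideals_with (dual_roots \<Delta>) (bc_simple (2 / c) ?f ` {..<n}) i)"
    using card_ideals_folded_eq[OF A B, of i] unfolding e(3) dual_bc_roots by simp
  also have "\<dots> = card (ad_nilpotent_ideals_with (dual_roots \<Delta>) S' i)"
    by (rule card_ideals_base_independent[OF root_system_dual[OF root_system] base' S'])
  finally show ?thesis .
qed

lemma card_ideals_dual_long_arm:
  assumes S': "is_simple_roots (dual_roots \<Delta>) S'"
    and S_eq: "S = insert b (a ` {..<p})" and p: "0 < p"
    and aa: "\<And>i j. i < j \<Longrightarrow> j < p \<Longrightarrow> sgn (a i) \<bullet> sgn (a j) = (if j = Suc i then - 1 / 2 else 0)"
    and ab: "\<And>i. i < p \<Longrightarrow> sgn (a i) \<bullet> sgn b = (if i = 0 then - (sqrt 2 / 2) else 0)"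
    and norm_a: "\<And>i. i < p \<Longrightarrow> norm (a i) = norm (a 0)"
    and lengths: "a 0 \<bullet> a 0 = 2 * (b \<bullet> b) \<or> b \<bullet> b = 2 * (a 0 \<bullet> a 0)"
  shows "card (ad_nilpotent_ideals_with \<Delta> S i) = card (ad_nilpotent_ideals_with (dual_roots \<Delta>) S' i)"
proof -
  have nz: "a 0 \<noteq> 0" "b \<noteq> 0"
    using S_eq p S_subset zero_notin by auto
  have polar: "v \<bullet> w = norm v * norm w * (sgn v \<bullet> sgn w)" for v w :: 'a
    by (cases "v = 0 \<or> w = 0") (auto simp: sgn_div_norm field_simps)
  \<comment> \<open>\<open>M\<close> and \<open>c\<close> are read off from the lengths in
    coordinates, \<open>2 * M\<close> for the roots of the arm and \<open>c * c * M\<close> for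
    \<open>b\<close>: a short \<open>b\<close> gives type B, a long one type C.\<close>
  define M where "M = (a 0 \<bullet> a 0) / 2"
  define c :: real where "c = (if a 0 \<bullet> a 0 = 2 * (b \<bullet> b) then 1 else 2)"
  have M: "M > 0"
    using nz by (simp add: M_def)
  have a0: "norm (a 0) * norm (a 0) = 2 * M"
    by (simp add: M_def power2_norm_eq_inner flip: power2_eq_square)
  have bb: "b \<bullet> b = c * c * M"
    using lengths nz by (auto simp: c_def M_def)
  have "0 \<le> c"
    by (simp add: c_def)
  then have b: "norm b = c * sqrt M"
    using bb by (simp add: norm_eq_sqrt_inner real_sqrt_mult)
  have a: "norm (a 0) = sqrt 2 * sqrt M"
    by (simp add: norm_eq_sqrt_inner M_def real_sqrt_divide)
  obtain e where "scaled_orthonormal e (Suc p) M c" "S = bc_simple c e ` {..<Suc p}"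
    "\<Delta> = bc_roots c e (Suc p)"
  proof (rule bc_recognition[OF S_eq M])
    show "c = 1 \<or> c = 2"
      by (simp add: c_def)
    show "a i \<bullet> a i = 2 * M" if "i < p" for i
      using norm_a[OF that] a0 by (simp add: dot_square_norm power2_eq_square)
    show "a i \<bullet> a j = (if j = Suc i then - M else 0)" if "i < j" "j < p" for i j
      using norm_a[of i] norm_a[of j] that aa[OF that] a0 polar[of "a i" "a j"] by simp
    show "a i \<bullet> b = (if i = 0 then - c * M else 0)" if "i < p" for i
    proof -
      have "x * w * (c * w) * (x / 2) = (x * x) * (w * w) * c / 2" for x w :: real
        by simp
      from this[of "sqrt 2" "sqrt M"]
      have "norm (a 0) * norm b * (sqrt 2 / 2) = (sqrt 2 * sqrt 2) * (sqrt M * sqrt M) * c / 2"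
        unfolding a b .
      then have "norm (a 0) * norm b * (sqrt 2 / 2) = c * M"
        using M by simp
      then show ?thesis
        using norm_a[OF that] ab[OF that] polar[of "a i" b] by simp
    qed
  qed (use bb in auto)
  then show ?thesis
    by (rule card_ideals_dual_bc[OF S'])
qed

text \<open>Exchanging \<open>a i\<close> and \<open>b i\<close> keeps the angles because the cross
  products are symmetric, and always pairs a root of one length with one of the other, so the
  product of norms is constant.\<close>

lemma card_ideals_dual_equal_arms:
  fixes a b :: "nat \<Rightarrow> 'a"
  assumes S': "is_simple_roots (dual_roots \<Delta>) S'"
    and inj: "inj_on a {..<p}" "inj_on b {..<p}" and disj: "a ` {..<p} \<inter> b ` {..<p} = {}"
    and S_eq: "S = a ` {..<p} \<union> b ` {..<p}"
    and aa: "\<And>i j. i < j \<Longrightarrow> j < p \<Longrightarrow> sgn (a i) \<bullet> sgn (a j) = sgn (b i) \<bullet> sgn (b j)"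
    and ab: "\<And>i j. i < p \<Longrightarrow> j < p \<Longrightarrow> sgn (a i) \<bullet> sgn (b j) = sgn (a j) \<bullet> sgn (b i)"
    and norm: "\<And>i. i < p \<Longrightarrow> norm (a i) = norm (a 0)" "\<And>i. i < p \<Longrightarrow> norm (b i) = norm (b 0)"
  shows "card (ad_nilpotent_ideals_with \<Delta> S i) = card (ad_nilpotent_ideals_with (dual_roots \<Delta>) S' i)"
proof -
  define \<sigma> where "\<sigma> v = (if v \<in> a ` {..<p} then b (inv_into {..<p} a v) else a (inv_into {..<p} b v))" for v
  have \<sigma>: "\<sigma> (a i) = b i" "\<sigma> (b i) = a i" if "i < p" for i
  proof -
    have "b i \<notin> a ` {..<p}"
      using disj that by blast
    then show "\<sigma> (a i) = b i" "\<sigma> (b i) = a i"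
      using that inj by (simp_all add: \<sigma>_def inv_into_f_f)
  qed
  have cases: thesis if "\<And>i. i < p \<Longrightarrow> v = a i \<Longrightarrow> thesis" "\<And>i. i < p \<Longrightarrow> v = b i \<Longrightarrow> thesis" "v \<in> S" for v thesis
    using that S_eq by auto
  have unit: "sgn v \<bullet> sgn v = 1" if "v \<in> S" for v
  proof -
    have "v \<noteq> 0"
      using that S_subset zero_notin by auto
    then show ?thesis
      by (simp add: dot_square_norm norm_sgn)
  qed
  have aS: "a i \<in> S" "b i \<in> S" if "i < p" for i
    using that S_eq by auto
  have same: "sgn (a i) \<bullet> sgn (a j) = sgn (b i) \<bullet> sgn (b j)" if "i < p" "j < p" for i j
    using aa[of i j] aa[of j i] that unit[OF aS(1)[OF that(1)]] unit[OF aS(2)[OF that(1)]]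
    by (cases i j rule: linorder_cases) (auto simp: inner_commute)
  show ?thesis
  proof (rule card_ideals_dual_permutation[OF root_system base S'])
    have "\<sigma> ` a ` {..<p} = b ` {..<p}" "\<sigma> ` b ` {..<p} = a ` {..<p}"
      unfolding image_image using \<sigma> by (auto intro!: image_cong)
    then show "\<sigma> ` S = S"
      unfolding S_eq image_Un by blast
    show "norm v * norm (\<sigma> v) = norm (a 0) * norm (b 0)" if "v \<in> S" for v
    proof (rule cases[OF _ _ that])
      fix i assume i: "i < p" "v = a i"
      then show ?thesis
        unfolding i(2) \<sigma>(1)[OF i(1)] norm(1)[OF i(1)] norm(2)[OF i(1)] by simp
    next
      fix i assume i: "i < p" "v = b i"
      then show ?thesis
        unfolding i(2) \<sigma>(2)[OF i(1)] norm(1)[OF i(1)] norm(2)[OF i(1)] by simp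
    qed
    show "sgn (\<sigma> v) \<bullet> sgn (\<sigma> w) = sgn v \<bullet> sgn w" if v: "v \<in> S" and w: "w \<in> S" for v w
    proof (rule cases[OF _ _ v])
      fix i assume i: "i < p" "v = a i"
      show ?thesis
      proof (rule cases[OF _ _ w])
        fix j assume j: "j < p" "w = a j"
        show ?thesis
          unfolding i(2) j(2) \<sigma>(1)[OF i(1)] \<sigma>(1)[OF j(1)] using same[OF i(1) j(1)] by simp
      next
        fix j assume j: "j < p" "w = b j"
        show ?thesis
          unfolding i(2) j(2) \<sigma>(1)[OF i(1)] \<sigma>(2)[OF j(1)] using ab[OF i(1) j(1)] by (simp add: inner_commute)
      qed
    next
      fix i assume i: "i < p" "v = b i"
      show ?thesis
      proof (rule cases[OF _ _ w])
        fix j assume j: "j < p" "w = a j"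
        show ?thesis
          unfolding i(2) j(2) \<sigma>(2)[OF i(1)] \<sigma>(1)[OF j(1)] using ab[OF i(1) j(1)] by (simp add: inner_commute)
      next
        fix j assume j: "j < p" "w = b j"
        show ?thesis
          unfolding i(2) j(2) \<sigma>(2)[OF i(1)] \<sigma>(2)[OF j(1)] using same[OF i(1) j(1)] by simp
      qed
    qed
  qed
qed

end

text \<open>With p = x + 1 and q = y + 1 the bound reads 2xy + x + y < 1 for N = 3, so x = y = 0
  (type G2), and xy < 2 for N = 2, so one arm is a single root or x = y = 1 (type F4).\<close>

lemma arm_lengths:
  fixes p q N :: nat
  assumes "0 < p" "0 < q" "N = 2 \<or> N = 3" "N * (p * q) < (p + 1) * (q + 1)"
  shows "p = q \<or> N = 2 \<and> (p = 1 \<or> q = 1)"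
proof -
  obtain x y where xy: "p = Suc x" "q = Suc y"
    using assms(1,2) by (metis Suc_pred')
  show ?thesis
    using assms(3)
  proof
    assume N: "N = 3"
    then have "x = 0" "y = 0"
      using assms(4) unfolding xy by (auto simp: algebra_simps)
    then show ?thesis
      using xy by simp
  next
    assume N: "N = 2"
    then have xy1: "x * y < 2"
      using assms(4) unfolding xy by (simp add: algebra_simps)
    have "x = y" if "x \<noteq> 0" "y \<noteq> 0"
    proof -
      have "x \<le> x * y" "y \<le> x * y"
        using that by auto
      then show ?thesis
        using xy1 that by linarith
    qed
    then show ?thesis
      using N xy by auto
  qed
qed

lemma card_ideals_dual:
  assumes irr: "irreducible_root_system \<Delta>" and S: "is_simple_roots \<Delta> S"
    and S': "is_simple_roots (dual_roots \<Delta>) S'"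
  shows "card (ad_nilpotent_ideals_with \<Delta> S i) = card (ad_nilpotent_ideals_with (dual_roots \<Delta>) S' i)"
proof -
  have root_system: "root_system \<Delta>"
    using irr by (simp add: irreducible_root_system_def)
  interpret based_root_system \<Delta> S
    by (rule based_root_system.intro[OF root_system S])
  show ?thesis
  proof (cases "\<exists>r. \<forall>\<alpha>\<in>S. norm \<alpha> = r")
    case True
    then obtain r where r: "\<And>\<alpha>. \<alpha> \<in> S \<Longrightarrow> norm \<alpha> = r"
      by blast
    show ?thesis
    proof (rule card_ideals_dual_permutation[OF root_system S S'])
      show "(\<lambda>\<alpha>. \<alpha>) ` S = S"
        by simp
      show "norm \<alpha> * norm \<alpha> = r * r" if "\<alpha> \<in> S" for \<alpha>
        using r[OF that] by simp
    qed simp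
  next
    case False
    then show ?thesis
    proof (rule base_with_two_lengths[OF irr])
      fix a b :: "nat \<Rightarrow> 'a" and p q N :: nat
      assume pq: "0 < p" "0 < q" and inj: "inj_on a {..<p}" "inj_on b {..<q}"
        and disj: "a ` {..<p} \<inter> b ` {..<q} = {}" and S_eq: "S = a ` {..<p} \<union> b ` {..<q}"
        and aa: "\<And>i j. i < j \<Longrightarrow> j < p \<Longrightarrow> sgn (a i) \<bullet> sgn (a j) = (if j = Suc i then - 1 / 2 else 0)"
        and bb: "\<And>i j. i < j \<Longrightarrow> j < q \<Longrightarrow> sgn (b i) \<bullet> sgn (b j) = (if j = Suc i then - 1 / 2 else 0)"
        and ab: "\<And>i j. i < p \<Longrightarrow> j < q \<Longrightarrow> sgn (a i) \<bullet> sgn (b j) = (if i = 0 \<and> j = 0 then - (sqrt N / 2) else 0)"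
        and norm: "\<And>i. i < p \<Longrightarrow> norm (a i) = norm (a 0)" "\<And>i. i < q \<Longrightarrow> norm (b i) = norm (b 0)"
        and N: "N = 2 \<or> N = 3"
        and lengths: "a 0 \<bullet> a 0 = N * (b 0 \<bullet> b 0) \<or> b 0 \<bullet> b 0 = N * (a 0 \<bullet> a 0)"
        and bound: "N * (p * q) < (p + 1) * (q + 1)"
      consider "p = q" | "N = 2" "q = 1" | "N = 2" "p = 1"
        using arm_lengths[OF pq N bound] by blast
      then show ?thesis
      proof cases
        case 1
        show ?thesis
        proof (rule card_ideals_dual_equal_arms[OF S' inj(1) inj(2)[folded 1] disj[folded 1] S_eq[folded 1]])
          show "sgn (a i) \<bullet> sgn (a j) = sgn (b i) \<bullet> sgn (b j)" if "i < j" "j < p" for i j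
            using aa[OF that] bb[of i j] that 1 by simp
          show "sgn (a i) \<bullet> sgn (b j) = sgn (a j) \<bullet> sgn (b i)" if "i < p" "j < p" for i j
            using ab[of i j] ab[of j i] that 1 by auto
          show "norm (a i) = norm (a 0)" "norm (b i) = norm (b 0)" if "i < p" for i
            using norm(1)[OF that] norm(2)[OF that[unfolded 1]] by simp_all
        qed
      next
        case 2
        show ?thesis
        proof (rule card_ideals_dual_long_arm[OF S' _ pq(1)])
          show "S = insert (b 0) (a ` {..<p})"
            using S_eq 2 by (auto simp: lessThan_Suc)
          show "sgn (a i) \<bullet> sgn (b 0) = (if i = 0 then - (sqrt 2 / 2) else 0)" if "i < p" for i
            using ab[OF that pq(2)] 2 by simp
          show "a 0 \<bullet> a 0 = 2 * (b 0 \<bullet> b 0) \<or> b 0 \<bullet> b 0 = 2 * (a 0 \<bullet> a 0)"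
            using lengths 2 by simp
          show "sgn (a i) \<bullet> sgn (a j) = (if j = Suc i then - 1 / 2 else 0)" if "i < j" "j < p" for i j
            by (rule aa[OF that])
          show "norm (a i) = norm (a 0)" if "i < p" for i
            by (rule norm(1)[OF that])
        qed
      next
        case 3
        show ?thesis
        proof (rule card_ideals_dual_long_arm[OF S' _ pq(2)])
          show "S = insert (a 0) (b ` {..<q})"
            using S_eq 3 by (auto simp: lessThan_Suc)
          show "sgn (b i) \<bullet> sgn (a 0) = (if i = 0 then - (sqrt 2 / 2) else 0)" if "i < q" for i
            using ab[OF pq(1) that] 3 by (simp add: inner_commute)
          show "b 0 \<bullet> b 0 = 2 * (a 0 \<bullet> a 0) \<or> a 0 \<bullet> a 0 = 2 * (b 0 \<bullet> b 0)"
            using lengths 3 by auto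
          show "sgn (b i) \<bullet> sgn (b j) = (if j = Suc i then - 1 / 2 else 0)" if "i < j" "j < q" for i j
            by (rule bb[OF that])
          show "norm (b i) = norm (b 0)" if "i < q" for i
            by (rule norm(2)[OF that])
        qed
      qed
    qed
  qed
qed

subsection \<open>The standard root system of type B\<close>

lemma type_B_rootsI:
  "s \<in> {1, -1} \<Longrightarrow> s *\<^sub>R axis i 1 \<in> type_B_roots"
  "s \<in> {1, -1} \<Longrightarrow> t \<in> {1, -1} \<Longrightarrow> i \<noteq> j \<Longrightarrow> s *\<^sub>R axis i 1 + t *\<^sub>R axis j 1 \<in> type_B_roots"
  unfolding type_B_roots_def by (intro UnI1 UnI2 CollectI exI conjI; (rule refl | assumption))+

lemma type_B_rootsE:
  assumes "v \<in> type_B_roots"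
  obtains (single) s i where "s \<in> {1, -1}" "v = s *\<^sub>R axis i 1"
  | (pair) s t i j where "s \<in> {1, -1}" "t \<in> {1, -1}" "i \<noteq> j" "v = s *\<^sub>R axis i 1 + t *\<^sub>R axis j 1"
  using assms unfolding type_B_roots_def by blast

lemma type_C_rootsI:
  "s \<in> {1, -1} \<Longrightarrow> s *\<^sub>R axis i 2 \<in> type_C_roots"
  "s \<in> {1, -1} \<Longrightarrow> t \<in> {1, -1} \<Longrightarrow> i \<noteq> j \<Longrightarrow> s *\<^sub>R axis i 1 + t *\<^sub>R axis j 1 \<in> type_C_roots"
  unfolding type_C_roots_def by (intro UnI1 UnI2 CollectI exI conjI; (rule refl | assumption))+

lemma type_C_rootsE:
  assumes "v \<in> type_C_roots"
  obtains (single) s i where "s \<in> {1, -1}" "v = s *\<^sub>R axis i 2"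
  | (pair) s t i j where "s \<in> {1, -1}" "t \<in> {1, -1}" "i \<noteq> j" "v = s *\<^sub>R axis i 1 + t *\<^sub>R axis j 1"
  using assms unfolding type_C_roots_def by blast

lemma axis_signed: "s *\<^sub>R axis i (x :: real) = axis i (s * x)"
  by (auto simp: vec_eq_iff axis_def)

lemma Ints_square_le_2:
  assumes "x \<in> \<int>" "x\<^sup>2 \<le> (2 :: real)" "x \<noteq> 0"
  shows "x = 1 \<or> x = -1"
proof -
  obtain z :: int where z: "x = of_int z"
    using assms(1) by (elim Ints_cases)
  have "\<bar>z\<bar> < 2"
  proof (rule ccontr)
    assume "\<not> \<bar>z\<bar> < 2"
    then have "2 \<le> \<bar>x\<bar>"
      using z by linarith
    then have "2\<^sup>2 \<le> \<bar>x\<bar>\<^sup>2"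
      by (rule power_mono) simp
    then show False
      using assms(2) by simp
  qed
  then have "z = 1 \<or> z = -1"
    using assms(3) z by auto
  then show ?thesis
    using z by auto
qed

lemma inner_vec_self: "v \<bullet> v = (\<Sum>i\<in>UNIV. (v $ i)\<^sup>2)" for v :: "real ^ 'n"
  by (simp add: inner_vec_def power2_eq_square)

lemma sum_squares_zero:
  assumes "(\<Sum>i\<in>A. (x i :: real)\<^sup>2) = 0" "finite A" "i \<in> A"
  shows "x i = 0"
  using sum_nonneg_eq_0_iff[OF assms(2), of "\<lambda>i. (x i)\<^sup>2"] assms(1,3) by simp

text \<open>In this form stability under reflections is immediate. For the converse inclusion,
  squared length at most 2 leaves room for at most two nonzero integral coordinates, each of them 1
  or -1.\<close>

lemma type_B_roots_eq:
  "(type_B_roots :: (real ^ 'n) set) = {v. (\<forall>i. v $ i \<in> \<int>) \<and> (v \<bullet> v = 1 \<or> v \<bullet> v = 2)}"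
proof (intro equalityI subsetI)
  fix v :: "real ^ 'n" assume "v \<in> type_B_roots"
  then have "v $ i \<in> \<int>" for i
    unfolding type_B_roots_def by (auto simp: axis_def)
  moreover have "v \<bullet> v = 1 \<or> v \<bullet> v = 2"
    using \<open>v \<in> type_B_roots\<close> unfolding type_B_roots_def
    by (auto simp: inner_axis_axis inner_add_left inner_add_right inner_diff_left inner_diff_right)
  ultimately show "v \<in> {v. (\<forall>i. v $ i \<in> \<int>) \<and> (v \<bullet> v = 1 \<or> v \<bullet> v = 2)}"
    by simp
next
  fix v :: "real ^ 'n" assume "v \<in> {v. (\<forall>i. v $ i \<in> \<int>) \<and> (v \<bullet> v = 1 \<or> v \<bullet> v = 2)}"
  then have int: "v $ i \<in> \<int>" and vv: "v \<bullet> v = 1 \<or> v \<bullet> v = 2" for i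
    by auto
  have unit: "v $ i = 1 \<or> v $ i = -1" if "v $ i \<noteq> 0" for i
  proof (rule Ints_square_le_2[OF int _ that])
    have "(v $ i)\<^sup>2 \<le> (\<Sum>i\<in>UNIV. (v $ i)\<^sup>2)"
      by (rule member_le_sum) auto
    then show "(v $ i)\<^sup>2 \<le> 2"
      using vv by (auto simp: inner_vec_self)
  qed
  have "v \<noteq> 0"
    using vv by auto
  then obtain i where i: "v $ i \<noteq> 0"
    by (auto simp: vec_eq_iff)
  have vi: "(v $ i)\<^sup>2 = 1"
    using unit[OF i] by auto
  have rest: "v \<bullet> v = 1 + (\<Sum>j\<in>UNIV - {i}. (v $ j)\<^sup>2)"
    unfolding inner_vec_self using vi by (subst sum.remove[of _ i]) auto
  show "v \<in> type_B_roots"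
  proof (cases "\<exists>j. j \<noteq> i \<and> v $ j \<noteq> 0")
    case False
    then have eq: "(v $ i) *\<^sub>R axis i 1 = v"
      by (auto simp: vec_eq_iff axis_def)
    have "(v $ i) *\<^sub>R axis i 1 \<in> type_B_roots"
      by (rule type_B_rootsI(1)) (use unit[OF i] in blast)
    then show ?thesis
      by (simp only: eq)
  next
    case True
    then obtain j where j: "j \<noteq> i" "v $ j \<noteq> 0"
      by blast
    have "(v $ j)\<^sup>2 = 1"
      using unit[OF j(2)] by auto
    then have "(\<Sum>j\<in>UNIV - {i}. (v $ j)\<^sup>2) = 1 + (\<Sum>k\<in>UNIV - {i} - {j}. (v $ k)\<^sup>2)"
      using j(1) by (subst sum.remove[of _ j]) auto
    moreover have "0 \<le> (\<Sum>k\<in>UNIV - {i} - {j}. (v $ k)\<^sup>2)"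
      by (rule sum_nonneg) simp
    ultimately have "(\<Sum>k\<in>UNIV - {i} - {j}. (v $ k)\<^sup>2) = 0"
      using vv rest by linarith
    then have "v $ k = 0" if "k \<noteq> i" "k \<noteq> j" for k
      using sum_squares_zero[of "\<lambda>k. v $ k" "UNIV - {i} - {j}" k] that by simp
    then have eq: "(v $ i) *\<^sub>R axis i 1 + (v $ j) *\<^sub>R axis j 1 = v"
      using j(1) by (auto simp: vec_eq_iff axis_def)
    have "(v $ i) *\<^sub>R axis i 1 + (v $ j) *\<^sub>R axis j 1 \<in> type_B_roots"
      by (rule type_B_rootsI(2)) (use unit[OF i] unit[OF j(2)] j(1) in blast)+
    then show ?thesis
      by (simp only: eq)
  qed
qed

lemma finite_type_B_roots: "finite (type_B_roots :: (real ^ 'n) set)"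
proof (rule finite_subset)
  let ?s = "{1, -1 :: real}"
  let ?F = "(\<lambda>(s, i). s *\<^sub>R axis i 1) ` (?s \<times> UNIV) \<union>
      (\<lambda>(s, t, i, j). s *\<^sub>R axis i 1 + t *\<^sub>R axis j 1) ` (?s \<times> ?s \<times> UNIV \<times> UNIV) :: (real ^ 'n) set"
  show "type_B_roots \<subseteq> ?F"
  proof
    fix v :: "real ^ 'n" assume "v \<in> type_B_roots"
    then show "v \<in> ?F"
    proof (cases rule: type_B_rootsE)
      case (single s i)
      then show ?thesis
        by (intro UnI1 image_eqI[of _ _ "(s, i)"]) simp_all
    next
      case (pair s t i j)
      then show ?thesis
        by (intro UnI2 image_eqI[of _ _ "(s, t, i, j)"]) simp_all
    qed
  qed
  show "finite ?F"
    by simp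
qed

lemma type_B_pairing:
  assumes "\<alpha> \<in> type_B_roots" "\<beta> \<in> (type_B_roots :: (real ^ 'n) set)"
  shows "\<beta> \<bullet> coroot \<alpha> \<in> \<int>"
proof -
  have "\<beta> \<bullet> \<alpha> \<in> \<int>"
    using assms by (auto simp: type_B_roots_eq inner_vec_def intro!: Ints_sum Ints_mult)
  moreover have "\<beta> \<bullet> coroot \<alpha> = 2 * (\<beta> \<bullet> \<alpha>) \<or> \<beta> \<bullet> coroot \<alpha> = \<beta> \<bullet> \<alpha>"
    using assms(1) by (auto simp: type_B_roots_eq inner_coroot)
  ultimately show ?thesis
    by (auto intro: Ints_mult)
qed

lemma axis_in_type_B_roots: "axis i 1 \<in> type_B_roots"
proof -
  show ?thesis
    using type_B_rootsI(1)[of 1 i] by simp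
qed

lemma root_system_type_B: "root_system (type_B_roots :: (real ^ 'n) set)"
  unfolding root_system_def
proof (intro conjI ballI allI impI)
  show "finite (type_B_roots :: (real ^ 'n) set)"
    by (rule finite_type_B_roots)
  show "(0 :: real ^ 'n) \<notin> type_B_roots"
    by (simp add: type_B_roots_eq)
  have "(Basis :: (real ^ 'n) set) \<subseteq> type_B_roots"
    using axis_in_type_B_roots by (auto simp: Basis_vec_def)
  then show "span (type_B_roots :: (real ^ 'n) set) = UNIV"
    using span_mono span_Basis by (metis top.extremum_uniqueI)
  fix \<alpha> \<beta> :: "real ^ 'n" assume *: "\<alpha> \<in> type_B_roots" "\<beta> \<in> type_B_roots"
  show int: "\<beta> \<bullet> coroot \<alpha> \<in> \<int>"
    by (rule type_B_pairing[OF *])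
  \<comment> \<open>An integral pairing keeps the coordinates integral; the length is preserved by
    any reflection.\<close>
  have "reflection \<alpha> \<beta> $ i \<in> \<int>" for i
    using * int by (auto simp: type_B_roots_eq reflection_def intro!: Ints_diff Ints_mult)
  then show "reflection \<alpha> \<beta> \<in> type_B_roots"
    using * by (simp add: type_B_roots_eq reflection_inner)
next
  fix \<alpha> :: "real ^ 'n" and c :: real
  assume \<alpha>: "\<alpha> \<in> type_B_roots" and c\<alpha>: "c *\<^sub>R \<alpha> \<in> type_B_roots"
  then have "\<alpha> \<noteq> 0"
    by (auto simp: type_B_roots_eq)
  then obtain i where i: "\<alpha> $ i \<noteq> 0"
    by (auto simp: vec_eq_iff)
  \<comment> \<open>A coordinate equal to 1 or -1 turns integrality of
    \<open>c *\<^sub>R \<alpha>\<close> into integrality of \<open>c\<close>, and comparing lengths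
    bounds \<open>c\<^sup>2\<close> by 2.\<close>
  have "(\<alpha> $ i)\<^sup>2 \<le> (\<Sum>i\<in>UNIV. (\<alpha> $ i)\<^sup>2)"
    by (rule member_le_sum) auto
  then have "\<alpha> $ i = 1 \<or> \<alpha> $ i = - 1"
    using \<alpha> i by (intro Ints_square_le_2) (auto simp: type_B_roots_eq inner_vec_self)
  moreover have "c * \<alpha> $ i \<in> \<int>"
    using c\<alpha> by (auto simp: type_B_roots_eq)
  ultimately have "c \<in> \<int>"
    by (auto simp: minus_in_Ints_iff)
  moreover have "c\<^sup>2 * (\<alpha> \<bullet> \<alpha>) = 1 \<or> c\<^sup>2 * (\<alpha> \<bullet> \<alpha>) = 2"
    using c\<alpha> by (auto simp: type_B_roots_eq power2_eq_square)
  then have "c\<^sup>2 \<le> 2" "c \<noteq> 0"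
    using \<alpha> by (auto simp: type_B_roots_eq)
  ultimately show "c = 1 \<or> c = - 1"
    by (intro Ints_square_le_2)
qed

text \<open>A part containing a root with nonzero coordinate \<open>i\<close> also contains
  \<open>axis i 1\<close>, which is not orthogonal to that root. So each part contains a coordinate
  vector, and the sum of the two is orthogonal to neither, hence fits in no part.\<close>

lemma irreducible_type_B: "irreducible_root_system (type_B_roots :: (real ^ 'n) set)"
  unfolding irreducible_root_system_def
proof (intro conjI notI; (elim exE conjE)?)
  show "root_system (type_B_roots :: (real ^ 'n) set)"
    by (rule root_system_type_B)
next
  fix A B :: "(real ^ 'n) set"
  assume ne: "A \<noteq> {}" "B \<noteq> {}" and un: "A \<union> B = type_B_roots" and disj: "A \<inter> B = {}"
    and "\<forall>\<alpha>\<in>A. \<forall>\<beta>\<in>B. \<alpha> \<bullet> \<beta> = 0"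
  then have orth: "\<alpha> \<bullet> \<beta> = 0" if "\<alpha> \<in> A" "\<beta> \<in> B" for \<alpha> \<beta>
    using that by blast
  have axis: "\<exists>i. axis i 1 \<in> C" if C: "\<alpha> \<in> C" "C \<union> D = type_B_roots" "\<And>\<beta>. \<beta> \<in> D \<Longrightarrow> \<alpha> \<bullet> \<beta> = 0"
    for C D and \<alpha> :: "real ^ 'n"
  proof -
    have "\<alpha> \<in> type_B_roots"
      using C(1,2) by blast
    then have "\<alpha> \<noteq> 0"
      by (auto simp: type_B_roots_eq)
    then obtain i where "\<alpha> $ i \<noteq> 0"
      by (auto simp: vec_eq_iff)
    then have "axis i 1 \<notin> D"
      using C(3)[of "axis i 1"] by (auto simp: inner_axis)
    then show ?thesis
      using axis_in_type_B_roots[of i] C(2) by blast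
  qed
  obtain \<alpha> where \<alpha>: "\<alpha> \<in> A"
    using ne(1) by blast
  obtain i where i: "axis i 1 \<in> A"
    using axis[OF \<alpha> un orth[OF \<alpha>]] by blast
  obtain \<beta> where \<beta>: "\<beta> \<in> B"
    using ne(2) by blast
  obtain j where j: "axis j 1 \<in> B"
    using axis[OF \<beta> un[unfolded Un_commute[of A]]] orth[OF _ \<beta>] by (auto simp: inner_commute)
  have "i \<noteq> j"
    using i j disj by blast
  then have "axis i 1 + axis j 1 \<in> A \<union> B"
    unfolding un using type_B_rootsI(2)[of 1 1 i j] by simp
  then show False
  proof
    assume "axis i 1 + axis j 1 \<in> A"
    then have "(axis i 1 + axis j 1) \<bullet> axis j (1 :: real) = 0"
      using j by (rule orth)
    then show False
      using \<open>i \<noteq> j\<close> by (simp add: inner_add_left inner_axis_axis)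
  next
    assume "axis i 1 + axis j 1 \<in> B"
    then have "axis i (1 :: real) \<bullet> (axis i 1 + axis j 1) = 0"
      by (rule orth[OF i])
    then show False
      using \<open>i \<noteq> j\<close> by (simp add: inner_add_right inner_axis_axis)
  qed
qed

lemma dual_type_B: "dual_roots type_B_roots = (type_C_roots :: (real ^ 'n) set)"
proof -
  let ?s = "{1, -1 :: real}"
  have coroot_single: "coroot (s *\<^sub>R axis i (1 :: real)) = s *\<^sub>R axis i 2" if "s \<in> ?s" for s and i :: 'n
    using that by (auto simp: coroot_def inner_axis_axis axis_signed)
  have coroot_pair: "coroot (s *\<^sub>R axis i (1 :: real) + t *\<^sub>R axis j 1) = s *\<^sub>R axis i 1 + t *\<^sub>R axis j 1"
    if "s \<in> ?s" "t \<in> ?s" "i \<noteq> j" for s t and i j :: 'n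
  proof -
    let ?v = "s *\<^sub>R axis i 1 + t *\<^sub>R axis j (1 :: real)"
    have v: "?v \<bullet> ?v = 2"
      using that by (auto simp: inner_add_left inner_add_right inner_axis_axis)
    show ?thesis
      unfolding coroot_def v by simp
  qed
  show ?thesis
    unfolding dual_roots_def
  proof (intro equalityI subsetI)
    fix w :: "real ^ 'n" assume "w \<in> coroot ` type_B_roots"
    then obtain v where v: "v \<in> type_B_roots" "w = coroot v"
      by (rule imageE) simp
    from v(1) show "w \<in> type_C_roots"
    proof (cases rule: type_B_rootsE)
      case (single s i)
      show ?thesis
        unfolding v(2) single(2) coroot_single[OF single(1)] by (rule type_C_rootsI(1)[OF single(1)])
    next
      case (pair s t i j)
      show ?thesis
        unfolding v(2) pair(4) coroot_pair[OF pair(1-3)] by (rule type_C_rootsI(2)[OF pair(1-3)])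
    qed
  next
    fix w :: "real ^ 'n" assume "w \<in> type_C_roots"
    then show "w \<in> coroot ` type_B_roots"
    proof (cases rule: type_C_rootsE)
      case (single s i)
      show ?thesis
        unfolding single(2) coroot_single[OF single(1), symmetric]
        by (rule imageI[OF type_B_rootsI(1)[OF single(1)]])
    next
      case (pair s t i j)
      have "coroot (s *\<^sub>R axis i (1 :: real) + t *\<^sub>R axis j 1) \<in> coroot ` type_B_roots"
        by (rule imageI[OF type_B_rootsI(2)[OF pair(1-3)]])
      then show ?thesis
        unfolding pair(4) coroot_pair[OF pair(1-3)] .
    qed
  qed
qed

theorem mainTheorem7:
  shows "(\<forall>(\<Delta> :: 'a::euclidean_space set) S S'.
            irreducible_root_system \<Delta> \<and> is_simple_roots \<Delta> S \<and> is_simple_roots (dual_roots \<Delta>) S'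
            \<longrightarrow> simple_root_polynomial \<Delta> S = simple_root_polynomial (dual_roots \<Delta>) S')
       \<and> (\<forall>(S\<^sub>B :: (real ^ 'n) set) (S\<^sub>C :: (real ^ 'n) set).
            is_simple_roots type_B_roots S\<^sub>B \<and> is_simple_roots type_C_roots S\<^sub>C
            \<longrightarrow> (\<forall>i. card (ad_nilpotent_ideals_with type_B_roots S\<^sub>B i) =
                     card (ad_nilpotent_ideals_with type_C_roots S\<^sub>C i)))"
proof (intro conjI allI impI)
  fix \<Delta> S S' :: "'a set"
  assume *: "irreducible_root_system \<Delta> \<and> is_simple_roots \<Delta> S \<and> is_simple_roots (dual_roots \<Delta>) S'"
  then have "root_system \<Delta>" "root_system (dual_roots \<Delta>)"
    using root_system_dual by (auto simp: irreducible_root_system_def)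
  then show "simple_root_polynomial \<Delta> S = simple_root_polynomial (dual_roots \<Delta>) S'"
    using * card_ideals_dual by (intro simple_root_polynomial_eqI) (auto simp: root_system_def)
next
  fix S\<^sub>B S\<^sub>C :: "(real ^ 'n) set" and i
  assume "is_simple_roots type_B_roots S\<^sub>B \<and> is_simple_roots type_C_roots S\<^sub>C"
  then show "card (ad_nilpotent_ideals_with type_B_roots S\<^sub>B i) =
      card (ad_nilpotent_ideals_with type_C_roots S\<^sub>C i)"
    using card_ideals_dual[OF irreducible_type_B, of S\<^sub>B S\<^sub>C i] by (simp add: dual_type_B)
qed

end
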